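(* Let $B_5\subset\mathbb P^6$ be the del Pezzo threefold, over a number field, and let $H_1,H_2$ be two hyperplane sections of $B_5$, defined over that number field, which have a smooth conic in common (i.e. $H_1\cap H_2$ contains a smooth conic). Then the set of integral points of $B_5\setminus(H_1\cup H_2)$ is potentially dense.
   Context: The del Pezzo threefold $B_5\subset\mathbb P^6$ is the smooth Fano threefold of Picard rank $1$, index $2$ and degree $5$ obtained as a transversal section of the Grassmannian $\mathbb G(2,5)\subset\mathbb P^9$ (Plücker embedding) by a linear subspace of codimension $3$; it is unique up to isomorphism over an algebraically closed field of characteristic $0$. Let $X\subset\mathbb P^n$ be a projective variety over a number field $\mathbb K$, let $D\subset X$ be a proper closed algebraic subset and let $X^o=X\setminus D$. For a finite set $S$ of places of $\mathbb K$ containing the archimedean ones, a point $P\in X^o(\mathbb K)$ is $S$-integral with respect to $D$ if for no place $\nu\notin S$ does $P$ reduce modulo $\nu$ to a point of $D$. The integral points of $X^o$ are potentially dense if, after replacing $\mathbb K$ by a suitable finite extension and enlarging the finite set $S$ suitably, the set of $S$-integral points of $X^o$ is Zariski-dense. *)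

theory Defs
  imports
    "HOL-Analysis.Analysis"
    "HOL-Library.Poly_Mapping"
    "HOL-Algebra.Algebraic_Closure_Type"
    "HOL-Algebra.Embedded_Algebras"
begin

text \<open>
  Conventions. Number fields are subfields of the complex numbers; every number field embeds, and
  every finite extension of a number field in \<open>\<complex>\<close> embeds compatibly. Geometric points have complex
  coordinates. A point of projective space is given by a nonzero vector of homogeneous coordinates,
  and a subset of projective space by the set of all homogeneous coordinate vectors of its points;
  thus subsets of projective \<open>n\<close>-space live in \<open>complex ^ 'n\<close> with \<open>n + 1\<close> coordinates.
\<close>

section \<open>Number fields and their finite places\<close>

abbreviation complex_ring :: "complex ring" where
  "complex_ring \<equiv> ring_of_type_algebra"

definition number_field :: "complex set \<Rightarrow> bool" where
  "number_field K \<longleftrightarrow> subfield K complex_ring \<and> ring.finite_dimension complex_ring \<rat> K"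

definition integers_of :: "complex set \<Rightarrow> complex set" where
  "integers_of K = {x \<in> K. algebraic_int x}"

definition finite_places :: "complex set \<Rightarrow> complex set set" where
  "finite_places K =
     {p. primeideal p (complex_ring\<lparr>carrier := integers_of K\<rparr>) \<and> p \<noteq> {0}}"

text \<open>The valuation ring of \<open>K\<close> at the place \<open>p\<close>, and its maximal ideal.\<close>

definition place_ring :: "complex set \<Rightarrow> complex set \<Rightarrow> complex set" where
  "place_ring K p = {a / b | a b. a \<in> integers_of K \<and> b \<in> integers_of K - p}"

definition place_ideal :: "complex set \<Rightarrow> complex set \<Rightarrow> complex set" where
  "place_ideal K p = {a / b | a b. a \<in> p \<and> b \<in> integers_of K - p}"


section \<open>Projective algebraic sets\<close>

definition poly_eval :: "(('n::finite \<Rightarrow>\<^sub>0 nat) \<Rightarrow>\<^sub>0 complex) \<Rightarrow> complex ^ 'n \<Rightarrow> complex" where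
  "poly_eval f x =
     (\<Sum>m\<in>Poly_Mapping.keys f. Poly_Mapping.lookup f m * (\<Prod>i\<in>UNIV. (x $ i) ^ Poly_Mapping.lookup m i))"

definition forms_over :: "complex set \<Rightarrow> (('n::finite \<Rightarrow>\<^sub>0 nat) \<Rightarrow>\<^sub>0 complex) set" where
  "forms_over R =
     {f. (\<forall>m. Poly_Mapping.lookup f m \<in> R) \<and>
         (\<exists>d. \<forall>m\<in>Poly_Mapping.keys f. (\<Sum>i\<in>UNIV. Poly_Mapping.lookup m i) = d)}"

definition proj_zeros :: "(('n::finite \<Rightarrow>\<^sub>0 nat) \<Rightarrow>\<^sub>0 complex) set \<Rightarrow> (complex ^ 'n) set" where
  "proj_zeros A = {x. x \<noteq> 0 \<and> (\<forall>f\<in>A. poly_eval f x = 0)}"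

definition proj_closed_over :: "complex set \<Rightarrow> (complex ^ 'n::finite) set \<Rightarrow> bool" where
  "proj_closed_over K V \<longleftrightarrow> (\<exists>A. A \<subseteq> forms_over K \<and> V = proj_zeros A)"

definition zariski_closure :: "(complex ^ 'n::finite) set \<Rightarrow> (complex ^ 'n) set" where
  "zariski_closure T = proj_zeros {f \<in> forms_over UNIV. \<forall>x\<in>T. poly_eval f x = 0}"


section \<open>Integral points\<close>

text \<open>
  The reduction of \<open>D\<close> modulo \<open>p\<close> is the special fibre of the closure of \<open>D\<close> in projective space over
  the valuation ring \<open>R\<close> at \<open>p\<close>: it is cut out by the reductions of all forms with coefficients in
  \<open>R\<close> that vanish on \<open>D\<close>. A point with coordinates in \<open>K\<close> is reduced by scaling its coordinates so
  that all of them lie in \<open>R\<close> and not all of them in the maximal ideal. A value of a form at such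
  coordinates reduces to zero iff it lies in the maximal ideal.
\<close>

definition reduces_into ::
  "complex set \<Rightarrow> complex set \<Rightarrow> (complex ^ 'n::finite) set \<Rightarrow> complex ^ 'n \<Rightarrow> bool" where
  "reduces_into K p D x \<longleftrightarrow>
     (\<exists>c\<in>K - {0}.
        (\<forall>i. (c *s x) $ i \<in> place_ring K p) \<and>
        (\<exists>i. (c *s x) $ i \<notin> place_ideal K p) \<and>
        (\<forall>f\<in>forms_over (place_ring K p).
           (\<forall>z\<in>D. poly_eval f z = 0) \<longrightarrow> poly_eval f (c *s x) \<in> place_ideal K p))"

text \<open>
  A set of places containing the archimedean ones is represented by the set \<open>S\<close> of its
  non-archimedean members: the archimedean places play no role in the condition.
\<close>

definition S_integral_points ::
  "complex set \<Rightarrow> complex set set \<Rightarrow> (complex ^ 'n::finite) set \<Rightarrow> (complex ^ 'n) set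
    \<Rightarrow> (complex ^ 'n) set" where
  "S_integral_points K S V D =
     {x \<in> V - D. (\<forall>i. x $ i \<in> K) \<and> (\<forall>p\<in>finite_places K - S. \<not> reduces_into K p D x)}"

definition integral_points_potentially_dense ::
  "complex set \<Rightarrow> (complex ^ 'n::finite) set \<Rightarrow> (complex ^ 'n) set \<Rightarrow> bool" where
  "integral_points_potentially_dense K V D \<longleftrightarrow>
     (\<exists>L S. number_field L \<and> K \<subseteq> L \<and> finite S \<and> S \<subseteq> finite_places L \<and>
        V \<subseteq> zariski_closure (S_integral_points L S V D))"


section \<open>The del Pezzo threefold of degree five\<close>

text \<open>
  The second exterior power of \<open>\<complex>\<^sup>5\<close> is the 10-dimensional space of alternating tensors in
  \<open>\<complex>\<^sup>5 \<otimes> \<complex>\<^sup>5\<close>, and \<open>wedge v w\<close> is the vector of Pluecker coordinates of the span of \<open>v\<close> and \<open>w\<close>.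
\<close>

definition alternating_tensors :: "(complex ^ (5 \<times> 5)) set" where
  "alternating_tensors = {t. \<forall>i j. t $ (i, j) = - t $ (j, i)}"

definition wedge :: "complex ^ 5 \<Rightarrow> complex ^ 5 \<Rightarrow> complex ^ (5 \<times> 5)" where
  "wedge v w = (\<chi> ij. v $ fst ij * w $ snd ij - v $ snd ij * w $ fst ij)"

definition grassmannian25 :: "(complex ^ (5 \<times> 5)) set" where
  "grassmannian25 = {wedge v w | v w. wedge v w \<noteq> 0}"

text \<open>
  The tangent space at \<open>wedge v w\<close> of the affine cone over the Grassmannian: the image of the
  differential of \<open>wedge\<close> at \<open>(v, w)\<close>.
\<close>

definition grassmannian25_tangent :: "complex ^ 5 \<Rightarrow> complex ^ 5 \<Rightarrow> (complex ^ (5 \<times> 5)) set" where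
  "grassmannian25_tangent v w = {wedge a w + wedge v b | a b. True}"

text \<open>
  A linear subspace of codimension 3 of the Pluecker space is given together with its homogeneous
  coordinates, as the image of an injective \<open>10 \<times> 7\<close> matrix \<open>M\<close>.
\<close>

definition transversal_section :: "complex ^ 7 ^ (5 \<times> 5) \<Rightarrow> bool" where
  "transversal_section M \<longleftrightarrow>
     inj ((*v) M) \<and> range ((*v) M) \<subseteq> alternating_tensors \<and>
     (\<forall>v w. wedge v w \<noteq> 0 \<and> wedge v w \<in> range ((*v) M) \<longrightarrow>
        {s + t | s t. s \<in> grassmannian25_tangent v w \<and> t \<in> range ((*v) M)} = alternating_tensors)"

text \<open>
  \<open>V\<close> is defined over \<open>K\<close>; the linear section is only required to exist over the algebraic closure
  of \<open>K\<close>, so that all forms of the threefold over \<open>K\<close> are included.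
\<close>

definition del_Pezzo_B5 :: "complex set \<Rightarrow> (complex ^ 7) set \<Rightarrow> bool" where
  "del_Pezzo_B5 K V \<longleftrightarrow>
     proj_closed_over K V \<and>
     (\<exists>M. transversal_section M \<and> (\<forall>i j. algebraic (M $ i $ j)) \<and>
          V = {x. M *v x \<in> grassmannian25})"

definition hyperplane_section ::
  "complex set \<Rightarrow> (complex ^ 'n::finite) set \<Rightarrow> (complex ^ 'n) set \<Rightarrow> bool" where
  "hyperplane_section K V H \<longleftrightarrow>
     (\<exists>h. h \<noteq> 0 \<and> (\<forall>i. h $ i \<in> K) \<and> H = {x \<in> V. (\<Sum>i\<in>UNIV. h $ i * x $ i) = 0})"

text \<open>
  A smooth conic over the field of algebraic numbers: \<open>N\<close> parametrizes a plane, and \<open>Q\<close> is the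
  symmetric matrix of a quadratic form, whose gradient \<open>2 Q y\<close> must not vanish at points of the conic.
\<close>

definition smooth_conic :: "(complex ^ 'n::finite) set \<Rightarrow> bool" where
  "smooth_conic C \<longleftrightarrow>
     (\<exists>(N :: complex ^ 3 ^ 'n) (Q :: complex ^ 3 ^ 3).
        (\<forall>i j. algebraic (N $ i $ j)) \<and> (\<forall>i j. algebraic (Q $ i $ j)) \<and>
        inj ((*v) N) \<and> transpose Q = Q \<and>
        (\<forall>y. y \<noteq> 0 \<and> (\<Sum>i\<in>UNIV. y $ i * (Q *v y) $ i) = 0 \<longrightarrow> Q *v y \<noteq> 0) \<and>
        C = {N *v y | y. y \<noteq> 0 \<and> (\<Sum>i\<in>UNIV. y $ i * (Q *v y) $ i) = 0})"

end

theory Submission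
  imports Defs
begin

text \<open>
  In a suitable basis \<open>a, b, c, d, e\<close> of \<open>\<complex>\<^sup>5\<close> the conic consists of the lines joining \<open>s a + t c\<close> and
  \<open>s b + t d\<close>, which sweep out a smooth quadric surface in the projective 3-space \<open>P\<close> spanned by
  \<open>a, b, c, d\<close>. A line of the section not contained in \<open>P\<close> meets \<open>P\<close> in one point, and through each
  point of \<open>P\<close> off the quadric there is exactly one line of the section. This parametrizes the
  threefold birationally by \<open>P\<close>, and a hyperplane section through the conic pulls back to a plane
  together with the quadric. It therefore suffices to find a Zariski-dense set of points of \<open>P\<close> that
  are integral outside two planes and a smooth quadric. On a line through a common point of the two
  planes and the quadric, the equations of the planes are constant in an affine coordinate and that
  of the quadric is linear, so infinitely many such points lie on the line as soon as its coefficients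
  are suitable units.
\<close>

subsection \<open>Number fields\<close>

text \<open>Two obstacles shape the proof. The first is arithmetic. In the coordinates
  \<open>g + u *s h + w *s e + s *s n\<close>, with \<open>n\<close> the common point, the second
  plane takes the value \<open>u\<close>, and the slope of the quadric along the line is affine in
  \<open>u\<close> and \<open>w\<close>. If it depends on \<open>u\<close> alone, asking that it be
  a unit together with \<open>u\<close> may be a unit equation, which leaves too few lines. The
  slope is then a non-unit \<open>N\<close>, and the lines are chosen so that the quadric at
  \<open>s = 0\<close> is congruent modulo \<open>N\<close> to infinitely many units. The second is
  density in the threefold. Irreducibility is replaced by an explicit transport: a form vanishing on
  the parametrized points is followed to an arbitrary point along a polynomial curve of lines, which
  requires on each line a point through which no other line of the section passes. The hyperplane
  sections pull back as they do because of a choice of complement: projecting bivectors to the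
  section along \<open>wedge a c\<close>, \<open>wedge b d\<close>, \<open>wedge a d\<close> sends
  those of \<open>P\<close> into the span of the conic, where the equations of hyperplanes through
  the conic vanish.\<close>

lemma complex_ring_simps [simp]:
  "carrier complex_ring = UNIV" "monoid.mult complex_ring = (*)" "one complex_ring = 1"
  "ring.zero complex_ring = 0" "ring.add complex_ring = (+)"
  by (simp_all add: ring_of_type_algebra_def)

interpretation cring_complex: domain complex_ring
  by (rule field.axioms(1)) (rule field_from_type_algebra)

lemma complex_ring_a_inv [simp]: "a_inv complex_ring x = - x"
  by (metis complex_ring_simps(1,4,5) cring_complex.minus_equality iso_tuple_UNIV_I add.left_inverse)

lemma complex_ring_m_inv [simp]: "x \<noteq> 0 \<Longrightarrow> m_inv complex_ring x = inverse x"
  using cring_complex.inv_char[of x "inverse x"] by simp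

lemma complex_ring_pow [simp]: "x [^]\<^bsub>complex_ring\<^esub> (n::nat) = x ^ n"
  by (induction n) simp_all

text \<open>\<open>HOL-Algebra\<close> stores a polynomial as a coefficient list with the leading
  coefficient first, whereas \<open>Poly\<close> starts with the constant one; hence
  \<open>rev\<close>.\<close>

lemma eval_complex_ring: "ring.eval complex_ring p x = poly (Poly (rev p)) x"
  by (induction p) (simp_all add: Poly_append poly_monom)

text \<open>The convention \<open>inverse 0 = 0\<close> lets closure under inverses be stated for
  all elements at once.\<close>

definition field_set :: "complex set \<Rightarrow> bool" where
  "field_set K \<longleftrightarrow> 0 \<in> K \<and> 1 \<in> K \<and> (\<forall>x\<in>K. \<forall>y\<in>K. x + y \<in> K \<and> x * y \<in> K) \<and>
     (\<forall>x\<in>K. - x \<in> K \<and> inverse x \<in> K)"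

lemma subfield_complex_ring_iff: "subfield K complex_ring \<longleftrightarrow> field_set K"
proof
  assume K: "subfield K complex_ring"
  note r = subfieldE(3)[OF K] subringE[OF subfieldE(1)[OF K]]
  have "inverse x \<in> K" if "x \<in> K" for x
    using cring_complex.subfield_m_inv(1)[OF K, of x] that r by (cases "x = 0") auto
  then show "field_set K"
    using r by (auto simp: field_set_def)
next
  assume K: "field_set K"
  show "subfield K complex_ring"
  proof (rule field.subfieldI'[OF field_from_type_algebra])
    show "subring K complex_ring"
      by (rule cring_complex.subringI) (use K in \<open>auto simp: field_set_def\<close>)
  qed (use K in \<open>auto simp: field_set_def\<close>)
qed

lemma field_set_Rats: "field_set \<rat>"
  by (auto simp: field_set_def)

lemma number_field_imp_field_set: "number_field K \<Longrightarrow> field_set K"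
  by (simp add: number_field_def subfield_complex_ring_iff)

text \<open>The coefficient list of one notion becomes the polynomial of the other; the head of the
  list is the leading coefficient, which keeps the polynomial nonzero.\<close>

lemma algebraic_over_Rats_iff: "cring_complex.algebraic \<rat> x \<longleftrightarrow> algebraic x"
proof
  have Q: "subring \<rat> complex_ring"
    using field_set_Rats subfield_complex_ring_iff subfieldE(1) by blast
  assume "cring_complex.algebraic \<rat> x"
  then obtain p where p: "p \<in> carrier (univ_poly complex_ring \<rat>)" "p \<noteq> []"
      "cring_complex.eval p x = 0"
    using cring_complex.algebraicE[OF Q, of x] by (auto simp: over_def)
  have *: "set p \<subseteq> \<rat>" "hd p \<noteq> 0"
    using p(1,2) by (auto simp: univ_poly_def polynomial_def)
  show "algebraic x"
  proof (rule algebraicI')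
    show "Polynomial.coeff (Poly (rev p)) i \<in> \<rat>" for i
    proof (cases "i < length p")
      case True
      then have "rev p ! i \<in> set p" using nth_mem[of i "rev p"] by simp
      then show ?thesis using * True by (auto simp: nth_default_def)
    qed (simp add: nth_default_def)
    have "nth_default 0 (rev p) (length p - 1) = hd p"
      using p(2) by (simp add: nth_default_def rev_nth hd_conv_nth)
    then have "Polynomial.coeff (Poly (rev p)) (length p - 1) \<noteq> 0"
      using *(2) by simp
    then show "Poly (rev p) \<noteq> 0" by fastforce
    show "poly (Poly (rev p)) x = 0"
      using p(3) by (simp add: eval_complex_ring)
  qed
next
  assume "algebraic x"
  then obtain p where p: "\<And>i. Polynomial.coeff p i \<in> \<rat>" "p \<noteq> 0" "poly p x = 0"
    using algebraicE' by (metis algebraic_altdef)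
  have "cring_complex.algebraic over \<rat> = cring_complex.algebraic \<rat>" by (simp add: over_def)
  moreover have "(cring_complex.algebraic over \<rat>) x"
  proof (rule cring_complex.algebraicI)
    have "set (coeffs p) \<subseteq> \<rat>"
      using p(1) by (auto simp: coeffs_def)
    moreover have "hd (rev (coeffs p)) \<noteq> 0"
      using p(2) by (simp add: hd_rev last_coeffs_eq_coeff_degree)
    ultimately show "rev (coeffs p) \<in> carrier (univ_poly complex_ring \<rat>)"
      by (simp add: univ_poly_def polynomial_def)
    show "rev (coeffs p) \<noteq> []" using p(2) by simp
    show "cring_complex.eval (rev (coeffs p)) x = \<zero>\<^bsub>complex_ring\<^esub>"
      using p(3) by (simp add: eval_complex_ring)
  qed
  ultimately show "cring_complex.algebraic \<rat> x" by simp
qed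

lemma number_field_imp_algebraic:
  assumes "number_field K" "x \<in> K"
  shows "algebraic x"
proof -
  have "(cring_complex.algebraic over \<rat>) x"
    using assms cring_complex.finite_dimension_imp_algebraic[of \<rat> K x]
      subfieldE(1)[of K complex_ring] field_set_Rats
    by (simp add: number_field_def subfield_complex_ring_iff)
  then show ?thesis by (simp add: over_def algebraic_over_Rats_iff)
qed

text \<open>Serves to collect the finitely many algebraic constants of the construction in one
  number field. Its degree is finite by the tower law for
  \<open>\<rat> \<subseteq> K \<subseteq> L\<close>.\<close>

lemma number_field_adjoin:
  assumes "number_field K" "finite A" "\<And>x. x \<in> A \<Longrightarrow> algebraic x"
  obtains L where "number_field L" "K \<subseteq> L" "A \<subseteq> L"
proof -
  obtain xs where xs: "set xs = A" using assms(2) finite_list by blast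
  have K: "subfield K complex_ring" "cring_complex.finite_dimension \<rat> K" "\<rat> \<subseteq> K"
  proof -
    show "subfield K complex_ring" "cring_complex.finite_dimension \<rat> K"
      using assms(1) by (auto simp: number_field_def)
    have K: "field_set K" by (rule number_field_imp_field_set[OF assms(1)])
    have N: "of_nat n \<in> K" for n
      using K by (induction n) (auto simp: field_set_def)
    have Z: "of_int n \<in> K" for n
      using N K by (cases n rule: int_cases2) (auto simp: field_set_def)
    have "of_int a / of_int b \<in> K" for a b
      using Z K unfolding field_set_def divide_inverse by blast
    then show "\<rat> \<subseteq> K" by (auto elim!: Rats_cases')
  qed
  have Q: "subfield \<rat> complex_ring" using field_set_Rats by (simp add: subfield_complex_ring_iff)
  have alg: "(cring_complex.algebraic over K) x" if "x \<in> set xs" for x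
    using cring_complex.algebraic_mono[OF K(3)] assms(3)[of x] that xs
    by (auto simp: over_def algebraic_over_Rats_iff)
  define L where "L = cring_complex.finite_extension K xs"
  have "subfield L complex_ring"
    unfolding L_def by (rule cring_complex.finite_extension_is_subfield[OF K(1) _ alg]) auto
  moreover have "cring_complex.finite_dimension K L"
    unfolding L_def by (rule cring_complex.finite_extension_finite_dimension(1)[OF K(1) _ alg]) auto
  ultimately have "number_field L"
    using cring_complex.telescopic_base_dim(1)[OF Q K(1) K(2)] by (simp add: number_field_def)
  moreover have "K \<subseteq> L"
    unfolding L_def by (rule cring_complex.finite_extension_incl) auto
  moreover have "A \<subseteq> L"
    unfolding L_def xs[symmetric]
    by (rule cring_complex.finite_extension_mem) (use subfieldE(1)[OF K(1)] in auto)
  ultimately show ?thesis using that by blast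
qed

lemma number_field_Rats: "number_field \<rat>"
  using field_set_Rats cring_complex.finite_dimensionI[OF cring_complex.dimension_one[of \<rat>]]
  by (simp add: number_field_def subfield_complex_ring_iff)

text \<open>Both numbers lie in one number field, which is closed under the operations and has only
  algebraic elements.\<close>

lemma algebraic_arith:
  fixes x y :: complex
  assumes "algebraic x" "algebraic y"
  shows algebraic_add: "algebraic (x + y)" and algebraic_mult: "algebraic (x * y)"
proof -
  obtain L where L: "number_field L" "{x, y} \<subseteq> L"
    using number_field_adjoin[OF number_field_Rats, of "{x, y}"] assms by auto
  then have "x + y \<in> L" "x * y \<in> L"
    using number_field_imp_field_set[OF L(1)] by (auto simp: field_set_def)
  then show "algebraic (x + y)" "algebraic (x * y)"
    using number_field_imp_algebraic[OF L(1)] by auto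
qed

lemma algebraic_diff: "algebraic x \<Longrightarrow> algebraic y \<Longrightarrow> algebraic (x - y :: complex)"
  using algebraic_add[of x "- y"] by simp

lemma algebraic_divide: "algebraic x \<Longrightarrow> algebraic y \<Longrightarrow> algebraic (x / y :: complex)"
  by (simp add: divide_inverse algebraic_mult algebraic_inverse)

lemma algebraic_sum: "(\<And>i. i \<in> I \<Longrightarrow> algebraic (f i)) \<Longrightarrow> algebraic (\<Sum>i\<in>I. f i :: complex)"
  by (induction I rule: infinite_finite_induct) (auto intro: algebraic_add)

lemma algebraic_1: "algebraic (1::complex)"
  using number_field_imp_algebraic[OF number_field_Rats, of 1] by simp

lemma algebraic_numeral: "algebraic (numeral n::complex)"
  using number_field_imp_algebraic[OF number_field_Rats, of "numeral n"] by simp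

lemmas algebraic_intros = algebraic_0 algebraic_1 algebraic_numeral algebraic_add algebraic_mult
  algebraic_diff algebraic_divide algebraic_minus algebraic_inverse algebraic_csqrt algebraic_sum

subsection \<open>Finite places\<close>

text \<open>Integrality of the constructed points is proved once for an arbitrary such subring and
  then applied both to the number field and to its valuation rings.\<close>

definition ring_set :: "complex set \<Rightarrow> bool" where
  "ring_set R \<longleftrightarrow> 0 \<in> R \<and> 1 \<in> R \<and> (\<forall>x\<in>R. \<forall>y\<in>R. x + y \<in> R \<and> x * y \<in> R) \<and> (\<forall>x\<in>R. - x \<in> R)"

lemma ring_setD:
  assumes "ring_set R"
  shows "0 \<in> R" "1 \<in> R" "x \<in> R \<Longrightarrow> y \<in> R \<Longrightarrow> x + y \<in> R" "x \<in> R \<Longrightarrow> y \<in> R \<Longrightarrow> x * y \<in> R"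
    "x \<in> R \<Longrightarrow> - x \<in> R" "x \<in> R \<Longrightarrow> y \<in> R \<Longrightarrow> x - y \<in> R" "of_nat n \<in> R" "of_int k \<in> R"
    "x \<in> R \<Longrightarrow> x ^ n \<in> R" "(\<And>i. i \<in> I \<Longrightarrow> f i \<in> R) \<Longrightarrow> sum f I \<in> R"
    "(\<And>i. i \<in> I \<Longrightarrow> f i \<in> R) \<Longrightarrow> prod f I \<in> R" "numeral m \<in> R"
proof -
  show *: "0 \<in> R" "1 \<in> R" "x \<in> R \<Longrightarrow> - x \<in> R"
    and **: "x \<in> R \<Longrightarrow> y \<in> R \<Longrightarrow> x + y \<in> R" "x \<in> R \<Longrightarrow> y \<in> R \<Longrightarrow> x * y \<in> R" for x y
    using assms by (auto simp: ring_set_def)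
  show d: "x \<in> R \<Longrightarrow> y \<in> R \<Longrightarrow> x - y \<in> R"
    using assms unfolding ring_set_def by (metis diff_conv_add_uminus)
  show N: "of_nat n \<in> R" for n by (induction n) (use * ** in auto)
  show "of_int k \<in> R"
    using assms N by (cases k rule: int_cases2) (auto simp: ring_set_def)
  show "x \<in> R \<Longrightarrow> x ^ n \<in> R" by (induction n) (use * ** in auto)
  show "(\<And>i. i \<in> I \<Longrightarrow> f i \<in> R) \<Longrightarrow> sum f I \<in> R"
    by (induction I rule: infinite_finite_induct) (use * ** in auto)
  show "(\<And>i. i \<in> I \<Longrightarrow> f i \<in> R) \<Longrightarrow> prod f I \<in> R"
    by (induction I rule: infinite_finite_induct) (use * ** in auto)
  show "numeral m \<in> R" using N[of "numeral m"] by simp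
qed

lemma field_set_imp_ring_set: "field_set K \<Longrightarrow> ring_set K"
  by (auto simp: field_set_def ring_set_def)

lemma finite_placeD:
  assumes "p \<in> finite_places L"
  shows "ring_set (integers_of L)" "p \<subseteq> integers_of L" "0 \<in> p" "1 \<notin> p"
    "x \<in> p \<Longrightarrow> y \<in> p \<Longrightarrow> x + y \<in> p" "x \<in> p \<Longrightarrow> - x \<in> p"
    "x \<in> p \<Longrightarrow> y \<in> integers_of L \<Longrightarrow> x * y \<in> p"
    "x \<in> integers_of L \<Longrightarrow> y \<in> integers_of L \<Longrightarrow> x * y \<in> p \<Longrightarrow> x \<in> p \<or> y \<in> p"
proof -
  let ?O = "complex_ring\<lparr>carrier := integers_of L\<rparr>"
  have pr: "primeideal p ?O" using assms by (simp add: finite_places_def)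
  interpret P: primeideal p ?O by (rule pr)
  have minus: "a_inv ?O x = - x" if "x \<in> integers_of L" for x
  proof -
    have "x + a_inv ?O x = 0" using P.r_neg[of x] that by simp
    then show ?thesis by (metis add_eq_0_iff)
  qed
  show "ring_set (integers_of L)"
    unfolding ring_set_def
    using P.zero_closed P.one_closed P.add.m_closed P.m_closed P.a_inv_closed minus by auto
  show "p \<subseteq> integers_of L" "0 \<in> p" using P.a_subset P.zero_closed P.additive_subgroup_axioms additive_subgroup.zero_closed[of p ?O] by auto
  show "1 \<notin> p" using P.I_notcarr P.one_imp_carrier by auto
  show "x \<in> p \<Longrightarrow> y \<in> p \<Longrightarrow> x + y \<in> p" using additive_subgroup.a_closed[of p ?O x y] P.additive_subgroup_axioms by auto
  show "- x \<in> p" if "x \<in> p"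
  proof -
    have "x \<in> integers_of L" using that P.a_subset by auto
    then show ?thesis
      using minus additive_subgroup.a_inv_closed[OF P.additive_subgroup_axioms that] by metis
  qed
  show "x \<in> p \<Longrightarrow> y \<in> integers_of L \<Longrightarrow> x * y \<in> p" using P.I_r_closed by auto
  show "x \<in> integers_of L \<Longrightarrow> y \<in> integers_of L \<Longrightarrow> x * y \<in> p \<Longrightarrow> x \<in> p \<or> y \<in> p"
    using P.I_prime by auto
qed

lemma finite_place_sum:
  assumes "p \<in> finite_places L" "\<And>i. i \<in> I \<Longrightarrow> f i \<in> p"
  shows "sum f I \<in> p"
  using assms(2) by (induction I rule: infinite_finite_induct)
    (auto simp: finite_placeD(3)[OF assms(1)] finite_placeD(5)[OF assms(1)])

lemma finite_place_prod:
  assumes "p \<in> finite_places L" "finite I" "\<And>i. i \<in> I \<Longrightarrow> f i \<in> integers_of L - p"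
  shows "prod f I \<in> integers_of L - p"
  using assms(2,3)
proof (induction I rule: finite_induct)
  case empty
  then show ?case using finite_placeD(4)[OF assms(1)] ring_setD[OF finite_placeD(1)[OF assms(1)]] by auto
next
  case (insert i I)
  then show ?case
    using finite_placeD(8)[OF assms(1), of "f i" "prod f I"] ring_setD[OF finite_placeD(1)[OF assms(1)]] by auto
qed

section \<open>Finiteness of the set of places above a rational prime\<close>

lemma finite_place_prime_dvd:
  assumes p: "p \<in> finite_places L" and l: "Factorial_Ring.prime (l::int)" "of_int l \<in> p" and k: "of_int k \<in> p"
  shows "l dvd k"
proof (rule ccontr)
  assume "\<not> l dvd k"
  then have "coprime l k" using l(1) by (simp add: prime_imp_coprime)
  then obtain u v where "u * l + v * k = 1" by (metis coprime_iff_gcd_eq_1 bezout_int)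
  then have "of_int l * of_int u + of_int k * of_int v = (1::complex)"
    by (metis of_int_1 of_int_add of_int_mult mult.commute)
  moreover have "of_int l * of_int u + of_int k * of_int v \<in> p"
    using finite_placeD(5,7)[OF p] ring_setD(8)[OF finite_placeD(1)[OF p]] l k by blast
  ultimately show False using finite_placeD(4)[OF p] by simp
qed

text \<open>Dimension one of the ring of integers. With \<open>x\<close> in \<open>q\<close> but not
  in \<open>p\<close>, every integer polynomial whose value at \<open>x\<close> lies in
  \<open>p\<close> has all coefficients divisible by \<open>l\<close>; the monic equation of
  \<open>x\<close> cannot have this property.\<close>

lemma finite_places_incomparable:
  assumes p: "p \<in> finite_places L" and q: "q \<in> finite_places L"
    and l: "Factorial_Ring.prime (l::int)" "of_int l \<in> p" "of_int l \<in> q" and "p \<subseteq> q"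
  shows "p = q"
proof (rule ccontr)
  assume "p \<noteq> q"
  then obtain x where x: "x \<in> q" "x \<notin> p" using \<open>p \<subseteq> q\<close> by blast
  have xO: "x \<in> integers_of L" using x finite_placeD(2)[OF q] by blast
  note O = ring_setD[OF finite_placeD(1)[OF p]]
  have fO: "poly (map_poly of_int f) x \<in> integers_of L" for f :: "int poly"
    by (induction f) (auto simp: map_poly_pCons O xO)
  \<comment> \<open>Horner induction: \<open>c + x * g\<close> is in \<open>p \<subseteq> q\<close>
    and \<open>x\<close> is in \<open>q\<close>, so the constant term \<open>c\<close> is in
    \<open>q\<close>, hence a multiple of \<open>l\<close>, hence in \<open>p\<close>. Then
    \<open>x * g\<close> is in \<open>p\<close> and, \<open>x\<close> being outside, so is
    \<open>g\<close>.\<close>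
  have "\<forall>i. l dvd Polynomial.coeff f i" if "poly (map_poly of_int f) x \<in> p" for f :: "int poly"
    using that
  proof (induction f)
    case 0
    then show ?case by simp
  next
    case (pCons c f)
    define g where "g = poly (map_poly of_int f) x"
    have cg: "of_int c + x * g \<in> p" using pCons by (simp add: map_poly_pCons g_def)
    have gO: "g \<in> integers_of L" using fO g_def by simp
    have "- (x * g) \<in> q" using finite_placeD(6,7)[OF q] x(1) gO by blast
    then have "(of_int c + x * g) + - (x * g) \<in> q" using finite_placeD(5)[OF q] cg \<open>p \<subseteq> q\<close> by blast
    then have dvd: "l dvd c" using finite_place_prime_dvd[OF q l(1) l(3)] by simp
    then obtain m where "c = l * m" by blast
    then have "of_int c \<in> p" using finite_placeD(7)[OF p l(2) O(8)[of m]] by simp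
    then have "(of_int c + x * g) + - of_int c \<in> p" using finite_placeD(5,6)[OF p] cg by blast
    then have "x * g \<in> p" by simp
    then have "g \<in> p" using finite_placeD(8)[OF p xO gO] x(2) by blast
    then show ?case using pCons.IH dvd by (auto simp: g_def coeff_pCons split: nat.splits)
  qed
  moreover obtain f where f: "poly (map_poly of_int f) x = 0" "Polynomial.lead_coeff f = (1::int)"
    using xO by (auto simp: integers_of_def algebraic_int_altdef_ipoly)
  ultimately have "l dvd Polynomial.lead_coeff f" using finite_placeD(3)[OF p] by metis
  then show False using f(2) l(1) by (simp add: prime_int_iff)
qed

lemma combine_complex_ring:
  "length Ks = length xs \<Longrightarrow> cring_complex.combine Ks xs = (\<Sum>i<length xs. Ks ! i * xs ! i)"
proof (induction Ks xs rule: list_induct2)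
  case (Cons k Ks x xs)
  have "{..<length (x # xs)} = insert 0 (Suc ` {..<length xs})"
    by (auto simp: image_iff less_Suc_eq_0_disj)
  then show ?case using Cons by (simp add: sum.reindex)
qed simp

text \<open>With \<open>n\<close> the degree of \<open>L\<close>, any \<open>n + 1\<close> elements
  satisfy a rational relation. Clearing denominators and dividing by the greatest common divisor
  makes it integral and primitive, hence nontrivial modulo every non-unit \<open>l\<close>; the
  bound \<open>n\<close> is the same for all \<open>l\<close>.\<close>

lemma number_field_int_dependent:
  assumes "number_field L"
  obtains n :: nat where "\<And>(x :: nat \<Rightarrow> complex) l :: int. (\<And>i. i \<le> n \<Longrightarrow> x i \<in> L) \<Longrightarrow> \<not> is_unit l \<Longrightarrow>
     \<exists>w. (\<exists>i\<le>n. \<not> l dvd w i) \<and> (\<Sum>i\<le>n. of_int (w i) * x i) = 0"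
proof -
  have Q: "subfield \<rat> complex_ring" using field_set_Rats by (simp add: subfield_complex_ring_iff)
  obtain n where n: "cring_complex.dimension n \<rat> L"
    using assms by (auto simp: number_field_def)
  have "\<exists>w. (\<exists>i\<le>n. \<not> l dvd w i) \<and> (\<Sum>i\<le>n. of_int (w i) * x i) = 0"
    if xL: "\<And>i. i \<le> n \<Longrightarrow> x i \<in> L" and l: "\<not> is_unit l" for x :: "nat \<Rightarrow> complex" and l :: int
  proof -
    define xs where "xs = map x [0..<Suc n]"
    have "set xs \<subseteq> L" unfolding xs_def using xL by (auto simp: less_Suc_eq_le)
    then have "\<not> cring_complex.independent \<rat> xs"
      using cring_complex.independent_length_le_dimension[OF Q n, of xs] by (auto simp: xs_def)
    then obtain Ks where Ks: "length Ks = length xs" "cring_complex.combine Ks xs = 0"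
        "set Ks \<subseteq> \<rat>" "set Ks \<noteq> {0}"
      using cring_complex.dependent_imp_non_trivial_combine[OF Q, of xs] by auto
    have len: "length xs = Suc n" by (simp add: xs_def)
    have sum0: "(\<Sum>i\<le>n. Ks ! i * x i) = 0"
      using Ks(2) combine_complex_ring[OF Ks(1)] by (simp add: len lessThan_Suc_atMost xs_def nth_append del: upt_Suc)
    have "\<forall>i. \<exists>a b. i \<le> n \<longrightarrow> b > 0 \<and> Ks ! i = of_int a / of_int b"
    proof (intro allI)
      fix i show "\<exists>a b. i \<le> n \<longrightarrow> b > 0 \<and> Ks ! i = of_int a / of_int b"
      proof (cases "i \<le> n")
        case True
        then have "Ks ! i \<in> \<rat>" using Ks(1,3) len nth_mem[of i Ks] by auto
        then show ?thesis by (elim Rats_cases') blast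
      qed simp
    qed
    then obtain a b where ab: "\<And>i. i \<le> n \<Longrightarrow> b i > 0 \<and> Ks ! i = of_int (a i) / of_int (b i :: int)"
      by metis
    \<comment> \<open>The integer \<open>z i\<close> is \<open>Ks ! i\<close> multiplied by the
      product \<open>B\<close> of all denominators.\<close>
    define z where "z i = a i * (\<Prod>j\<in>{..n}-{i}. b j)" for i
    define B where "B = (\<Prod>j\<le>n. b j)"
    have B: "of_int (z i) = of_int B * Ks ! i" if "i \<le> n" for i
    proof -
      have "B = b i * (\<Prod>j\<in>{..n}-{i}. b j)" unfolding B_def using that by (simp add: prod.remove)
      then show ?thesis using ab[OF that] by (simp add: z_def)
    qed
    have "B \<noteq> 0" unfolding B_def using ab by (simp add: less_imp_neq[symmetric])
    obtain i0 where i0: "i0 \<le> n" "Ks ! i0 \<noteq> 0"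
    proof -
      have "set Ks \<noteq> {}" using Ks(1) len by auto
      moreover have "\<not> set Ks \<subseteq> {0}" using Ks(4) calculation by (simp add: subset_singleton_iff)
      ultimately obtain k where "k \<in> set Ks" "k \<noteq> 0" by auto
      then show ?thesis using that Ks(1) len by (metis in_set_conv_nth less_Suc_eq_le)
    qed
    have z0: "z i0 \<noteq> 0" using B[OF i0(1)] i0(2) \<open>B \<noteq> 0\<close>
      by (metis mult_eq_0_iff of_int_eq_0_iff)
    define g where "g = Gcd (z ` {..n})"
    have g0: "g \<noteq> 0" unfolding g_def using z0 i0 by (auto simp: Gcd_0_iff)
    have gz: "g dvd z i" if "i \<le> n" for i unfolding g_def using that by (auto intro: Gcd_dvd)
    define w where "w i = z i div g" for i
    have zw: "z i = g * w i" if "i \<le> n" for i using gz[OF that] by (simp add: w_def)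
    have "\<exists>i\<le>n. \<not> l dvd w i"
    proof (rule ccontr)
      assume "\<not> ?thesis"
      then have "g * l dvd z i" if "i \<le> n" for i using that zw by auto
      then have "g * l dvd g" unfolding g_def by (intro Gcd_greatest) (auto simp: g_def)
      then show False using g0 l by (metis dvd_mult_cancel_left mult.right_neutral)
    qed
    moreover have "(\<Sum>i\<le>n. of_int (w i) * x i) = 0"
    proof -
      have "of_int g * (\<Sum>i\<le>n. of_int (w i) * x i) = (\<Sum>i\<le>n. of_int (z i) * x i)"
        using zw by (auto simp: sum_distrib_left intro!: sum.cong)
      also have "\<dots> = of_int B * (\<Sum>i\<le>n. Ks ! i * x i)"
        using B by (auto simp: sum_distrib_left intro!: sum.cong)
      finally show ?thesis using sum0 g0 by simp
    qed
    ultimately show ?thesis by blast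
  qed
  then show ?thesis using that by blast
qed

text \<open>At most as many places as the degree lie above \<open>l\<close>: for more of them there
  are elements forming a diagonal system modulo these places, and a primitive integral relation
  between the elements would be trivial modulo \<open>l\<close>.\<close>

lemma finite_places_above_prime:
  assumes L: "number_field L" and l: "Factorial_Ring.prime (l::int)"
  shows "finite {p \<in> finite_places L. of_int l \<in> p}" (is "finite ?P")
proof (rule ccontr)
  assume inf: "infinite ?P"
  obtain n :: nat where n: "\<And>(x :: nat \<Rightarrow> complex) l :: int. (\<And>i. i \<le> n \<Longrightarrow> x i \<in> L) \<Longrightarrow> \<not> is_unit l \<Longrightarrow>
     \<exists>w. (\<exists>i\<le>n. \<not> l dvd w i) \<and> (\<Sum>i\<le>n. of_int (w i) * x i) = 0"
    using number_field_int_dependent[OF L] by blast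
  obtain P :: "nat \<Rightarrow> complex set" where P: "inj P" "range P \<subseteq> ?P"
    using infinite_countable_subset[OF inf] by blast
  then have pl: "P i \<in> finite_places L" and lP: "of_int l \<in> P i" for i by auto
  have "\<exists>y. i \<noteq> j \<longrightarrow> y \<in> P j \<and> y \<notin> P i" for i j
  proof (cases "i = j")
    case False
    then have "P j \<noteq> P i" using P(1) by (auto dest: injD)
    then have "\<not> P j \<subseteq> P i" using finite_places_incomparable[OF pl pl l lP lP, of j i] by blast
    then show ?thesis by blast
  qed simp
  then obtain y where y: "\<And>i j. i \<noteq> j \<Longrightarrow> y i j \<in> P j \<and> y i j \<notin> P i" by metis
  \<comment> \<open>Each factor \<open>y i j\<close> lies in \<open>P j\<close> and not in
    \<open>P i\<close>, so \<open>x i\<close> is outside \<open>P i\<close> and inside every other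
    \<open>P j\<close>. Reducing the relation modulo \<open>P i\<close> therefore isolates the
    coefficient \<open>w i\<close>.\<close>
  define x where "x i = (\<Prod>j\<in>{..n}-{i}. y i j)" for i
  have yO: "y i j \<in> integers_of L" if "i \<noteq> j" for i j
    using y[OF that] finite_placeD(2)[OF pl[of j]] by blast
  have x1: "x i \<in> integers_of L - P i" for i
    unfolding x_def by (rule finite_place_prod[OF pl]) (use y yO in auto)
  have x2: "x i \<in> P j" if "i \<noteq> j" "j \<le> n" for i j
  proof -
    have "x i = y i j * (\<Prod>j\<in>{..n}-{i}-{j}. y i j)"
      unfolding x_def using that by (subst prod.remove[of _ j]) auto
    moreover have "(\<Prod>j\<in>{..n}-{i}-{j}. y i j) \<in> integers_of L"
      by (rule ring_setD(11)[OF finite_placeD(1)[OF pl]]) (use yO in auto)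
    ultimately show ?thesis using finite_placeD(7)[OF pl] y[OF that(1)] by auto
  qed
  have "\<not> is_unit l" using l not_prime_unit by blast
  moreover have "x i \<in> L" for i using x1 by (auto simp: integers_of_def)
  ultimately obtain w where w: "\<exists>i\<le>n. \<not> l dvd w i" "(\<Sum>i\<le>n. of_int (w i) * x i) = 0"
    using n[of x l] by blast
  have "l dvd w i" if "i \<le> n" for i
  proof -
    have wO: "of_int (w j) \<in> integers_of L" for j using ring_setD(8)[OF finite_placeD(1)[OF pl]] .
    have "of_int (w i) * x i = - (\<Sum>j\<in>{..n}-{i}. of_int (w j) * x j)"
      using w(2) that by (subst (asm) sum.remove[of _ i]) (auto simp: eq_neg_iff_add_eq_0)
    moreover have "of_int (w j) * x j \<in> P i" if "j \<noteq> i" for j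
      using finite_placeD(7)[OF pl x2[OF that \<open>i \<le> n\<close>] wO[of j]] by (simp add: mult.commute)
    ultimately have "of_int (w i) * x i \<in> P i"
      by (auto intro!: finite_placeD(6)[OF pl] finite_place_sum[OF pl])
    then have "of_int (w i) \<in> P i" using finite_placeD(8)[OF pl] x1[of i] wO by blast
    then show ?thesis using finite_place_prime_dvd[OF pl l lP] by blast
  qed
  then show False using w(1) by blast
qed

text \<open>A prime ideal containing \<open>N\<close> contains one of the finitely many prime
  factors of \<open>N\<close>.\<close>

lemma finite_places_above:
  assumes L: "number_field L" and N: "N > (0::nat)"
  shows "finite {p \<in> finite_places L. of_nat N \<in> p}"
proof (rule finite_subset)
  show "{p \<in> finite_places L. of_nat N \<in> p} \<subseteq>
     (\<Union>l\<in>prime_factors (int N). {p \<in> finite_places L. of_int l \<in> p})"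
  proof
    fix p assume p: "p \<in> {p \<in> finite_places L. of_nat N \<in> p}"
    then have pl: "p \<in> finite_places L" by simp
    have "\<exists>l\<in>prime_factors (int N). of_int l \<in> p"
    proof (rule ccontr)
      assume neg: "\<not> ?thesis"
      have lO: "of_int l \<in> integers_of L" for l by (rule ring_setD(8)[OF finite_placeD(1)[OF pl]])
      have "(\<Prod>l\<in>prime_factors (int N). of_int l ^ multiplicity l (int N)) \<in> integers_of L - p"
      proof (rule finite_place_prod[OF pl])
        fix l assume "l \<in> prime_factors (int N)"
        then have "of_int l \<in> integers_of L - p" using neg lO by blast
        then have "(\<Prod>i<multiplicity l (int N). of_int l) \<in> integers_of L - p"
          by (intro finite_place_prod[OF pl]) auto
        then show "of_int l ^ multiplicity l (int N) \<in> integers_of L - p" by simp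
      qed simp
      moreover have "(\<Prod>l\<in>prime_factors (int N). (of_int l :: complex) ^ multiplicity l (int N)) = of_nat N"
      proof -
        have "(\<Prod>l\<in>prime_factors (int N). l ^ multiplicity l (int N)) = int N"
          using prod_prime_factors[of "int N"] N by simp
        then have "of_int (\<Prod>l\<in>prime_factors (int N). l ^ multiplicity l (int N)) = (of_int (int N) :: complex)"
          by (rule arg_cong)
        then show ?thesis by simp
      qed
      ultimately show False using p by simp
    qed
    then show "p \<in> (\<Union>l\<in>prime_factors (int N). {p \<in> finite_places L. of_int l \<in> p})" using pl by blast
  qed
  show "finite (\<Union>l\<in>prime_factors (int N). {p \<in> finite_places L. of_int l \<in> p})"
    using finite_places_above_prime[OF L] by (auto simp: in_prime_factors_iff)
qed

section \<open>Denominators of algebraic numbers and valuation rings\<close>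

lemma algebraic_imp_multiple_algebraic_int:
  assumes "algebraic (x::complex)"
  obtains n :: nat where "n > 0" "algebraic_int (of_nat n * x)"
proof -
  obtain p where p: "\<And>i. Polynomial.coeff p i \<in> \<int>" "p \<noteq> 0" "poly p x = 0"
    using assms by (auto elim!: algebraicE)
  define d where "d = Polynomial.degree p"
  have d: "d > 0"
  proof (rule ccontr)
    assume "\<not> d > 0"
    then obtain c where "p = [:c:]" using degree_eq_zeroE[of p] d_def by auto
    then show False using p by auto
  qed
  define a where "a = Polynomial.lead_coeff p"
  have a: "a \<in> \<int>" "a \<noteq> 0" using p by (auto simp: a_def)
  \<comment> \<open>This is \<open>a ^ (d - 1) * p (X / a)\<close> for the leading coefficient
    \<open>a\<close>: monic, with integral coefficients and with root \<open>a * x\<close>.\<close>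
  define q where "q = Polynomial.monom 1 d + (\<Sum>i<d. Polynomial.monom (Polynomial.coeff p i * a ^ (d - 1 - i)) i)"
  have cq: "Polynomial.coeff q k = (if k = d then 1 else if k < d then Polynomial.coeff p k * a ^ (d - 1 - k) else 0)" for k
    by (auto simp: q_def coeff_sum)
  have "Polynomial.degree q = d"
    by (rule antisym[OF degree_le le_degree]) (auto simp: cq)
  then have lc: "Polynomial.lead_coeff q = 1" by (simp add: cq)
  have "poly p x = a * x ^ d + (\<Sum>i<d. Polynomial.coeff p i * x ^ i)"
    unfolding poly_altdef d_def[symmetric] by (simp add: lessThan_Suc_atMost[symmetric] a_def d_def)
  then have 0: "a ^ (d - 1) * (a * x ^ d + (\<Sum>i<d. Polynomial.coeff p i * x ^ i)) = 0" using p(3) by simp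
  have "(\<Sum>i<d. Polynomial.coeff p i * a ^ (d - 1 - i) * (a * x) ^ i) = (\<Sum>i<d. a ^ (d - 1) * (Polynomial.coeff p i * x ^ i))"
  proof (rule sum.cong)
    fix i assume "i \<in> {..<d}"
    then have "i < d" by simp
    have "a ^ (d - 1) = a ^ (d - 1 - i) * a ^ i"
      using \<open>i < d\<close> by (simp flip: power_add)
    then show "Polynomial.coeff p i * a ^ (d - 1 - i) * (a * x) ^ i = a ^ (d - 1) * (Polynomial.coeff p i * x ^ i)"
      by (simp add: power_mult_distrib mult_ac)
  qed simp
  moreover have "a ^ (d - 1) * (a * x ^ d) = (a * x) ^ d"
    using d by (cases d) (auto simp: power_mult_distrib mult_ac)
  ultimately have "poly q (a * x) = a ^ (d - 1) * (a * x ^ d) + (\<Sum>i<d. a ^ (d - 1) * (Polynomial.coeff p i * x ^ i))"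
    by (simp add: q_def poly_monom poly_sum del: mult_cancel_left mult_cancel_right)
  also have "\<dots> = a ^ (d - 1) * (a * x ^ d + (\<Sum>i<d. Polynomial.coeff p i * x ^ i))"
    by (simp only: distrib_left sum_distrib_left)
  finally have "poly q (a * x) = a ^ (d - 1) * (a * x ^ d + (\<Sum>i<d. Polynomial.coeff p i * x ^ i))" .
  then have "poly q (a * x) = 0" using 0 by simp
  then have "algebraic_int (a * x)"
    using lc p(1) a by (intro algebraic_int.intros[of q]) (auto simp: cq)
  moreover obtain k where k: "a = of_int k" using a by (elim Ints_cases)
  \<comment> \<open>The multiplier has to be a natural number, so a negative leading coefficient is
    replaced by its absolute value.\<close>
  moreover have "algebraic_int (of_nat (nat \<bar>k\<bar>) * x)"
  proof (cases "k \<ge> 0")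
    case True
    then show ?thesis using calculation by simp
  next
    case False
    then have "of_nat (nat \<bar>k\<bar>) * x = - (a * x)" using k by (simp add: of_nat_nat)
    then show ?thesis using calculation by (simp only: algebraic_int_minus_iff)
  qed
  ultimately show ?thesis using that[of "nat \<bar>k\<bar>"] a by auto
qed

lemma ring_set_place_ring:
  assumes p: "p \<in> finite_places L"
  shows "ring_set (place_ring L p)" "integers_of L \<subseteq> place_ring L p"
proof -
  note O = ring_setD[OF finite_placeD(1)[OF p]]
  note P = finite_placeD[OF p]
  show sub: "integers_of L \<subseteq> place_ring L p"
  proof
    fix x assume "x \<in> integers_of L"
    then show "x \<in> place_ring L p"
      unfolding place_ring_def using O(2) P(4)
      by (intro CollectI exI[of _ x] exI[of _ "1::complex"]) simp
  qed
  have closed: "x + y \<in> place_ring L p \<and> x * y \<in> place_ring L p"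
    if xy: "x \<in> place_ring L p" "y \<in> place_ring L p" for x y
  proof -
    obtain a b c d where abcd: "x = a / b" "y = c / d" "a \<in> integers_of L" "c \<in> integers_of L"
        "b \<in> integers_of L - p" "d \<in> integers_of L - p"
      using xy by (auto simp: place_ring_def)
    have bd: "b * d \<in> integers_of L - p" using abcd O(4) P(8) by blast
    have "b \<noteq> 0" "d \<noteq> 0" using abcd P(3) by auto
    then have "x + y = (a * d + c * b) / (b * d)" "x * y = (a * c) / (b * d)"
      using abcd by (auto simp: field_simps)
    moreover have "a * d + c * b \<in> integers_of L" "a * c \<in> integers_of L" using abcd O(3,4) by auto
    ultimately show ?thesis using bd unfolding place_ring_def by blast
  qed
  moreover have "- x \<in> place_ring L p" if "x \<in> place_ring L p" for x
  proof -
    obtain a b where "x = a / b" "a \<in> integers_of L" "b \<in> integers_of L - p"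
      using \<open>x \<in> place_ring L p\<close> unfolding place_ring_def by blast
    moreover from this have "- x = (- a) / b" "- a \<in> integers_of L" using O(5) by auto
    ultimately show ?thesis unfolding place_ring_def by blast
  qed
  ultimately show "ring_set (place_ring L p)"
    using sub O(1,2) by (auto simp: ring_set_def)
qed

lemma place_idealD:
  assumes p: "p \<in> finite_places L"
  shows "1 \<notin> place_ideal L p"
    "x \<in> place_ideal L p \<Longrightarrow> y \<in> place_ring L p \<Longrightarrow> x * y \<in> place_ideal L p"
    "x \<in> place_ring L p \<Longrightarrow> y \<in> place_ring L p \<Longrightarrow> x * y \<in> place_ideal L p \<Longrightarrow>
      x \<in> place_ideal L p \<or> y \<in> place_ideal L p"
proof -
  note O = ring_setD[OF finite_placeD(1)[OF p]]
  note P = finite_placeD[OF p]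
  show "1 \<notin> place_ideal L p" using P(2) by (auto simp: place_ideal_def)
  show "x * y \<in> place_ideal L p" if xy: "x \<in> place_ideal L p" "y \<in> place_ring L p"
  proof -
    obtain a b where ab: "x = a / b" "a \<in> p" "b \<in> integers_of L - p"
      using xy(1) unfolding place_ideal_def by blast
    moreover obtain c d where "y = c / d" "c \<in> integers_of L" "d \<in> integers_of L - p"
      using xy(2) unfolding place_ring_def by blast
    ultimately have abcd: "x = a / b" "y = c / d" "a \<in> p" "c \<in> integers_of L"
        "b \<in> integers_of L - p" "d \<in> integers_of L - p" by blast+
    then have "b * d \<in> integers_of L - p" "a * c \<in> p" using O(4) P(7,8) by blast+
    moreover have "x * y = (a * c) / (b * d)" using abcd by simp
    ultimately show ?thesis unfolding place_ideal_def by blast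
  qed
  show "x \<in> place_ideal L p \<or> y \<in> place_ideal L p"
    if xy: "x \<in> place_ring L p" "y \<in> place_ring L p" "x * y \<in> place_ideal L p"
  proof -
    obtain a b where "x = a / b" "a \<in> integers_of L" "b \<in> integers_of L - p"
      using xy(1) unfolding place_ring_def by blast
    moreover obtain c d where "y = c / d" "c \<in> integers_of L" "d \<in> integers_of L - p"
      using xy(2) unfolding place_ring_def by blast
    moreover obtain e f where "x * y = e / f" "e \<in> p" "f \<in> integers_of L - p"
      using xy(3) unfolding place_ideal_def by blast
    ultimately have *: "x = a / b" "y = c / d" "a \<in> integers_of L" "c \<in> integers_of L"
        "b \<in> integers_of L - p" "d \<in> integers_of L - p" "x * y = e / f" "e \<in> p" "f \<in> integers_of L - p"
      by blast+
    have nz: "b \<noteq> 0" "d \<noteq> 0" "f \<noteq> 0" using * P(3) by auto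
    have "a * c * f = e * (b * d)" using arg_cong[OF *(7), of "\<lambda>z. z * (b * d * f)"] *(1,2) nz by (simp add: mult_ac)
    moreover have "e * (b * d) \<in> p" using * O(4) P(7) by blast
    ultimately have "a * c * f \<in> p" by simp
    moreover have ac: "a * c \<in> integers_of L" using O(4)[OF *(3,4)] .
    ultimately have "a * c \<in> p" using P(8)[OF ac, of f] *(9) by blast
    then have "a \<in> p \<or> c \<in> p" using P(8)[OF *(3,4)] by blast
    then show ?thesis using * by (auto simp: place_ideal_def)
  qed
qed

text \<open>The excluded places are those containing the product \<open>N\<close> of denominators of
  the elements of \<open>A\<close>. Everywhere else each denominator is outside the prime ideal and
  may be inverted.\<close>

lemma almost_all_places_integral:
  assumes L: "number_field L" and A: "finite A" "A \<subseteq> L"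
  obtains S where "finite S" "S \<subseteq> finite_places L" "\<And>p. p \<in> finite_places L - S \<Longrightarrow> A \<subseteq> place_ring L p"
proof -
  have FL: "ring_set L" using L by (intro field_set_imp_ring_set number_field_imp_field_set)
  have "\<forall>x. \<exists>n::nat. x \<in> A \<longrightarrow> n > 0 \<and> algebraic_int (of_nat n * x)"
  proof
    fix x show "\<exists>n::nat. x \<in> A \<longrightarrow> n > 0 \<and> algebraic_int (of_nat n * x)"
    proof (cases "x \<in> A")
      case True
      then have "algebraic x" using number_field_imp_algebraic[OF L] A(2) by blast
      then show ?thesis by (elim algebraic_imp_multiple_algebraic_int) blast
    qed simp
  qed
  then obtain n where n: "\<And>x. x \<in> A \<Longrightarrow> n x > (0::nat) \<and> algebraic_int (of_nat (n x) * x)" by metis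
  define N where "N = (\<Prod>x\<in>A. n x)"
  have "N > 0" unfolding N_def using n by (simp add: prod_pos)
  define S where "S = {p \<in> finite_places L. of_nat N \<in> p}"
  have "A \<subseteq> place_ring L p" if p: "p \<in> finite_places L - S" for p
  proof
    fix x assume x: "x \<in> A"
    note O = ring_setD[OF finite_placeD(1)[of p L]]
    have pl: "p \<in> finite_places L" using p by blast
    have "N = n x * (\<Prod>x\<in>A-{x}. n x)" unfolding N_def using A(1) x by (simp add: prod.remove)
    then have "of_nat N = (of_nat (\<Prod>x\<in>A-{x}. n x) * of_nat (n x) :: complex)"
      by (metis mult.commute of_nat_mult)
    moreover have "of_nat N \<notin> p" using p by (simp add: S_def)
    ultimately have "of_nat (n x) \<notin> p"
      using finite_placeD(7)[OF pl _ O(7)[OF pl, of "\<Prod>x\<in>A-{x}. n x"], of "of_nat (n x)"]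
      by (metis mult.commute)
    moreover have "of_nat (n x) * x \<in> integers_of L"
      using n[OF x] x A(2) ring_setD(4,7)[OF FL] by (auto simp: integers_of_def)
    moreover have "x = of_nat (n x) * x / of_nat (n x)" using n[OF x] by simp
    ultimately show "x \<in> place_ring L p"
      using O(7)[OF pl, of "n x"] unfolding place_ring_def by blast
  qed
  then show ?thesis using that[of S] finite_places_above[OF L \<open>N > 0\<close>] by (auto simp: S_def)
qed

subsection \<open>Linear algebra\<close>

no_notation fps_nth (infixl "$" 75)

text \<open>Coefficients are functions on \<open>nat\<close> read only below the length, so that
  splitting a list amounts to a shift of indices.\<close>

definition lincomb :: "(nat \<Rightarrow> complex) \<Rightarrow> (complex ^ 'n) list \<Rightarrow> complex ^ 'n" where
  "lincomb c xs = (\<Sum>i<length xs. c i *s xs ! i)"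

definition lin_indep :: "(complex ^ 'n) list \<Rightarrow> bool" where
  "lin_indep xs \<longleftrightarrow> (\<forall>c. lincomb c xs = 0 \<longrightarrow> (\<forall>i<length xs. c i = 0))"

lemma lin_indepD: "lin_indep xs \<Longrightarrow> lincomb c xs = 0 \<Longrightarrow> i < length xs \<Longrightarrow> c i = 0"
  by (auto simp: lin_indep_def)

lemma lin_indep_iff: "lin_indep xs \<longleftrightarrow> distinct xs \<and> vec.independent (set xs)"
proof
  assume xs: "lin_indep xs"
  have "distinct xs"
  proof (rule ccontr)
    assume "\<not> distinct xs"
    then obtain i j where ij: "i < length xs" "j < length xs" "i \<noteq> j" "xs ! i = xs ! j"
      by (auto simp: distinct_conv_nth)
    define c :: "nat \<Rightarrow> complex" where "c k = (if k = i then 1 else if k = j then -1 else 0)" for k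
    have "lincomb c xs = (\<Sum>k\<in>{i, j}. c k *s xs ! k)"
      unfolding lincomb_def by (rule sum.mono_neutral_right) (use ij in \<open>auto simp: c_def\<close>)
    also have "\<dots> = 0" using ij by (simp add: c_def vec_eq_iff)
    finally have "c i = 0" using xs ij(1) by (simp add: lin_indep_def)
    then show False by (simp add: c_def)
  qed
  moreover have "vec.independent (set xs)"
  proof (rule vec.independent_if_scalars_zero)
    fix f x assume f: "(\<Sum>x\<in>set xs. f x *s x) = 0" and x: "x \<in> set xs"
    obtain i where i: "i < length xs" "xs ! i = x" using x by (metis in_set_conv_nth)
    have "(\<Sum>x\<in>set xs. f x *s x) = lincomb (\<lambda>i. f (xs ! i)) xs"
      unfolding lincomb_def
      by (rule sum.reindex_bij_betw[symmetric, OF bij_betw_nth]) (use \<open>distinct xs\<close> in auto)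
    then show "f x = 0" using lin_indepD[OF xs _ i(1)] f i(2) by metis
  qed simp
  ultimately show "distinct xs \<and> vec.independent (set xs)" ..
next
  assume xs: "distinct xs \<and> vec.independent (set xs)"
  show "lin_indep xs"
    unfolding lin_indep_def
  proof (intro allI impI)
    fix c i assume c: "lincomb c xs = 0" and i: "i < length xs"
    define f where "f x = c (the_inv_into {..<length xs} ((!) xs) x)" for x
    have inj: "inj_on ((!) xs) {..<length xs}" using xs by (simp add: inj_on_nth)
    have fc: "f (xs ! k) = c k" if "k < length xs" for k
      using the_inv_into_f_f[OF inj, of k] that by (simp add: f_def)
    have "(\<Sum>x\<in>set xs. f x *s x) = lincomb (\<lambda>i. f (xs ! i)) xs"
      unfolding lincomb_def
      by (rule sum.reindex_bij_betw[symmetric, OF bij_betw_nth]) (use xs in auto)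
    also have "\<dots> = lincomb c xs" unfolding lincomb_def using fc by (intro sum.cong) auto
    finally have "f (xs ! i) = 0"
      using c vec.independentD[of "set xs" "set xs" f "xs ! i"] xs i by auto
    then show "c i = 0" using fc[OF i] by simp
  qed
qed

lemma lin_indep_extend:
  fixes xs :: "(complex ^ 'n::finite) list"
  assumes "lin_indep xs"
  obtains ys where "lin_indep (xs @ ys)" "length (xs @ ys) = CARD('n)"
proof -
  have "vec.independent (set xs)" using assms by (simp add: lin_indep_iff)
  note ext = vec.extend_basis_superset[OF this] vec.independent_extend_basis[OF this]
    vec.span_extend_basis[OF this]
  define B where "B = vec.extend_basis (set xs)"
  have B: "set xs \<subseteq> B" "vec.independent B" "UNIV \<subseteq> vec.span B"
    using ext by (auto simp: B_def)
  have "card B = CARD('n)"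
    using vec.basis_card_eq_dim[of B UNIV] B unfolding vec_dim_card by simp
  have "finite B" using B(2) vec.finiteI_independent by blast
  then obtain ys where ys: "set ys = B - set xs" "distinct ys"
    using finite_distinct_list[of "B - set xs"] by blast
  have "set (xs @ ys) = B" "distinct (xs @ ys)" using ys B(1) assms by (auto simp: lin_indep_iff)
  then show ?thesis
    using that[of ys] B(2) \<open>card B = CARD('n)\<close> by (metis distinct_card lin_indep_iff)
qed

lemma lin_indep_basis:
  fixes xs :: "(complex ^ 'n::finite) list"
  assumes "lin_indep xs" "length xs = CARD('n)"
  obtains c where "x = lincomb c xs"
proof -
  have xs: "distinct xs" "vec.independent (set xs)" using assms by (auto simp: lin_indep_iff)
  have "UNIV \<subseteq> vec.span (set xs)"
    using vec.card_ge_dim_independent[of "set xs" UNIV] xs assms(2)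
    unfolding vec_dim_card by (simp add: distinct_card)
  then have "x \<in> vec.span (set xs)" by blast
  then obtain f where "x = (\<Sum>y\<in>set xs. f y *s y)"
    by (auto simp: vec.span_finite)
  also have "\<dots> = lincomb (\<lambda>i. f (xs ! i)) xs"
    unfolding lincomb_def
    by (rule sum.reindex_bij_betw[symmetric, OF bij_betw_nth]) (use xs in auto)
  finally show ?thesis using that by blast
qed

section \<open>Linear systems over the complex and over the algebraic numbers\<close>

lemma homogeneous_system_solution:
  fixes A :: "'j \<Rightarrow> 'i \<Rightarrow> complex"
  assumes "finite J" "finite I" "card J < card I"
  obtains c where "\<exists>i\<in>I. c i \<noteq> 0" "\<And>j. j \<in> J \<Longrightarrow> (\<Sum>i\<in>I. c i * A j i) = 0"
proof -
  have "\<exists>c. (\<exists>i\<in>I. c i \<noteq> 0) \<and> (\<forall>j\<in>J. (\<Sum>i\<in>I. c i * A j i) = 0)"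
    using assms
  proof (induction J arbitrary: I A rule: finite_induct)
    case empty
    then show ?case by (intro exI[of _ "\<lambda>_. 1"]) (auto simp: card_gt_0_iff)
  next
    case (insert j J)
    show ?case
    proof (cases "\<forall>i\<in>I. A j i = 0")
      case True
      then show ?thesis using insert.IH[of I A] insert.hyps insert.prems by auto
    next
      case False
      then obtain i0 where i0: "i0 \<in> I" "A j i0 \<noteq> 0" by blast
      \<comment> \<open>Equation \<open>j\<close> eliminates the unknown \<open>i0\<close> from all
        other equations.\<close>
      define A' where "A' k i = A k i - A k i0 * A j i / A j i0" for k i
      have "card J < card (I - {i0})"
        using insert.hyps insert.prems i0(1) by (simp add: card_Diff_singleton)
      obtain c where c: "\<exists>i\<in>I-{i0}. c i \<noteq> 0" "\<forall>k\<in>J. (\<Sum>i\<in>I-{i0}. c i * A' k i) = 0"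
        using insert.IH[of "I - {i0}" A'] insert.prems(1) \<open>card J < card (I - {i0})\<close> by auto
      define s where "s = (\<Sum>i\<in>I-{i0}. c i * A j i)"
      define d where "d i = (if i = i0 then - s / A j i0 else c i)" for i
      have sd: "(\<Sum>i\<in>I. d i * A k i) = - s / A j i0 * A k i0 + (\<Sum>i\<in>I-{i0}. c i * A k i)" for k
        using i0(1) insert.prems(1) by (simp add: sum.remove d_def)
      have "(\<Sum>i\<in>I. d i * A k i) = 0" if "k \<in> J" for k
      proof -
        have "(\<Sum>i\<in>I-{i0}. c i * A' k i) = (\<Sum>i\<in>I-{i0}. c i * A k i) - A k i0 / A j i0 * s"
          by (simp add: A'_def s_def sum_subtractf sum_distrib_left algebra_simps)
        then have "(\<Sum>i\<in>I-{i0}. c i * A k i) = A k i0 / A j i0 * s"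
          using c(2) that by simp
        then show ?thesis unfolding sd by simp
      qed
      moreover have "(\<Sum>i\<in>I. d i * A j i) = 0"
        unfolding sd using i0(2) by (simp add: s_def)
      moreover have "\<exists>i\<in>I. d i \<noteq> 0" using c(1) by (auto simp: d_def)
      ultimately show ?thesis by blast
    qed
  qed
  then show ?thesis using that by blast
qed

text \<open>Elimination uses only field operations on the coefficients, so a complex solution
  guarantees an algebraic one. The induction is on the unknowns, which allows any index type for the
  equations.\<close>

lemma algebraic_linear_system_aux:
  fixes A :: "'i \<Rightarrow> 'j \<Rightarrow> complex"
  assumes "finite J" "\<And>i j. j \<in> J \<Longrightarrow> algebraic (A i j)" "\<And>i. algebraic (b i)"
    and "\<And>i. (\<Sum>j\<in>J. A i j * x j) = b i"
  shows "\<exists>y. (\<forall>j. algebraic (y j)) \<and> (\<forall>i. (\<Sum>j\<in>J. A i j * y j) = b i)"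
  using assms
proof (induction J arbitrary: A b rule: finite_induct)
  case empty
  then show ?case by (intro exI[of _ "\<lambda>_. 0"]) auto
next
  case (insert j0 J)
  show ?case
  proof (cases "\<forall>i. A i j0 = 0")
    case True
    obtain y where "\<forall>j. algebraic (y j)" "\<forall>i. (\<Sum>j\<in>J. A i j * y j) = b i"
      using insert.IH[of A b] insert.prems insert.hyps True by auto
    then show ?thesis using True insert.hyps by (intro exI[of _ y]) auto
  next
    case False
    then obtain i0 where i0: "A i0 j0 \<noteq> 0" by blast
    define A' where "A' i j = A i j - A i j0 * A i0 j / A i0 j0" for i j
    define b' where "b' i = b i - A i j0 * b i0 / A i0 j0" for i
    have sA': "(\<Sum>j\<in>J. A' i j * y j) = (\<Sum>j\<in>J. A i j * y j) - A i j0 / A i0 j0 * (\<Sum>j\<in>J. A i0 j * y j)" for i y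
      by (simp add: A'_def sum_subtractf sum_distrib_left algebra_simps)
    have "(\<Sum>j\<in>J. A' i j * x j) = b' i" for i
    proof -
      have bi: "A k j0 * x j0 + (\<Sum>j\<in>J. A k j * x j) = b k" for k
        using insert.prems(3)[of k] insert.hyps by simp
      have "u - a / d * w = (a * z + u) - a * (d * z + w) / d" if "d \<noteq> 0" for a d u w z :: complex
        using that by (simp add: field_simps)
      from this[OF i0] show ?thesis unfolding sA' b'_def bi[symmetric] .
    qed
    moreover have "algebraic (A' i j)" if "j \<in> J" for i j
      unfolding A'_def using insert.prems(1) that by (auto intro!: algebraic_intros)
    moreover have "algebraic (b' i)" for i
      unfolding b'_def using insert.prems(1,2) by (auto intro!: algebraic_intros)
    ultimately obtain y where y: "\<forall>j. algebraic (y j)" "\<forall>i. (\<Sum>j\<in>J. A' i j * y j) = b' i"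
      using insert.IH[of A' b'] by auto
    define z where "z = y(j0 := (b i0 - (\<Sum>j\<in>J. A i0 j * y j)) / A i0 j0)"
    have Jz: "(\<Sum>j\<in>J. A i j * z j) = (\<Sum>j\<in>J. A i j * y j)" for i
      by (rule sum.cong) (use insert.hyps in \<open>auto simp: z_def\<close>)
    have "algebraic (z j)" for j
      using y(1) insert.prems(1,2) by (auto simp: z_def intro!: algebraic_intros)
    moreover have "(\<Sum>j\<in>insert j0 J. A i j * z j) = b i" for i
    proof -
      have "(\<Sum>j\<in>J. A i j * y j) = b' i + A i j0 / A i0 j0 * (\<Sum>j\<in>J. A i0 j * y j)"
        using y(2) sA'[of i y] by (simp add: algebra_simps)
      then show ?thesis
        using insert.hyps i0 by (simp add: Jz) (simp add: z_def b'_def field_simps)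
    qed
    ultimately show ?thesis by blast
  qed
qed

lemma algebraic_linear_system:
  fixes A :: "'i \<Rightarrow> complex ^ 'n::finite"
  assumes "\<And>i j. algebraic (A i $ j)" "\<And>i. algebraic (b i)"
    and "\<And>i. (\<Sum>j\<in>UNIV. A i $ j * x $ j) = b i"
  obtains y :: "complex ^ 'n" where "\<And>j. algebraic (y $ j)" "\<And>i. (\<Sum>j\<in>UNIV. A i $ j * y $ j) = b i"
proof -
  obtain y where "\<forall>j. algebraic (y j)" "\<forall>i. (\<Sum>j\<in>UNIV. A i $ j * y j) = b i"
    using algebraic_linear_system_aux[of UNIV "\<lambda>i j. A i $ j" b "\<lambda>j. x $ j"] assms by auto
  then show ?thesis using that[of "\<chi> j. y j"] by simp
qed

section \<open>Polynomial functions of one variable\<close>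

definition polyfun :: "(complex \<Rightarrow> complex) \<Rightarrow> bool" where
  "polyfun f \<longleftrightarrow> (\<exists>p. f = poly p)"

lemma polyfun_const: "polyfun (\<lambda>_. c)"
  unfolding polyfun_def by (intro exI[of _ "[:c:]"]) auto

lemma polyfun_id: "polyfun (\<lambda>t. t)"
  unfolding polyfun_def by (intro exI[of _ "[:0, 1:]"]) auto

lemma polyfun_add: "polyfun f \<Longrightarrow> polyfun g \<Longrightarrow> polyfun (\<lambda>t. f t + g t)"
proof -
  assume "polyfun f" "polyfun g"
  then obtain p q where "f = poly p" "g = poly q" by (auto simp: polyfun_def)
  then have "(\<lambda>t. f t + g t) = poly (p + q)" by (simp add: fun_eq_iff)
  then show ?thesis unfolding polyfun_def by (rule exI)
qed

lemma polyfun_mult: "polyfun f \<Longrightarrow> polyfun g \<Longrightarrow> polyfun (\<lambda>t. f t * g t)"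
proof -
  assume "polyfun f" "polyfun g"
  then obtain p q where "f = poly p" "g = poly q" by (auto simp: polyfun_def)
  then have "(\<lambda>t. f t * g t) = poly (p * q)" by (simp add: fun_eq_iff)
  then show ?thesis unfolding polyfun_def by (rule exI)
qed

lemma polyfun_diff: "polyfun f \<Longrightarrow> polyfun g \<Longrightarrow> polyfun (\<lambda>t. f t - g t)"
proof -
  assume "polyfun f" "polyfun g"
  then obtain p q where "f = poly p" "g = poly q" by (auto simp: polyfun_def)
  then have "(\<lambda>t. f t - g t) = poly (p - q)" by (simp add: fun_eq_iff)
  then show ?thesis unfolding polyfun_def by (rule exI)
qed

lemma polyfun_uminus: "polyfun f \<Longrightarrow> polyfun (\<lambda>t. - f t)"
  using polyfun_diff[OF polyfun_const[of 0]] by simp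

lemma polyfun_divide: "polyfun f \<Longrightarrow> polyfun (\<lambda>t. f t / c)"
  using polyfun_mult[OF _ polyfun_const[of "inverse c"]] by (simp add: divide_inverse)

lemma polyfun_sum: "(\<And>i. i \<in> I \<Longrightarrow> polyfun (f i)) \<Longrightarrow> polyfun (\<lambda>t. \<Sum>i\<in>I. f i t)"
  by (induction I rule: infinite_finite_induct) (auto intro: polyfun_const polyfun_add)

lemma polyfun_prod: "(\<And>i. i \<in> I \<Longrightarrow> polyfun (f i)) \<Longrightarrow> polyfun (\<lambda>t. \<Prod>i\<in>I. f i t)"
  by (induction I rule: infinite_finite_induct) (auto intro: polyfun_const polyfun_mult)

lemma polyfun_power: "polyfun f \<Longrightarrow> polyfun (\<lambda>t. f t ^ n)"
  by (induction n) (auto intro: polyfun_const polyfun_mult)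

lemmas polyfun_intros = polyfun_const polyfun_id polyfun_add polyfun_mult polyfun_diff polyfun_uminus
  polyfun_divide polyfun_sum polyfun_prod polyfun_power

lemma polyfun_det:
  assumes "\<And>i j. polyfun (\<lambda>t. A t $ i $ j)"
  shows "polyfun (\<lambda>t. det (A t :: complex ^ 'n ^ 'n::finite))"
  unfolding det_def using assms by (intro polyfun_intros) auto

lemma polyfun_zero:
  assumes "polyfun f" "infinite {t. f t = 0}"
  shows "f t = 0"
proof -
  obtain p where p: "f = poly p" using assms(1) by (auto simp: polyfun_def)
  then have "p = 0" using assms(2) poly_roots_finite[of p] by blast
  then show ?thesis using p by simp
qed

lemma polyfun_finite_zeros:
  assumes "polyfun f" "f t \<noteq> 0"
  shows "finite {t. f t = 0}"
  using polyfun_zero assms by blast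

text \<open>The determinant of the pencil is a binary form of positive degree and has a zero on the
  projective line. The functions \<open>f\<close> and \<open>g\<close> are its restrictions to the
  two affine charts.\<close>

lemma exists_singular_pencil_member:
  fixes A B :: "complex ^ 'n ^ 'n::finite"
  obtains s t x where "s \<noteq> 0 \<or> t \<noteq> 0" "x \<noteq> 0" "s *s (A *v x) + t *s (B *v x) = 0"
proof -
  have ker: "\<exists>x. x \<noteq> 0 \<and> M *v x = 0" if "det M = 0" for M :: "complex ^ 'n ^ 'n"
  proof (rule ccontr)
    assume "\<not> ?thesis"
    then have "inj ((*v) M)"
      using vec.inj_iff_eq_0[of M] by blast
    then have "det (matrix ((*v) M)) \<noteq> 0" using det_nz_iff_inj_gen[of "(*v) M"] by simp
    then show False using that by simp
  qed
  define f where "f t = det (\<chi> i. A $ i + t *s B $ i)" for t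
  define g where "g t = det (\<chi> i. t *s A $ i + B $ i)" for t
  have pf: "polyfun f" "polyfun g"
    unfolding f_def g_def by (auto intro!: polyfun_det polyfun_intros)
  have mv: "(\<chi> i. A $ i + t *s B $ i) *v x = A *v x + t *s (B *v x)" for t x
    by (simp add: vec_eq_iff matrix_vector_mult_def sum.distrib sum_distrib_left algebra_simps)
  show ?thesis
  proof (cases "\<exists>t. f t = 0")
    case True
    then obtain t where t: "f t = 0" ..
    obtain x where x: "x \<noteq> 0" "(\<chi> i. A $ i + t *s B $ i) *v x = 0"
      using ker[OF t[unfolded f_def]] by blast
    then have "A *v x + t *s (B *v x) = 0" unfolding mv by simp
    with x(1) show ?thesis using that[of 1 t x] by simp
  next
    \<comment> \<open>Without a root \<open>f\<close> is constant by the fundamental theorem of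
      algebra. Then \<open>g t = t ^ CARD('n) * f 0\<close> away from \<open>0\<close>, and as an
      identity of polynomials also at \<open>0\<close>, where the right side vanishes; so
      \<open>B\<close> itself is singular.\<close>
    case False
    obtain p where p: "f = poly p" using pf(1) by (auto simp: polyfun_def)
    have "constant (poly p)"
      using False p fundamental_theorem_of_algebra by metis
    then have fc: "f t = f 0" for t by (simp add: p constant_def)
    have gf: "g t = t ^ CARD('n) * f 0" if "t \<noteq> 0" for t
    proof -
      have "(\<chi> i. t *s A $ i + B $ i) = (\<chi> i. t *s (A $ i + inverse t *s B $ i))"
        using that by (simp add: vec_eq_iff distrib_left)
      then have "g t = t ^ CARD('n) * f (inverse t)"
        unfolding g_def f_def using det_rows_mul[of "\<lambda>_. t" "\<lambda>i. A $ i + inverse t *s B $ i"] by simp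
      then show ?thesis using fc by metis
    qed
    have "g 0 - 0 ^ CARD('n) * f 0 = 0"
    proof (rule polyfun_zero[where f = "\<lambda>t. g t - t ^ CARD('n) * f 0"])
      show "polyfun (\<lambda>t. g t - t ^ CARD('n) * f 0)" by (intro polyfun_intros pf)
      have "UNIV - {0} \<subseteq> {t. g t - t ^ CARD('n) * f 0 = 0}" using gf by auto
      moreover have "infinite (UNIV - {0::complex})"
        using infinite_UNIV_char_0 by (simp add: infinite_remove)
      ultimately show "infinite {t. g t - t ^ CARD('n) * f 0 = 0}" using infinite_super by blast
    qed
    then have "det B = 0" by (simp add: g_def)
    then obtain x where "x \<noteq> 0" "B *v x = 0" using ker by blast
    then show ?thesis using that[of 0 1 x] by simp
  qed
qed

section \<open>Lists of independent vectors and dimension counts\<close>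

lemma lincomb_Nil [simp]: "lincomb c [] = 0"
  by (simp add: lincomb_def)

lemma lincomb_Cons [simp]: "lincomb c (x # xs) = c 0 *s x + lincomb (\<lambda>i. c (Suc i)) xs"
proof -
  have "{..<length (x # xs)} = insert 0 (Suc ` {..<length xs})"
    by (auto simp: image_iff less_Suc_eq_0_disj)
  then show ?thesis by (simp add: lincomb_def sum.reindex)
qed

lemma lincomb_append: "lincomb c (xs @ ys) = lincomb c xs + lincomb (\<lambda>i. c (i + length xs)) ys"
  by (induction xs arbitrary: c) (simp_all add: add.assoc)

lemma lincomb_linear: "lincomb (\<lambda>i. x * a i + y * b i) ks = x *s lincomb a ks + y *s lincomb b ks"
  by (simp add: lincomb_def vec_eq_iff sum.distrib sum_distrib_left algebra_simps)

lemma lincomb_zero [simp]: "lincomb (\<lambda>_. 0) ks = 0"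
  by (simp add: lincomb_def)

lemma lin_indep_singleton: "lin_indep [v] \<longleftrightarrow> v \<noteq> 0"
  by (auto simp: lin_indep_iff)

lemma lin_indep_2: "lin_indep [v, w] \<longleftrightarrow> (\<forall>a b. a *s v + b *s w = 0 \<longrightarrow> a = 0 \<and> b = 0)"
proof
  assume vw: "lin_indep [v, w]"
  show "\<forall>a b. a *s v + b *s w = 0 \<longrightarrow> a = 0 \<and> b = 0"
  proof (intro allI impI)
    fix a b assume "a *s v + b *s w = 0"
    then have "lincomb ((!) [a, b]) [v, w] = 0" by simp
    from lin_indepD[OF vw this, of 0] lin_indepD[OF vw this, of 1] show "a = 0 \<and> b = 0" by simp
  qed
next
  assume "\<forall>a b. a *s v + b *s w = 0 \<longrightarrow> a = 0 \<and> b = 0"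
  then show "lin_indep [v, w]" by (simp add: lin_indep_def less_Suc_eq)
qed

lemma lin_indep_3:
  "lin_indep [u, v, w] \<longleftrightarrow> (\<forall>a b c. a *s u + b *s v + c *s w = 0 \<longrightarrow> a = 0 \<and> b = 0 \<and> c = 0)"
proof
  assume vw: "lin_indep [u, v, w]"
  show "\<forall>a b c. a *s u + b *s v + c *s w = 0 \<longrightarrow> a = 0 \<and> b = 0 \<and> c = 0"
  proof (intro allI impI)
    fix a b c assume "a *s u + b *s v + c *s w = 0"
    then have "lincomb ((!) [a, b, c]) [u, v, w] = 0" by (simp add: add.assoc)
    from lin_indepD[OF vw this, of 0] lin_indepD[OF vw this, of 1] lin_indepD[OF vw this, of 2]
    show "a = 0 \<and> b = 0 \<and> c = 0" by simp
  qed
next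
  assume "\<forall>a b c. a *s u + b *s v + c *s w = 0 \<longrightarrow> a = 0 \<and> b = 0 \<and> c = 0"
  then show "lin_indep [u, v, w]"
    by (simp add: lin_indep_def less_Suc_eq add.assoc numeral_2_eq_2)
qed

lemma lin_indep_mono:
  assumes "lin_indep ys" "set xs \<subseteq> set ys" "distinct xs"
  shows "lin_indep xs"
  using assms vec.independent_mono[of "set ys" "set xs"] by (simp add: lin_indep_iff)

lemma lin_indep_lincomb_ne_0: "lin_indep ks \<Longrightarrow> i < length ks \<Longrightarrow> c i \<noteq> 0 \<Longrightarrow> lincomb c ks \<noteq> 0"
  by (auto simp: lin_indep_def)

text \<open>The spans of \<open>xs\<close> and \<open>ys\<close> meet only in zero, so any
  independent vectors from the span of \<open>ys\<close> can take the place of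
  \<open>ys\<close>.\<close>

lemma lin_indep_append_subst:
  assumes xy: "lin_indep (xs @ ys)" and zs: "lin_indep zs" and z: "\<And>z. z \<in> set zs \<Longrightarrow> \<exists>c. z = lincomb c ys"
  shows "lin_indep (xs @ zs)"
  unfolding lin_indep_def
proof (intro allI impI)
  fix c i assume c: "lincomb c (xs @ zs) = 0" and i: "i < length (xs @ zs)"
  have span: "\<exists>d. lincomb e us = lincomb d ys" if "set us \<subseteq> set zs" for e us
    using that
  proof (induction us arbitrary: e)
    case Nil
    then show ?case by (intro exI[of _ "\<lambda>_. 0"]) simp
  next
    case (Cons u us)
    obtain d where "lincomb (\<lambda>i. e (Suc i)) us = lincomb d ys"
      using Cons.IH[of "\<lambda>i. e (Suc i)"] Cons.prems by auto
    moreover obtain d' where "u = lincomb d' ys" using z[of u] Cons.prems by auto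
    ultimately show ?case
      using lincomb_linear[of "e 0" d' 1 d ys] by (intro exI[of _ "\<lambda>i. e 0 * d' i + 1 * d i"]) simp
  qed
  define e where "e i = c (i + length xs)" for i
  obtain d where d: "lincomb e zs = lincomb d ys" using span[of zs e] by auto
  define f where "f i = (if i < length xs then c i else d (i - length xs))" for i
  have "lincomb f (xs @ ys) = lincomb c xs + lincomb d ys"
    unfolding lincomb_append by (simp add: f_def lincomb_def)
  also have "\<dots> = 0" using c unfolding lincomb_append d[symmetric] e_def by simp
  finally have f0: "f i = 0" if "i < length (xs @ ys)" for i using lin_indepD[OF xy] that by blast
  have "d i = 0" if "i < length ys" for i using f0[of "i + length xs"] that by (simp add: f_def)
  then have "lincomb e zs = 0" unfolding d by (simp add: lincomb_def)
  then have e0: "e i = 0" if "i < length zs" for i using lin_indepD[OF zs] that by blast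
  show "c i = 0"
  proof (cases "i < length xs")
    case True
    then show ?thesis using f0[of i] by (simp add: f_def)
  next
    case False
    then show ?thesis using e0[of "i - length xs"] i by (simp add: e_def)
  qed
qed

text \<open>Three coefficients leave room for two linear conditions on \<open>b\<close>: it kills
  \<open>g\<close>, and its coordinate \<open>i0\<close>, which is nonzero for \<open>a\<close>,
  vanishes. The second condition forces independence.\<close>

lemma lin_indep_partner:
  assumes ks: "lin_indep ks" "3 \<le> length ks" and i0: "i0 < length ks" "a i0 \<noteq> 0"
  obtains b where "lin_indep [lincomb a ks, lincomb b ks]" "(\<Sum>i<length ks. b i * g i) = 0"
proof -
  obtain b where b: "\<exists>i\<in>{..<length ks}. b i \<noteq> 0"
    "\<And>j. j \<in> {0::nat, 1} \<Longrightarrow> (\<Sum>i\<in>{..<length ks}. b i * (if j = 0 then g i else if i = i0 then 1 else 0)) = 0"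
    using homogeneous_system_solution[of "{0::nat, 1}" "{..<length ks}"
        "\<lambda>j i. if j = 0 then g i else if i = i0 then 1 else 0"] ks(2) by auto
  have g: "(\<Sum>i<length ks. b i * g i) = 0" using b(2)[of 0] by simp
  have "b i0 = (\<Sum>i<length ks. b i * (if i = i0 then 1 else 0))"
    using i0 by (simp add: if_distrib cong: if_cong)
  then have b0: "b i0 = 0" using b(2)[of 1] by simp
  have "lin_indep [lincomb a ks, lincomb b ks]"
    unfolding lin_indep_2
  proof (intro allI impI)
    fix x y assume "x *s lincomb a ks + y *s lincomb b ks = 0"
    then have 0: "x * a i + y * b i = 0" if "i < length ks" for i
      using lin_indepD[OF ks(1), of "\<lambda>i. x * a i + y * b i"] that lincomb_linear[of x a y b ks] by simp
    have "x = 0" using 0[OF i0(1)] b0 i0(2) by simp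
    moreover from this b(1) 0 have "y = 0" by auto
    ultimately show "x = 0 \<and> y = 0" ..
  qed
  then show ?thesis using that g by blast
qed

lemma lin_indep_two_kernel:
  assumes ks: "lin_indep ks" "3 \<le> length ks"
  obtains a b where "lin_indep [lincomb a ks, lincomb b ks]" "(\<Sum>i<length ks. a i * g i) = 0"
    "(\<Sum>i<length ks. b i * g i) = 0"
proof -
  obtain a where a: "\<exists>i\<in>{..<length ks}. a i \<noteq> 0" "(\<Sum>i<length ks. a i * g i) = 0"
    using homogeneous_system_solution[of "{0::nat}" "{..<length ks}" "\<lambda>_ i. g i"] ks(2) by auto
  then obtain i0 where "i0 < length ks" "a i0 \<noteq> 0" by auto
  then obtain b where "lin_indep [lincomb a ks, lincomb b ks]" "(\<Sum>i<length ks. b i * g i) = 0"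
    using lin_indep_partner[of ks i0 a g] ks by blast
  then show ?thesis using a(2) that by blast
qed

text \<open>The row \<open>k0\<close> of the square system follows from the others by the relation
  \<open>r\<close>; once it is dropped, there are fewer equations than unknowns.\<close>

lemma dependent_functionals:
  fixes g :: "nat \<Rightarrow> nat \<Rightarrow> complex"
  assumes "k0 < n" "r k0 \<noteq> 0" "\<And>i. i < n \<Longrightarrow> (\<Sum>k<n. r k * g k i) = 0"
  obtains x where "\<exists>i<n. x i \<noteq> 0" "\<And>k. k < n \<Longrightarrow> (\<Sum>i<n. x i * g k i) = 0"
proof -
  obtain x where x: "\<exists>i\<in>{..<n}. x i \<noteq> 0" "\<And>k. k \<in> {..<n} - {k0} \<Longrightarrow> (\<Sum>i\<in>{..<n}. x i * g k i) = 0"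
    using homogeneous_system_solution[of "{..<n} - {k0}" "{..<n}" g] assms(1) by auto
  have "(\<Sum>k<n. r k * (\<Sum>i<n. x i * g k i)) = (\<Sum>i<n. x i * (\<Sum>k<n. r k * g k i))"
    by (simp add: sum_distrib_left mult_ac) (rule sum.swap)
  also have "\<dots> = 0" using assms(3) by simp
  finally have "r k0 * (\<Sum>i<n. x i * g k0 i) + (\<Sum>k\<in>{..<n}-{k0}. r k * (\<Sum>i<n. x i * g k i)) = 0"
    by (subst (asm) sum.remove[of _ k0]) (use assms(1) in auto)
  then have "(\<Sum>i<n. x i * g k0 i) = 0" using x(2) assms(2) by simp
  then have "(\<Sum>i<n. x i * g k i) = 0" if "k < n" for k
    using x(2)[of k] that by (cases "k = k0") auto
  then show ?thesis using that[of x] x(1) by auto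
qed

lemma singular_pencil_nat:
  fixes A B :: "nat \<Rightarrow> nat \<Rightarrow> complex"
  assumes "n = card (UNIV :: 'n::finite set)"
  obtains s t x where "s \<noteq> 0 \<or> t \<noteq> 0" "\<exists>i<n. x i \<noteq> 0"
    "\<And>i. i < n \<Longrightarrow> s * (\<Sum>j<n. A i j * x j) + t * (\<Sum>j<n. B i j * x j) = 0"
proof -
  obtain h :: "nat \<Rightarrow> 'n" where h: "bij_betw h {..<n} UNIV"
    using ex_bij_betw_nat_finite[of "UNIV :: 'n set"] assms by (auto simp: atLeast0LessThan)
  define h' where "h' = the_inv_into {..<n} h"
  have hh': "h' (h i) = i" if "i < n" for i
    using h that unfolding h'_def by (simp add: bij_betw_def the_inv_into_f_f)
  obtain s t and x :: "complex ^ 'n" where st: "s \<noteq> 0 \<or> t \<noteq> 0" "x \<noteq> 0"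
     and 0: "s *s ((\<chi> i j. A (h' i) (h' j)) *v x) + t *s ((\<chi> i j. B (h' i) (h' j)) *v x) = 0"
    using exists_singular_pencil_member[of "\<chi> i j. A (h' i) (h' j)" "\<chi> i j. B (h' i) (h' j)"] by blast
  have mv: "((\<chi> i j. M (h' i) (h' j)) *v x) $ h i = (\<Sum>j<n. M i j * x $ h j)" if "i < n" for M :: "nat \<Rightarrow> nat \<Rightarrow> complex" and i
    using that hh' by (simp add: matrix_vector_mult_def sum.reindex_bij_betw[OF h, symmetric])
  have "\<exists>i<n. x $ h i \<noteq> 0"
  proof -
    obtain k where "x $ k \<noteq> 0" using st(2) by (auto simp: vec_eq_iff)
    moreover obtain i where "i < n" "h i = k" using h by (metis bij_betw_iff_bijections UNIV_I lessThan_iff)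
    ultimately show ?thesis by auto
  qed
  moreover have "s * (\<Sum>j<n. A i j * x $ h j) + t * (\<Sum>j<n. B i j * x $ h j) = 0" if "i < n" for i
    using arg_cong[OF 0, of "\<lambda>y. y $ h i"] mv[OF that, of A] mv[OF that, of B] by simp
  ultimately show ?thesis using that[of s t "\<lambda>i. x $ h i"] st(1) by blast
qed


subsection \<open>Nets of alternating forms\<close>

text \<open>The three linear equations of a section of codimension 3, read as a net of alternating
  forms on the 5-space: \<open>wedge v w\<close> is in the section iff all forms vanish on
  \<open>v\<close>, \<open>w\<close>. The last axiom is transversality at that point, since a
  functional kills the tangent space there iff \<open>v\<close> and \<open>w\<close> are in the
  kernel of its form.\<close>

locale net =
  fixes \<omega> :: "complex ^ 3 \<Rightarrow> complex ^ 5 \<Rightarrow> complex ^ 5 \<Rightarrow> complex"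
  assumes add1: "\<omega> (c + d) v w = \<omega> c v w + \<omega> d v w"
    and scale1: "\<omega> (x *s c) v w = x * \<omega> c v w"
    and add2: "\<omega> c (v + v') w = \<omega> c v w + \<omega> c v' w"
    and scale2: "\<omega> c (x *s v) w = x * \<omega> c v w"
    and skew: "\<omega> c v w = - \<omega> c w v"
    and transversal: "lin_indep [v, w] \<Longrightarrow> (\<And>c. \<omega> c v w = 0) \<Longrightarrow>
       (\<And>x. \<omega> c v x = 0) \<Longrightarrow> (\<And>x. \<omega> c w x = 0) \<Longrightarrow> c = 0"
begin

lemma alt: "\<omega> c v v = 0"
  using skew[of c v v] by simp

lemma add3: "\<omega> c v (w + w') = \<omega> c v w + \<omega> c v w'"
  using skew[of c v] add2 by simp

lemma scale3: "\<omega> c v (x *s w) = x * \<omega> c v w"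
  using skew[of c v] scale2 by simp

lemma zero: "\<omega> 0 v w = 0" "\<omega> c 0 w = 0" "\<omega> c v 0 = 0"
  using scale1[of 0 0] scale2[of c 0 0] scale3[of c v 0 0] by simp_all

lemma minus: "\<omega> c (- v) w = - \<omega> c v w" "\<omega> c v (- w) = - \<omega> c v w"
  using add2[of c v "- v" w] add3[of c v w "- w"] zero(2,3) by (simp_all add: add_eq_0_iff)

lemma diff: "\<omega> c (v - v') w = \<omega> c v w - \<omega> c v' w" "\<omega> c v (w - w') = \<omega> c v w - \<omega> c v w'"
  using add2[of c v "- v'" w] add3[of c v w "- w'"] minus by simp_all

lemmas om_simps = add1 scale1 add2 scale2 add3 scale3 zero alt minus diff

lemma lincomb1: "\<omega> (lincomb a ks) v w = (\<Sum>i<length ks. a i * \<omega> (ks ! i) v w)"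
proof (induction ks arbitrary: a)
  case (Cons k ks)
  have "{..<length (k # ks)} = insert 0 (Suc ` {..<length ks})"
    by (auto simp: image_iff less_Suc_eq_0_disj)
  then show ?case using Cons by (simp add: om_simps sum.reindex)
qed (simp add: om_simps)

lemma lincomb3: "\<omega> c v (lincomb a ks) = (\<Sum>i<length ks. a i * \<omega> c v (ks ! i))"
proof (induction ks arbitrary: a)
  case (Cons k ks)
  have "{..<length (k # ks)} = insert 0 (Suc ` {..<length ks})"
    by (auto simp: image_iff less_Suc_eq_0_disj)
  then show ?case using Cons by (simp add: om_simps sum.reindex)
qed (simp add: om_simps)

lemma lincomb2: "\<omega> c (lincomb a ks) v = (\<Sum>i<length ks. a i * \<omega> c (ks ! i) v)"
  using lincomb3[of c v a ks] skew[of c v] by (simp add: sum_negf)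

lemma zero_on_basis:
  assumes "lin_indep ks" "length ks = 5" "\<And>k. k \<in> set ks \<Longrightarrow> \<omega> c v k = 0"
  shows "\<omega> c v x = 0"
proof -
  obtain a where "x = lincomb a ks" using lin_indep_basis[of ks x] assms(1,2) by auto
  then show ?thesis using assms(3) by (simp add: lincomb3)
qed

lemma zero_on_param_basis:
  assumes "lin_indep ks" "length ks = 3" "\<And>k. k \<in> set ks \<Longrightarrow> \<omega> k v w = 0"
  shows "\<omega> c v w = 0"
proof -
  obtain a where "c = lincomb a ks" using lin_indep_basis[of ks c] assms(1,2) by auto
  then show ?thesis using assms(3) by (simp add: lincomb1)
qed

text \<open>An alternating form on a 3-space has odd-dimensional kernel; the cross product vector of
  its three values lies in it, and any vector does if these values vanish.\<close>

lemma odd_kernel: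
  "\<exists>a. (\<exists>i<3. a i \<noteq> (0::complex)) \<and> (\<forall>k\<in>{k1, k2, k3}. \<omega> c (lincomb a [k1, k2, k3]) k = 0)"
proof (cases "\<omega> c k2 k3 = 0 \<and> \<omega> c k3 k1 = 0 \<and> \<omega> c k1 k2 = 0")
  case True
  then show ?thesis
    using skew[of c k1 k3] by (intro exI[of _ "(!) [1, 0, 0]"]) (auto simp: om_simps intro!: exI[of _ 0])
next
  case False
  define a where "a = (!) [\<omega> c k2 k3, \<omega> c k3 k1, \<omega> c k1 k2]"
  have "a 0 \<noteq> 0 \<or> a 1 \<noteq> 0 \<or> a 2 \<noteq> 0" using False by (simp add: a_def)
  then have "\<exists>i<3. a i \<noteq> 0" by (auto intro: exI[of _ 0] exI[of _ 1] exI[of _ 2])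
  moreover have "\<omega> c (lincomb a [k1, k2, k3]) k = 0" if "k \<in> {k1, k2, k3}" for k
    using that skew[of c k2 k1] skew[of c k3 k1] skew[of c k3 k2]
    by (auto simp: a_def om_simps algebra_simps)
  ultimately show ?thesis by blast
qed

text \<open>In a 3-space killed by \<open>c\<close>, choose \<open>v\<close> in the kernel of the
  restriction of \<open>d\<close>, and then \<open>w\<close> such that \<open>e\<close> vanishes on
  \<open>v\<close>, \<open>w\<close>. All forms of the net vanish on this pair, and transversality
  fails there for \<open>c\<close>.\<close>

lemma no_kernel3:
  assumes k: "lin_indep [k1, k2, k3]" and c: "\<And>k x. k \<in> {k1, k2, k3} \<Longrightarrow> \<omega> c k x = 0"
  shows "c = 0"
proof (rule ccontr)
  assume "c \<noteq> 0"
  then have "lin_indep [c]" by (simp add: lin_indep_singleton)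
  then obtain ys where ys: "lin_indep ([c] @ ys)" "length ([c] @ ys) = CARD(3)"
    by (rule lin_indep_extend)
  then obtain d e where "ys = [d, e]" by (auto simp: length_Suc_conv numeral_2_eq_2)
  then have cde: "lin_indep [c, d, e]" using ys by simp
  let ?ks = "[k1, k2, k3]"
  obtain a where a: "\<exists>i<3. a i \<noteq> 0" "\<And>k. k \<in> {k1, k2, k3} \<Longrightarrow> \<omega> d (lincomb a ?ks) k = 0"
    using odd_kernel[of k1 k2 k3 d] by blast
  then obtain i0 where i0: "i0 < length ?ks" "a i0 \<noteq> 0" by (auto simp: numeral_3_eq_3)
  define v where "v = lincomb a ?ks"
  obtain b where b: "lin_indep [v, lincomb b ?ks]" "(\<Sum>i<length ?ks. b i * \<omega> e v (?ks ! i)) = 0"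
  proof -
    have "3 \<le> length ?ks" by simp
    from lin_indep_partner[of ?ks i0 a "\<lambda>i. \<omega> e v (?ks ! i)", OF k this i0] that
    show ?thesis unfolding v_def[symmetric] by blast
  qed
  define w where "w = lincomb b ?ks"
  have ew: "\<omega> e v w = 0" unfolding w_def lincomb3 using b(2) .
  have dw: "\<omega> d v w = 0"
    unfolding w_def lincomb3
  proof (rule sum.neutral, rule ballI)
    fix i assume "i \<in> {..<length ?ks}"
    then have "?ks ! i \<in> set ?ks" by (intro nth_mem) simp
    then show "b i * \<omega> d v (?ks ! i) = 0" using a(2)[of "?ks ! i"] by (simp add: v_def)
  qed
  have "\<omega> c (lincomb a' ?ks) x = 0" for a' x
    using c by (simp add: om_simps)
  then have cv: "\<omega> c v x = 0" "\<omega> c w x = 0" for x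
    unfolding v_def w_def by blast+
  have "\<omega> c' v w = 0" for c'
  proof (rule zero_on_param_basis[OF cde])
    fix k assume "k \<in> set [c, d, e]"
    then show "\<omega> k v w = 0" using ew dw cv by auto
  qed simp
  then have "c = 0" using transversal[of v w c] b(1) cv by (simp add: w_def)
  then show False using \<open>c \<noteq> 0\<close> by simp
qed

text \<open>Alternating forms have even rank, so in dimension 5 two independent kernel vectors
  entail a third: a kernel vector of the restriction to a complement. Hence every nonzero form of
  the net has rank 4.\<close>

lemma no_kernel2:
  assumes vw: "lin_indep [v, w]" and c: "\<And>x. \<omega> c v x = 0" "\<And>x. \<omega> c w x = 0"
  shows "c = 0"
proof -
  obtain ys where ys: "lin_indep ([v, w] @ ys)" "length ([v, w] @ ys) = CARD(5)"
    using lin_indep_extend[OF vw] by blast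
  then obtain f1 f2 f3 where f: "ys = [f1, f2, f3]" by (auto simp: length_Suc_conv numeral_3_eq_3)
  obtain a where a: "\<exists>i<3. a i \<noteq> 0" "\<And>k. k \<in> {f1, f2, f3} \<Longrightarrow> \<omega> c (lincomb a ys) k = 0"
    unfolding f using odd_kernel[of f1 f2 f3 c] by blast
  define k where "k = lincomb a ys"
  have "k \<noteq> 0"
  proof -
    have "lin_indep ys" using lin_indep_mono[OF ys(1), of ys] ys(1) by (auto simp: lin_indep_iff)
    moreover have "length ys = 3" using f by simp
    ultimately show ?thesis using a(1) lin_indep_lincomb_ne_0[of ys _ a] by (auto simp: k_def)
  qed
  then have "lin_indep ([v, w] @ [k])"
    by (intro lin_indep_append_subst[OF ys(1)]) (auto simp: lin_indep_singleton k_def)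
  moreover have "\<omega> c k x = 0" for x
    by (rule zero_on_basis[OF ys(1)])
      (use ys(2) a(2) c skew[of c k v] skew[of c k w] in \<open>auto simp: k_def f\<close>)
  ultimately show ?thesis using no_kernel3[of v w k c] c by auto
qed

text \<open>On vectors of an isotropic 4-space the form only sees one further vector
  \<open>f\<close>. The vectors of the 4-space annihilated by that single functional are kernel
  vectors, and there are too many of them.\<close>

lemma no_isotropic4:
  assumes n: "lin_indep ns" "length ns = 4" and c: "\<And>x y. x \<in> set ns \<Longrightarrow> y \<in> set ns \<Longrightarrow> \<omega> c x y = 0"
  shows "c = 0"
proof -
  obtain ys where ys: "lin_indep (ns @ ys)" "length (ns @ ys) = CARD(5)"
    using lin_indep_extend[OF n(1)] by blast
  then obtain f where f: "ys = [f]" using n(2) by (auto simp: length_Suc_conv)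
  obtain a b where ab: "lin_indep [lincomb a ns, lincomb b ns]"
      "(\<Sum>i<length ns. a i * \<omega> c (ns ! i) f) = 0" "(\<Sum>i<length ns. b i * \<omega> c (ns ! i) f) = 0"
    using lin_indep_two_kernel[OF n(1), of "\<lambda>i. \<omega> c (ns ! i) f"] n(2) by auto
  have "\<omega> c (lincomb d ns) x = 0" if d: "(\<Sum>i<length ns. d i * \<omega> c (ns ! i) f) = 0" for d x
  proof (rule zero_on_basis[OF ys(1)])
    fix k assume "k \<in> set (ns @ ys)"
    then consider "k \<in> set ns" | "k = f" using f by auto
    then show "\<omega> c (lincomb d ns) k = 0"
    proof cases
      case 1
      then show ?thesis unfolding lincomb2 using c by (intro sum.neutral) auto
    next
      case 2
      then show ?thesis unfolding lincomb2 using d by simp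
    qed
  qed (use ys(2) in simp)
  then show ?thesis using no_kernel2[OF ab(1)] ab(2,3) by blast
qed

text \<open>Two forms killing \<open>u\<close> descend to a 4-dimensional quotient, where some
  member of their pencil is singular; this member has two independent kernel vectors in the
  5-space.\<close>

lemma no_common_kernel:
  assumes "u \<noteq> 0" and c: "\<And>x. \<omega> c u x = 0" and d: "\<And>x. \<omega> d u x = 0"
  shows "\<not> lin_indep [c, d]"
proof
  assume cd: "lin_indep [c, d]"
  have "lin_indep [u]" using assms(1) by (simp add: lin_indep_singleton)
  then obtain fs where fs: "lin_indep ([u] @ fs)" "length ([u] @ fs) = CARD(5)"
    using lin_indep_extend by blast
  have len: "length fs = 4" using fs(2) by simp
  have fs': "lin_indep fs" using lin_indep_mono[OF fs(1), of fs] fs(1) by (auto simp: lin_indep_iff)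
  obtain s t x where st: "s \<noteq> 0 \<or> t \<noteq> 0" "\<exists>i<4. x i \<noteq> 0"
    and 0: "\<And>i. i < 4 \<Longrightarrow> s * (\<Sum>j<4. \<omega> c (fs ! j) (fs ! i) * x j) + t * (\<Sum>j<4. \<omega> d (fs ! j) (fs ! i) * x j) = 0"
    using singular_pencil_nat[where 'n = 4, of 4 "\<lambda>i j. \<omega> c (fs ! j) (fs ! i)" "\<lambda>i j. \<omega> d (fs ! j) (fs ! i)"]
    by auto
  define k where "k = lincomb x fs"
  define h where "h = s *s c + t *s d"
  have "k \<noteq> 0" using st(2) lin_indep_lincomb_ne_0[OF fs'] by (auto simp: k_def len)
  then have uk: "lin_indep ([u] @ [k])"
    by (intro lin_indep_append_subst[OF fs(1)]) (auto simp: lin_indep_singleton k_def)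
  have hu: "\<omega> h u y = 0" for y by (simp add: h_def om_simps c d)
  have "\<omega> h k y = 0" for y
  proof (rule zero_on_basis[OF fs(1)])
    fix z assume "z \<in> set ([u] @ fs)"
    then consider "z = u" | i where "i < 4" "z = fs ! i" using len by (auto simp: in_set_conv_nth)
    then show "\<omega> h k z = 0"
    proof cases
      case 1
      then show ?thesis using skew[of h k u] hu by simp
    next
      case 2
      then show ?thesis
        using 0[OF 2(1)] by (simp add: h_def k_def add1 scale1 lincomb2 len distrib_left sum.distrib sum_distrib_left mult_ac)
    qed
  qed (use fs(2) in simp)
  then have "h = 0" using no_kernel2[of u k h] uk hu by simp
  then show False using cd st(1) by (auto simp: lin_indep_2 h_def)
qed

text \<open>No plane has all its lines in the section. Otherwise each complementary vector maps the
  net to the functionals on the 3-space, and \<open>f\<close>, \<open>g\<close> give a pencil of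
  square matrices. A singular member provides a form \<open>c\<close> and a vector \<open>m\<close>
  enlarging the 3-space to an isotropic 4-space for \<open>c\<close>.\<close>

lemma no_isotropic3:
  assumes n: "lin_indep [n1, n2, n3]"
  shows "\<not> (\<forall>c. \<omega> c n1 n2 = 0 \<and> \<omega> c n1 n3 = 0 \<and> \<omega> c n2 n3 = 0)"
proof
  assume iso: "\<forall>c. \<omega> c n1 n2 = 0 \<and> \<omega> c n1 n3 = 0 \<and> \<omega> c n2 n3 = 0"
  let ?ns = "[n1, n2, n3]"
  have ns: "\<omega> c x y = 0" if "x \<in> set ?ns" "y \<in> set ?ns" for c x y
    using that iso skew[of c n2 n1] skew[of c n3 n1] skew[of c n3 n2] by (auto simp: alt)
  obtain ys where ys: "lin_indep (?ns @ ys)" "length (?ns @ ys) = CARD(5)"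
    using lin_indep_extend[OF n] by blast
  then obtain f g where fg: "ys = [f, g]" by (auto simp: length_Suc_conv numeral_2_eq_2)
  obtain es :: "(complex ^ 3) list" where es: "lin_indep es" "length es = 3"
    using lin_indep_extend[of "[] :: (complex ^ 3) list"] by (auto simp: lin_indep_def)
  obtain s t x where st: "s \<noteq> 0 \<or> t \<noteq> 0" "\<exists>i<3. x i \<noteq> 0"
    and 0: "\<And>i. i < 3 \<Longrightarrow> s * (\<Sum>j<3. \<omega> (es ! j) f (?ns ! i) * x j) + t * (\<Sum>j<3. \<omega> (es ! j) g (?ns ! i) * x j) = 0"
    using singular_pencil_nat[where 'n = 3, of 3 "\<lambda>i j. \<omega> (es ! j) f (?ns ! i)" "\<lambda>i j. \<omega> (es ! j) g (?ns ! i)"]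
    by auto
  define c where "c = lincomb x es"
  define m where "m = s *s f + t *s g"
  have "c \<noteq> 0" using st(2) lin_indep_lincomb_ne_0[OF es(1)] by (auto simp: c_def es(2))
  have "lin_indep [f, g]" using lin_indep_mono[OF ys(1), of "[f, g]"] ys(1) by (auto simp: lin_indep_iff fg)
  then have "m \<noteq> 0" using st(1) by (auto simp: lin_indep_2 m_def)
  then have nm: "lin_indep (?ns @ [m])"
    by (intro lin_indep_append_subst[OF ys(1)])
      (auto simp: lin_indep_singleton m_def fg intro!: exI[of _ "(!) [s, t]"])
  have cm: "\<omega> c m y = 0" if y: "y \<in> set ?ns" for y
  proof -
    obtain i where "i < length ?ns" "?ns ! i = y" using y unfolding in_set_conv_nth by blast
    then have "i < 3" "y = ?ns ! i" by simp_all
    then show ?thesis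
      using 0[of i] by (simp add: m_def c_def add2 scale2 lincomb1 es(2) distrib_left sum.distrib sum_distrib_left mult_ac)
  qed
  have "c = 0"
  proof (rule no_isotropic4[OF nm])
    fix x y assume "x \<in> set (?ns @ [m])" "y \<in> set (?ns @ [m])"
    then show "\<omega> c x y = 0"
      using ns cm skew[of c x m] by (auto simp: alt)
  qed simp
  then show False using \<open>c \<noteq> 0\<close> by simp
qed

text \<open>If every point of the line is in the kernel of a nonzero form, let \<open>c\<close>,
  \<open>d\<close>, \<open>e\<close> kill \<open>v\<close>, \<open>w\<close>, \<open>v + w\<close>.
  Linear relations between such forms produce common zeros in a complement of the line, and these
  lead to an isotropic 3-space of the net or an isotropic 4-space of one form.\<close>

lemma exists_regular_vector:
  assumes vw: "lin_indep [v, w]" and iso: "\<And>c. \<omega> c v w = 0"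
  shows "\<exists>x y. (x \<noteq> 0 \<or> y \<noteq> 0) \<and> (\<forall>c. (\<forall>z. \<omega> c (x *s v + y *s w) z = 0) \<longrightarrow> c = 0)"
proof (rule ccontr)
  assume "\<not> ?thesis"
  then have neg: "\<exists>c. c \<noteq> 0 \<and> (\<forall>z. \<omega> c (x *s v + y *s w) z = 0)" if "x \<noteq> 0 \<or> y \<noteq> 0" for x y
    using that by blast
  obtain c where c: "c \<noteq> 0" "\<And>z. \<omega> c v z = 0" using neg[of 1 0] by auto
  obtain d where d: "d \<noteq> 0" "\<And>z. \<omega> d w z = 0" using neg[of 0 1] by auto
  obtain e where e: "e \<noteq> 0" "\<And>z. \<omega> e (v + w) z = 0" using neg[of 1 1] by auto
  have cd: "lin_indep [c, d]"
    unfolding lin_indep_2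
  proof (intro allI impI)
    fix s t assume st: "s *s c + t *s d = 0"
    have "s = 0"
    proof (rule ccontr)
      assume "s \<noteq> 0"
      have "\<omega> (s *s c + t *s d) w z = 0" for z unfolding st by (simp add: om_simps)
      then have "\<omega> c w z = 0" for z using d(2) \<open>s \<noteq> 0\<close> by (simp add: om_simps)
      then have "c = 0" using no_kernel2[OF vw c(2)] by blast
      then show False using c(1) by simp
    qed
    then show "s = 0 \<and> t = 0" using st d(1) by (simp add: vector_mul_eq_0)
  qed
  obtain fs where fs: "lin_indep ([v, w] @ fs)" "length ([v, w] @ fs) = CARD(5)"
    using lin_indep_extend[OF vw] by blast
  have len: "length fs = 3" using fs(2) by simp
  have fs': "lin_indep fs" using lin_indep_mono[OF fs(1), of fs] fs(1) by (auto simp: lin_indep_iff)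
  have iso': "\<omega> c w v = 0" for c using iso skew[of c w v] by simp
  show False
  proof (cases "lin_indep [c, d, e]")
    case True
    obtain h where h: "h \<noteq> 0" "\<And>z. \<omega> h (1 *s v + 2 *s w) z = 0" using neg[of 1 2] by auto
    obtain r where r: "h = lincomb r [c, d, e]" using lin_indep_basis[OF True, of h] by auto
    \<comment> \<open>These functionals arise from expanding \<open>h\<close> at
      \<open>v + 2 w\<close> in terms of \<open>c\<close>, \<open>d\<close>, \<open>e\<close>:
      \<open>c\<close> kills \<open>v\<close>, \<open>d\<close> kills \<open>w\<close>, and
      \<open>e\<close> at \<open>w\<close> is minus \<open>e\<close> at \<open>v\<close>. This
      explains the factor \<open>2\<close> and the sign.\<close>
    define g where "g k i = (if k = 0 then 2 * \<omega> c w (fs ! i) else if k = 1 then \<omega> d v (fs ! i) else - \<omega> e v (fs ! i))"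
      for k i :: nat
    have ew: "\<omega> e w z = - \<omega> e v z" for z using e(2)[of z] by (simp add: om_simps add_eq_0_iff)
    have rel: "(\<Sum>k<3. r k * g k i) = 0" for i
      using h(2)[of "fs ! i"] c(2) d(2)
      by (simp add: r om_simps ew g_def numeral_3_eq_3 numeral_2_eq_2 algebra_simps)
    have "\<exists>k0<3. r k0 \<noteq> 0"
    proof (rule ccontr)
      assume "\<not> ?thesis"
      then have "r 0 = 0" "r 1 = 0" "r 2 = 0" by auto
      then show False using h(1) by (simp add: r numeral_2_eq_2)
    qed
    then obtain k0 where "k0 < 3" "r k0 \<noteq> 0" by blast
    then obtain x where x: "\<exists>i<3. x i \<noteq> 0" "\<And>k. k < 3 \<Longrightarrow> (\<Sum>i<3. x i * g k i) = 0"
      using dependent_functionals[of k0 3 r g] rel by blast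
    define a where "a = lincomb x fs"
    have "a \<noteq> 0" using x(1) lin_indep_lincomb_ne_0[OF fs'] by (auto simp: a_def len)
    then have "lin_indep ([v, w] @ [a])"
      by (intro lin_indep_append_subst[OF fs(1)]) (auto simp: lin_indep_singleton a_def)
    moreover have ca: "\<omega> c w a = 0" and da: "\<omega> d v a = 0" and ea: "\<omega> e v a = 0"
    proof -
      have "2 * \<omega> c w a = (\<Sum>i<3. x i * g 0 i)" "\<omega> d v a = (\<Sum>i<3. x i * g 1 i)"
        "- \<omega> e v a = (\<Sum>i<3. x i * g 2 i)"
        by (simp_all add: a_def lincomb3 len g_def sum_distrib_left sum_negf mult_ac)
      then show "\<omega> c w a = 0" "\<omega> d v a = 0" "\<omega> e v a = 0" using x(2) by simp_all
    qed
    have "\<omega> c' v a = 0 \<and> \<omega> c' w a = 0" for c'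
    proof
      show "\<omega> c' v a = 0"
        by (rule zero_on_param_basis[OF True]) (use c(2) da ea in auto)
      have ewa: "\<omega> e w a = 0" using ew[of a] ea by simp
      show "\<omega> c' w a = 0"
        by (rule zero_on_param_basis[OF True]) (use d(2) ca ewa in auto)
    qed
    ultimately show False using no_isotropic3[of v w a] iso by auto
  next
    case False
    \<comment> \<open>When \<open>e\<close> depends on \<open>c\<close> and \<open>d\<close>, the
      functionals of \<open>c\<close> at \<open>w\<close> and of \<open>d\<close> at
      \<open>v\<close> satisfy a linear relation, so a 2-space in the complement is killed by both.
      One member \<open>h\<close> of the pencil of \<open>c\<close> and \<open>d\<close> also
      vanishes on this 2-space, which makes a 4-space isotropic.\<close>
    then obtain p q r where pqr: "p *s c + q *s d + r *s e = 0" "p \<noteq> 0 \<or> q \<noteq> 0 \<or> r \<noteq> 0"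
      by (auto simp: lin_indep_3)
    have "r \<noteq> 0" using pqr cd by (auto simp: lin_indep_2)
    have "p \<noteq> 0 \<or> q \<noteq> 0" using pqr e(1) \<open>r \<noteq> 0\<close> by (auto simp: vector_mul_eq_0)
    have rel: "p * \<omega> c w z + q * \<omega> d v z = 0" for z
    proof -
      have "\<omega> (p *s c + q *s d + r *s e) (v + w) z = 0" unfolding pqr(1) by (simp add: om_simps)
      moreover have "\<omega> e w z = - \<omega> e v z" using e(2)[of z] by (simp add: om_simps add_eq_0_iff)
      ultimately show ?thesis using c(2) d(2) by (simp add: om_simps add.commute)
    qed
    have "\<exists>a b. lin_indep [lincomb a fs, lincomb b fs] \<and>
        \<omega> c w (lincomb a fs) = 0 \<and> \<omega> d v (lincomb a fs) = 0 \<and>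
        \<omega> c w (lincomb b fs) = 0 \<and> \<omega> d v (lincomb b fs) = 0"
    proof (cases "p = 0")
      case True
      then have q: "\<omega> d v z = 0" for z using rel[of z] \<open>p \<noteq> 0 \<or> q \<noteq> 0\<close> by simp
      obtain a b where "lin_indep [lincomb a fs, lincomb b fs]"
          "\<omega> c w (lincomb a fs) = 0" "\<omega> c w (lincomb b fs) = 0"
        using lin_indep_two_kernel[OF fs', of "\<lambda>i. \<omega> c w (fs ! i)"] len by (auto simp: lincomb3)
      then show ?thesis using q by blast
    next
      case False
      then have q: "\<omega> d v z = 0 \<Longrightarrow> \<omega> c w z = 0" for z using rel[of z] by simp
      obtain a b where "lin_indep [lincomb a fs, lincomb b fs]"
          "\<omega> d v (lincomb a fs) = 0" "\<omega> d v (lincomb b fs) = 0"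
        using lin_indep_two_kernel[OF fs', of "\<lambda>i. \<omega> d v (fs ! i)"] len by (auto simp: lincomb3)
      then show ?thesis using q by blast
    qed
    then obtain a b where ab: "lin_indep [lincomb a fs, lincomb b fs]" and
      z: "\<omega> c w (lincomb a fs) = 0" "\<omega> d v (lincomb a fs) = 0"
        "\<omega> c w (lincomb b fs) = 0" "\<omega> d v (lincomb b fs) = 0" by blast
    define A where "A = lincomb a fs"
    define B where "B = lincomb b fs"
    note z = z[folded A_def B_def]
    have ns: "lin_indep ([v, w] @ [A, B])"
      by (rule lin_indep_append_subst[OF fs(1)]) (use ab in \<open>auto simp: A_def B_def\<close>)
    obtain s t where st: "s \<noteq> 0 \<or> t \<noteq> 0" "s * \<omega> c A B + t * \<omega> d A B = 0"
    proof (cases "\<omega> c A B = 0")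
      case True
      then show ?thesis using that[of 1 0] by simp
    next
      case False
      then show ?thesis using that[of "\<omega> d A B" "- \<omega> c A B"] by simp
    qed
    define h where "h = s *s c + t *s d"
    have p: "\<omega> h v w = 0" "\<omega> h v A = 0" "\<omega> h v B = 0" "\<omega> h w A = 0" "\<omega> h w B = 0" "\<omega> h A B = 0"
      using c(2) d(2) iso z st(2) by (simp_all add: h_def add1 scale1)
    have p': "\<omega> h y x = 0" if "\<omega> h x y = 0" for x y using that skew[of h y x] by simp
    note p' = p(1)[THEN p'] p(2)[THEN p'] p(3)[THEN p'] p(4)[THEN p'] p(5)[THEN p'] p(6)[THEN p']
    have "h = 0"
    proof (rule no_isotropic4[OF ns])
      fix x y assume "x \<in> set ([v, w] @ [A, B])" "y \<in> set ([v, w] @ [A, B])"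
      then show "\<omega> h x y = 0" by (auto simp: alt p p')
    qed simp
    then have "s *s c + t *s d = 0" by (simp add: h_def)
    then show False using cd st(1) by (auto simp: lin_indep_2)
  qed
qed

end

subsection \<open>Integral points outside a quadric and two planes\<close>

definition pairing :: "complex ^ 'n::finite \<Rightarrow> complex ^ 'n \<Rightarrow> complex" where
  "pairing h x = (\<Sum>i\<in>UNIV. h $ i * x $ i)"

lemma pairing_simps:
  "pairing h (x + y) = pairing h x + pairing h y" "pairing h (c *s x) = c * pairing h x"
  "pairing h 0 = 0" "pairing h (- x) = - pairing h x" "pairing h (x - y) = pairing h x - pairing h y"
  by (simp_all add: pairing_def sum.distrib sum_distrib_left sum_negf sum_subtractf algebra_simps)

text \<open>The determinant of \<open>y\<close> read as a 2 by 2 matrix. In the basis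
  \<open>a\<close>, \<open>b\<close>, \<open>c\<close>, \<open>d\<close> chosen later, the matrices
  of rank one are the points of the lines joining \<open>s a + t c\<close> and
  \<open>s b + t d\<close>.\<close>

definition quadric :: "complex ^ 4 \<Rightarrow> complex" where
  "quadric y = y $ 1 * y $ 4 - y $ 2 * y $ 3"

definition quadric_polar :: "complex ^ 4 \<Rightarrow> complex ^ 4 \<Rightarrow> complex" where
  "quadric_polar y z = y $ 1 * z $ 4 + z $ 1 * y $ 4 - y $ 2 * z $ 3 - z $ 2 * y $ 3"

lemma quadric_add: "quadric (y + t *s z) = quadric y + t * quadric_polar y z + t ^ 2 * quadric z"
  by (simp add: quadric_def quadric_polar_def algebra_simps power2_eq_square)

lemma quadric_scale: "quadric (c *s y) = c ^ 2 * quadric y"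
  by (simp add: quadric_def algebra_simps power2_eq_square)

lemma quadric_polar_simps:
  "quadric_polar (x + y) z = quadric_polar x z + quadric_polar y z"
  "quadric_polar (c *s y) z = c * quadric_polar y z"
  "quadric_polar (x - y) z = quadric_polar x z - quadric_polar y z"
  "quadric_polar x (y + z) = quadric_polar x y + quadric_polar x z"
  "quadric_polar y (c *s z) = c * quadric_polar y z"
  "quadric_polar x (y - z) = quadric_polar x y - quadric_polar x z"
  "quadric_polar y y = 2 * quadric y" "quadric_polar 0 z = 0"
  by (simp_all add: quadric_def quadric_polar_def algebra_simps)

lemma quadric_polar_commute: "quadric_polar y z = quadric_polar z y"
  by (simp add: quadric_polar_def)

lemma quadric_polar_nondegenerate:
  assumes "\<And>z. quadric_polar y z = 0"
  shows "y = 0"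
  using assms[of "axis 1 1"] assms[of "axis 2 1"] assms[of "axis 3 1"] assms[of "axis 4 1"]
  by (simp add: quadric_polar_def axis_def vec_eq_iff forall_4)

definition algebraic_vec :: "complex ^ 'n \<Rightarrow> bool" where
  "algebraic_vec v \<longleftrightarrow> (\<forall>i. algebraic (v $ i))"

lemma algebraic_vec_intros:
  "algebraic_vec v \<Longrightarrow> algebraic_vec w \<Longrightarrow> algebraic_vec (v + w)"
  "algebraic_vec v \<Longrightarrow> algebraic_vec w \<Longrightarrow> algebraic_vec (v - w)"
  "algebraic_vec v \<Longrightarrow> algebraic c \<Longrightarrow> algebraic_vec (c *s v)"
  "algebraic_vec (axis i 1)"
  by (auto simp: algebraic_vec_def axis_def intro!: algebraic_intros)

lemma algebraic_pairing: "algebraic_vec h \<Longrightarrow> algebraic_vec x \<Longrightarrow> algebraic (pairing h x)"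
  by (auto simp: algebraic_vec_def pairing_def intro!: algebraic_intros)

lemma algebraic_quadric: "algebraic_vec y \<Longrightarrow> algebraic (quadric y)"
  by (auto simp: algebraic_vec_def quadric_def intro!: algebraic_intros)

lemma algebraic_quadric_polar: "algebraic_vec y \<Longrightarrow> algebraic_vec z \<Longrightarrow> algebraic (quadric_polar y z)"
  by (auto simp: algebraic_vec_def quadric_polar_def intro!: algebraic_intros)

lemma pairing_axis: "pairing h (axis i 1) = h $ i"
  by (simp add: pairing_def axis_def if_distrib cong: if_cong)

text \<open>The vectors \<open>g\<close>, \<open>h\<close> are dual to \<open>m1\<close>,
  \<open>m2\<close>, while \<open>e\<close>, \<open>n\<close> span the intersection of the two
  planes; \<open>n\<close> is a point of that intersection on the quadric, found with at most one
  square root.\<close>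

lemma adapted_frame:
  fixes m1 m2 :: "complex ^ 4"
  assumes m: "algebraic_vec m1" "algebraic_vec m2" "lin_indep [m1, m2]"
  obtains g h e n where "algebraic_vec g" "algebraic_vec h" "algebraic_vec e" "algebraic_vec n"
    "lin_indep [g, h, e, n]"
    "pairing m1 g = 1" "pairing m2 g = 0" "pairing m1 h = 0" "pairing m2 h = 1"
    "pairing m1 e = 0" "pairing m2 e = 0" "pairing m1 n = 0" "pairing m2 n = 0" "quadric n = 0"
proof -
  obtain i j where D: "m1 $ i * m2 $ j - m1 $ j * m2 $ i \<noteq> 0"
  proof (rule ccontr)
    assume "\<not> thesis"
    then have 0: "m1 $ i * m2 $ j = m1 $ j * m2 $ i" for i j using that by fastforce
    have "m1 \<noteq> 0" using m(3) by (auto simp: lin_indep_2 dest: spec[of _ 1] spec[of _ 0])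
    then obtain i where i: "m1 $ i \<noteq> 0" by (auto simp: vec_eq_iff)
    have "m2 $ i *s m1 + (- m1 $ i) *s m2 = 0" using 0[of i] by (simp add: vec_eq_iff mult.commute)
    then show False using m(3) i unfolding lin_indep_2 by fastforce
  qed
  define D where "D = m1 $ i * m2 $ j - m1 $ j * m2 $ i"
  have D0: "D \<noteq> 0" "algebraic D" using D m by (auto simp: D_def algebraic_vec_def intro!: algebraic_intros)
  \<comment> \<open>Cramer's rule for the nonzero minor \<open>D\<close> in the columns
    \<open>i\<close>, \<open>j\<close>.\<close>
  define g where "g = (m2 $ j / D) *s axis i 1 - (m2 $ i / D) *s axis j 1"
  define h where "h = (m1 $ i / D) *s axis j 1 - (m1 $ j / D) *s axis i 1"
  have gh: "algebraic_vec g" "algebraic_vec h"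
    unfolding g_def h_def using m D0 by (auto simp: algebraic_vec_def axis_def intro!: algebraic_intros)
  have m': "m1 $ i * m2 $ j = D + m1 $ j * m2 $ i" by (simp add: D_def)
  have mg: "pairing m1 g = 1" "pairing m2 g = 0" "pairing m1 h = 0" "pairing m2 h = 1"
    using D0 m' by (simp_all add: g_def h_def pairing_simps pairing_axis field_simps)
  have "i \<noteq> j" using D by auto
  have "card (UNIV - {i, j}) = 2" using \<open>i \<noteq> j\<close> by (simp add: card_Diff_subset)
  then obtain k l where kl: "UNIV - {i, j} = {k, l}" "k \<noteq> l" by (auto simp: card_2_iff)
  then have kl': "k \<noteq> i" "k \<noteq> j" "l \<noteq> i" "l \<noteq> j" by auto
  \<comment> \<open>Projects the two remaining coordinate vectors to the common kernel of
    \<open>m1\<close> and \<open>m2\<close>.\<close>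
  define e' where "e' k = axis k 1 - (m1 $ k) *s g - (m2 $ k) *s h" for k
  have e': "algebraic_vec (e' k)" "pairing m1 (e' k) = 0" "pairing m2 (e' k) = 0" for k
    unfolding e'_def using m gh mg
    by (auto simp: pairing_simps pairing_axis algebraic_vec_def[of m1] algebraic_vec_def[of m2]
        intro!: algebraic_vec_intros)
  have comp: "e' k $ k = 1" "e' k $ l = 0" "e' l $ l = 1" "e' l $ k = 0"
    using kl(2) kl' by (auto simp: e'_def g_def h_def axis_def)
  have ind: "lin_indep [e' k, e' l]"
    unfolding lin_indep_2
  proof (intro allI impI)
    fix a b assume "a *s e' k + b *s e' l = 0"
    then have "(a *s e' k + b *s e' l) $ k = 0" "(a *s e' k + b *s e' l) $ l = 0" by simp_all
    then show "a = 0 \<and> b = 0" using comp by simp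
  qed
  have "\<exists>e n. algebraic_vec e \<and> algebraic_vec n \<and> lin_indep [e, n] \<and> quadric n = 0 \<and>
     pairing m1 e = 0 \<and> pairing m2 e = 0 \<and> pairing m1 n = 0 \<and> pairing m2 n = 0"
  proof (cases "quadric (e' k) = 0")
    case True
    have "lin_indep [e' l, e' k]"
      by (rule lin_indep_mono[OF ind]) (use ind in \<open>auto simp: lin_indep_iff\<close>)
    then show ?thesis using e' True by blast
  next
    case False
    define b where "b = quadric_polar (e' k) (e' l)"
    \<comment> \<open>A root of the quadratic polynomial \<open>quadric (e' l + r *s e' k)\<close>
      in \<open>r\<close>.\<close>
    define r where "r = (- b + csqrt (b ^ 2 - 4 * quadric (e' k) * quadric (e' l))) / (2 * quadric (e' k))"
    have "r * (2 * quadric (e' k)) + b = csqrt (b ^ 2 - 4 * quadric (e' k) * quadric (e' l))"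
      using False by (simp add: r_def)
    then have "(r * (2 * quadric (e' k)) + b) ^ 2 = b ^ 2 - 4 * quadric (e' k) * quadric (e' l)" by simp
    then have "4 * quadric (e' k) * (r ^ 2 * quadric (e' k) + r * b + quadric (e' l)) = 0"
      by (simp add: power2_eq_square algebra_simps)
    then have "r ^ 2 * quadric (e' k) + r * b + quadric (e' l) = 0" using False by simp
    then have "quadric (e' l + r *s e' k) = 0"
      by (simp add: quadric_add b_def quadric_polar_commute[of "e' l"] add.commute add.left_commute)
    moreover have "lin_indep [e' k, e' l + r *s e' k]"
      unfolding lin_indep_2
    proof (intro allI impI)
      fix a c assume "a *s e' k + c *s (e' l + r *s e' k) = 0"
      then have "(a + c * r) *s e' k + c *s e' l = 0" by (simp add: algebra_simps vec_eq_iff)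
      then show "a = 0 \<and> c = 0" using ind unfolding lin_indep_2 by fastforce
    qed
    moreover have "algebraic r"
      unfolding r_def b_def using e'(1)
      by (auto intro!: algebraic_intros algebraic_quadric algebraic_quadric_polar simp: power2_eq_square)
    ultimately show ?thesis
      using e' by (intro exI[of _ "e' k"] exI[of _ "e' l + r *s e' k"])
        (auto simp: pairing_simps intro!: algebraic_vec_intros)
  qed
  then obtain e n where en: "algebraic_vec e" "algebraic_vec n" "lin_indep [e, n]" "quadric n = 0"
     "pairing m1 e = 0" "pairing m2 e = 0" "pairing m1 n = 0" "pairing m2 n = 0" by blast
  have "lin_indep [g, h, e, n]"
    unfolding lin_indep_def
  proof (intro allI impI)
    fix c i assume c: "lincomb c [g, h, e, n] = 0" and i: "i < length [g, h, e, n]"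
    have "pairing m1 (lincomb c [g, h, e, n]) = 0" "pairing m2 (lincomb c [g, h, e, n]) = 0"
      unfolding c by (simp_all add: pairing_simps)
    then have 01: "c 0 = 0" "c 1 = 0" using mg en by (simp_all add: pairing_simps)
    then have "c 2 *s e + c 3 *s n = 0" using c by (simp add: numeral_2_eq_2 numeral_3_eq_3)
    then have "c 2 = 0 \<and> c 3 = 0" using en(3) unfolding lin_indep_2 by blast
    then show "c i = 0" using 01 i by (auto simp: less_Suc_eq numeral_2_eq_2 numeral_3_eq_3)
  qed
  then show ?thesis using that gh mg en by blast
qed

lemma infinite_rangeI:
  assumes "inj f" "\<And>k::nat. P (f k)"
  shows "infinite {x. P x}"
proof -
  have "range f \<subseteq> {x. P x}" using assms(2) by auto
  moreover have "infinite (range f)" using assms(1) by (rule range_inj_infinite)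
  ultimately show ?thesis using infinite_super by blast
qed

text \<open>Coordinates are normalized by the first linear form. Quantifying over all rings that
  contain \<open>A\<close> makes the notion independent of any number field: a place matters only
  through the integrality of the finitely many elements of \<open>A\<close>.\<close>

definition unit_values :: "complex set \<Rightarrow> complex ^ 4 \<Rightarrow> complex ^ 4 \<Rightarrow> (complex ^ 4) set" where
  "unit_values A m1 m2 = {y. pairing m1 y = 1 \<and> pairing m2 y \<noteq> 0 \<and> quadric y \<noteq> 0 \<and>
     (\<forall>R. ring_set R \<and> A \<subseteq> R \<longrightarrow> (\<forall>i. y $ i \<in> R) \<and> inverse (pairing m2 y) \<in> R \<and> inverse (quadric y) \<in> R)}"

lemma inj_power2: "inj (\<lambda>k::nat. (2::complex) ^ k)"
proof (rule injI)
  fix x y :: nat assume "(2::complex) ^ x = 2 ^ y"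
  then have "norm ((2::complex) ^ x) = norm ((2::complex) ^ y)" by simp
  then have "(2::real) ^ x = 2 ^ y" by (simp add: norm_power)
  then show "x = y" by (simp add: power_inject_exp)
qed

text \<open>The infinite sets are nested because polynomials will be tested on them one variable at
  a time. For fixed \<open>u\<close>, \<open>w\<close> the quadric is affine in \<open>s\<close>
  with slope \<open>N = a + u * b + w * c\<close>; the cases are the ways to make division by
  \<open>N\<close> possible in \<open>R\<close>.\<close>

lemma unit_values_infinite:
  fixes m1 m2 :: "complex ^ 4"
  assumes m: "algebraic_vec m1" "algebraic_vec m2" "lin_indep [m1, m2]"
  obtains A g h e n where "finite A" "\<And>a. a \<in> A \<Longrightarrow> algebraic a" "lin_indep [g, h, e, n]"
    "infinite {u. infinite {w. infinite {s. g + u *s h + w *s e + s *s n \<in> unit_values A m1 m2}}}"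
proof -
  obtain g h e n where alg: "algebraic_vec g" "algebraic_vec h" "algebraic_vec e" "algebraic_vec n"
    and ind: "lin_indep [g, h, e, n]" and
    mu: "pairing m1 g = 1" "pairing m2 g = 0" "pairing m1 h = 0" "pairing m2 h = 1"
    "pairing m1 e = 0" "pairing m2 e = 0" "pairing m1 n = 0" "pairing m2 n = 0" and qn: "quadric n = 0"
    using adapted_frame[OF m] by blast
  define a where "a = quadric_polar g n"
  define b where "b = quadric_polar h n"
  define c where "c = quadric_polar e n"
  define \<kappa> where "\<kappa> w = quadric (g + (- a / b) *s h + w *s e)" for w
  \<comment> \<open>Inverses of vanishing constants are \<open>0\<close>, so one \<open>A\<close>
    serves all cases. The entry \<open>1/2\<close> makes powers of \<open>2\<close> units, and three
    values of \<open>\<kappa>\<close> suffice because it has degree at most 2.\<close>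
  define A where "A = range (($) g) \<union> range (($) h) \<union> range (($) e) \<union> range (($) n) \<union>
    {1/2, a, b, inverse a, inverse b, inverse c, \<kappa> 0, \<kappa> 1, \<kappa> (-1), inverse (\<kappa> 0), inverse (\<kappa> 1), inverse (\<kappa> (-1))}"
  have algs: "algebraic a" "algebraic b" "algebraic c"
    unfolding a_def b_def c_def using alg by (auto intro: algebraic_quadric_polar)
  have "algebraic (\<kappa> w)" if "algebraic w" for w
    unfolding \<kappa>_def using alg algs that by (intro algebraic_quadric algebraic_vec_intros algebraic_intros)
  then have algA: "algebraic x" if "x \<in> A" for x
    using that alg algs
    by (auto simp: A_def algebraic_vec_def simp del: eq_divide_eq_numeral1 intro!: algebraic_intros)
  have finA: "finite A" unfolding A_def by simp
  have inR: "(\<forall>i. g $ i \<in> R) \<and> (\<forall>i. h $ i \<in> R) \<and> (\<forall>i. e $ i \<in> R) \<and> (\<forall>i. n $ i \<in> R) \<and>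
     1/2 \<in> R \<and> a \<in> R \<and> b \<in> R \<and> inverse a \<in> R \<and> inverse b \<in> R \<and> inverse c \<in> R \<and>
     (\<forall>w\<in>{0, 1, -1}. \<kappa> w \<in> R \<and> inverse (\<kappa> w) \<in> R)" if "A \<subseteq> R" for R
    using that unfolding A_def by auto
  have nu: "quadric_polar (g + u *s h + w *s e) n = a + u * b + w * c" for u w
    by (simp add: quadric_polar_simps a_def b_def c_def)
  have qs: "quadric (g + u *s h + w *s e + s *s n) = quadric (g + u *s h + w *s e) + s * (a + u * b + w * c)" for u w s
    by (simp add: quadric_add qn nu)
  have mus: "pairing m1 (g + u *s h + w *s e + s *s n) = 1" "pairing m2 (g + u *s h + w *s e + s *s n) = u" for u w s
    by (simp_all add: pairing_simps mu)
  have pow2: "inverse (2 ^ k) \<in> R" if "ring_set R" "A \<subseteq> R" for k :: nat and R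
    using ring_setD(9)[OF that(1), of "1/2" k] inR[OF that(2)] by (simp add: power_divide inverse_eq_divide)
  have quadR: "quadric y \<in> R" if "ring_set R" "\<forall>i. y $ i \<in> R" for y R
    unfolding quadric_def using that by (intro ring_setD[OF that(1)]) auto
  have polR: "quadric_polar y z \<in> R" if "ring_set R" "\<forall>i. y $ i \<in> R" "\<forall>i. z $ i \<in> R" for y z R
    unfolding quadric_polar_def using that by (intro ring_setD[OF that(1)]) auto
  have yR: "(g + u *s h + w *s e + s *s n) $ i \<in> R" if "ring_set R" "A \<subseteq> R" "u \<in> R" "w \<in> R" "s \<in> R" for R u w s i
    using inR[OF that(2)] that(3-5) by (auto intro!: ring_setD[OF that(1)])
  have y0R: "(g + u *s h + w *s e) $ i \<in> R" if "ring_set R" "A \<subseteq> R" "u \<in> R" "w \<in> R" for R u w i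
    using inR[OF that(2)] that(3-4) by (auto intro!: ring_setD[OF that(1)])
  \<comment> \<open>As \<open>s\<close> varies, the quadric takes any prescribed value as soon as the polar of \<open>n\<close> is a unit.\<close>
  have mem: "g + u *s h + w *s e + ((v - quadric (g + u *s h + w *s e)) / N) *s n \<in> unit_values A m1 m2"
    if N: "N = a + u * b + w * c" "N \<noteq> 0" and uv: "u \<noteq> 0" "v \<noteq> 0"
      and R: "\<And>R. ring_set R \<Longrightarrow> A \<subseteq> R \<Longrightarrow> u \<in> R \<and> w \<in> R \<and> (v - quadric (g + u *s h + w *s e)) / N \<in> R \<and>
          inverse u \<in> R \<and> inverse v \<in> R" for u v w N
  proof -
    have "quadric (g + u *s h + w *s e + ((v - quadric (g + u *s h + w *s e)) / N) *s n) = v"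
      unfolding qs N(1)[symmetric] using N(2) by simp
    then show ?thesis
      unfolding unit_values_def mem_Collect_eq mus
      using uv R yR[of _ u w "(v - quadric (g + u *s h + w *s e)) / N"] by (simp only:) blast
  qed
  have inj: "inj (\<lambda>k::nat. (\<alpha> * (2 ^ Suc d) ^ k - x) / y)" if "y \<noteq> 0" "\<alpha> \<noteq> 0" for d and x y \<alpha> :: complex
  proof (rule injI)
    fix i j assume "(\<alpha> * (2 ^ Suc d) ^ i - x) / y = (\<alpha> * (2 ^ Suc d) ^ j - x) / y"
    then have "((2::complex) ^ Suc d) ^ i = (2 ^ Suc d) ^ j" using that by simp
    then have "(2::complex) ^ (Suc d * i) = 2 ^ (Suc d * j)" by (simp only: power_mult)
    then have "Suc d * i = Suc d * j" by (rule injD[OF inj_power2])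
    then show "i = j" by (simp del: mult_Suc)
  qed
  have "infinite {u. infinite {w. infinite {s. g + u *s h + w *s e + s *s n \<in> unit_values A m1 m2}}}"
  proof (cases "c = 0")
    \<comment> \<open>Since \<open>c\<close> is invertible in \<open>R\<close>, the equation
      \<open>N = 2 ^ j\<close> can be solved for \<open>w\<close>.\<close>
    case False
    show ?thesis
    proof (rule infinite_rangeI[OF inj_power2])
      fix k
      let ?u = "2 ^ k :: complex"
      show "infinite {w. infinite {s. g + ?u *s h + w *s e + s *s n \<in> unit_values A m1 m2}}"
      proof (rule infinite_rangeI)
        show "inj (\<lambda>j::nat. (1 * (2 ^ Suc 0) ^ j - (a + ?u * b)) / c)" by (rule inj) (use False in auto)
        fix j
        let ?w = "(1 * (2 ^ Suc 0) ^ j - (a + ?u * b)) / c"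
        let ?q = "quadric (g + ?u *s h + ?w *s e)"
        show "infinite {s. g + ?u *s h + ?w *s e + s *s n \<in> unit_values A m1 m2}"
        proof (rule infinite_rangeI)
          show "inj (\<lambda>l::nat. (1 * (2 ^ Suc 0) ^ l - ?q) / 2 ^ j)" by (rule inj) auto
          fix l :: nat
          show "g + ?u *s h + ?w *s e + ((1 * (2 ^ Suc 0) ^ l - ?q) / 2 ^ j) *s n \<in> unit_values A m1 m2"
          proof (rule mem)
            show "2 ^ j = a + ?u * b + ?w * c" using False by simp
            fix R assume R: "ring_set R" "A \<subseteq> R"
            note r = ring_setD[OF R(1)]
            have w: "?w \<in> R" unfolding divide_inverse using inR[OF R(2)] by (intro r) auto
            have u: "?u \<in> R" by (intro r)
            have q: "?q \<in> R" by (rule quadR[OF R(1)]) (use y0R[OF R u w] in auto)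
            have "(1 * (2 ^ Suc 0) ^ l - ?q) / 2 ^ j \<in> R"
              by (subst divide_inverse) (intro r q pow2[OF R])
            then show "?u \<in> R \<and> ?w \<in> R \<and> (1 * (2 ^ Suc 0) ^ l - ?q) / 2 ^ j \<in> R \<and> inverse ?u \<in> R \<and>
                inverse (1 * (2 ^ Suc 0) ^ l) \<in> R"
              using u w pow2[OF R] by simp
          qed auto
        qed
      qed
    qed
  next
    case c0: True
    \<comment> \<open>Otherwise \<open>n\<close> would be polar to the whole frame, against
      nondegeneracy of the quadric.\<close>
    have ab: "a \<noteq> 0 \<or> b \<noteq> 0"
    proof (rule ccontr)
      assume "\<not> ?thesis"
      then have 0: "a = 0" "b = 0" by auto
      have "n = 0"
      proof (rule quadric_polar_nondegenerate)
        fix z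
        obtain d where "z = lincomb d [g, h, e, n]" using lin_indep_basis[OF ind, of z] by auto
        then have "quadric_polar z n = 0"
          using 0 c0 by (simp add: quadric_polar_simps a_def b_def c_def qn)
        then show "quadric_polar n z = 0" by (simp add: quadric_polar_commute)
      qed
      then show False
        using lin_indepD[OF ind, of "(!) [0, 0, 0, 1]" 3] by simp
    qed
    show ?thesis
    proof (cases "a = 0 \<or> b = 0")
      \<comment> \<open>The slope is \<open>a\<close> or \<open>2 ^ k * b\<close>, a unit whatever
        \<open>w\<close> is.\<close>
      case True
      show ?thesis
      proof (rule infinite_rangeI[OF inj_power2])
        fix k
        let ?u = "2 ^ k :: complex"
        define N where "N = a + ?u * b"
        have N: "N \<noteq> 0" using True ab by (auto simp: N_def)
        have NR: "inverse N \<in> R" if R: "ring_set R" "A \<subseteq> R" for R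
          using inR[OF R(2)] pow2[OF R] True ring_setD(4)[OF R(1)] by (auto simp: N_def)
        show "infinite {w. infinite {s. g + ?u *s h + w *s e + s *s n \<in> unit_values A m1 m2}}"
        proof (rule infinite_rangeI)
          show "inj (of_nat :: nat \<Rightarrow> complex)" by (rule inj_of_nat)
          fix j
          let ?w = "of_nat j :: complex"
          let ?q = "quadric (g + ?u *s h + ?w *s e)"
          show "infinite {s. g + ?u *s h + ?w *s e + s *s n \<in> unit_values A m1 m2}"
          proof (rule infinite_rangeI)
            show "inj (\<lambda>l::nat. (1 * (2 ^ Suc 0) ^ l - ?q) / N)" by (rule inj) (use N in auto)
            fix l :: nat
            show "g + ?u *s h + ?w *s e + ((1 * (2 ^ Suc 0) ^ l - ?q) / N) *s n \<in> unit_values A m1 m2"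
            proof (rule mem)
              show "N = a + ?u * b + ?w * c" by (simp add: N_def c0)
              fix R assume R: "ring_set R" "A \<subseteq> R"
              note r = ring_setD[OF R(1)]
              have w: "?w \<in> R" by (intro r)
              have u: "?u \<in> R" by (intro r)
              have q: "?q \<in> R" by (rule quadR[OF R(1)]) (use y0R[OF R u w] in auto)
              have "(1 * (2 ^ Suc 0) ^ l - ?q) / N \<in> R"
                by (subst divide_inverse) (intro r q NR[OF R])
              then show "?u \<in> R \<and> ?w \<in> R \<and> (1 * (2 ^ Suc 0) ^ l - ?q) / N \<in> R \<and> inverse ?u \<in> R \<and>
                  inverse (1 * (2 ^ Suc 0) ^ l) \<in> R"
                using u w pow2[OF R] by simp
            qed (use N in auto)
          qed
        qed
      qed
    next
      \<comment> \<open>Asking that \<open>u\<close> and \<open>a + u * b\<close> be units is a unit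
        equation, with finitely many solutions in a finitely generated ring. Instead put
        \<open>u = - a / b * t\<close>, so that \<open>N = a * (1 - t)\<close>. Modulo
        \<open>N\<close> one has \<open>t = 1\<close>, \<open>u = - a / b\<close> and, for
        \<open>w = w0 + N * m\<close>, the quadric at \<open>s = 0\<close> equals
        \<open>K = \<kappa> w0\<close>. The units \<open>K * t ^ j\<close> are congruent to
        \<open>K\<close>, so the division by \<open>N\<close> succeeds.\<close>
      case False
      then have a0: "a \<noteq> 0" and b0: "b \<noteq> 0" by auto
      define p where "p = g + (- a / b) *s h"
      have k: "\<kappa> w = quadric p + w * quadric_polar p e + w ^ 2 * quadric e" for w
        by (simp add: \<kappa>_def p_def quadric_add)
      obtain w0 where w0: "w0 \<in> {0, 1, -1}" "\<kappa> w0 \<noteq> 0"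
      proof (rule ccontr)
        assume "\<not> thesis"
        then have "\<kappa> 0 = 0" "\<kappa> 1 = 0" "\<kappa> (-1) = 0" using that by auto
        then have pe: "quadric p = 0" "quadric_polar p e = 0" "quadric e = 0"
          by (auto simp: k add_eq_0_iff)
        \<comment> \<open>The vectors \<open>p\<close>, \<open>e\<close>, \<open>n\<close> would
          span a totally isotropic 3-space of a nondegenerate quadric in 4-space. Concretely,
          \<open>x\<close> is a combination of \<open>n\<close> and \<open>e\<close> polar to
          \<open>h\<close>; it is also polar to \<open>p\<close>, \<open>e\<close>,
          \<open>n\<close>, so it vanishes, which \<open>b \<noteq> 0\<close> forbids.\<close>
        define x where "x = quadric_polar e h *s n - b *s e"
        have pn: "quadric_polar p n = 0" using b0 by (simp add: p_def quadric_polar_simps a_def[symmetric] b_def[symmetric])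
        have xh: "quadric_polar x h = 0"
          by (simp add: x_def quadric_polar_simps b_def quadric_polar_commute[of n h])
        have xn: "quadric_polar x n = 0" using c0 by (simp add: x_def quadric_polar_simps qn c_def)
        have xe: "quadric_polar x e = 0"
          using c0 pe by (simp add: x_def quadric_polar_simps c_def quadric_polar_commute[of n e])
        have "quadric_polar x p = 0"
          using pn pe by (simp add: x_def quadric_polar_simps quadric_polar_commute[of _ p])
        then have xg: "quadric_polar x g = 0" using xh by (simp add: p_def quadric_polar_simps)
        have "x = 0"
        proof (rule quadric_polar_nondegenerate)
          fix z
          obtain d where "z = lincomb d [g, h, e, n]" using lin_indep_basis[OF ind, of z] by auto
          then show "quadric_polar x z = 0"
            using xg xh xe xn by (simp add: quadric_polar_simps quadric_polar_commute[of x 0])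
        qed
        then show False
          using lin_indepD[OF ind, of "(!) [0, 0, - b, quadric_polar e h]" 2] b0
          by (simp add: x_def vec_eq_iff)
      qed
      define K where "K = \<kappa> w0"
      have KR: "K \<in> R \<and> inverse K \<in> R \<and> w0 \<in> R" if "ring_set R" "A \<subseteq> R" for R
        using inR[OF that(2)] w0(1) ring_setD(1,2,5)[OF that(1)] unfolding K_def by auto
      show ?thesis
      proof (rule infinite_rangeI)
        show "inj (\<lambda>i. (- a / b * (2 ^ Suc 0) ^ Suc i - 0) / 1)"
        proof (rule injI)
          fix i j assume "(- a / b * (2 ^ Suc 0) ^ Suc i - 0) / 1 = (- a / b * (2 ^ Suc 0) ^ Suc j - 0) / 1"
          then have "(2::complex) ^ i = 2 ^ j" using a0 b0 by simp
          then show "i = j" by (rule injD[OF inj_power2])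
        qed
        fix i
        define t :: complex where "t = 2 ^ Suc i"
        define u where "u = - a / b * t"
        define N where "N = a + u * b"
        have N': "N = a * (1 - t)" using b0 by (simp add: N_def u_def algebra_simps)
        have t1: "t \<noteq> 1" using injD[OF inj_power2, of "Suc i" 0] by (auto simp: t_def)
        then have N: "N \<noteq> 0" using a0 by (simp add: N')
        have uR: "u \<in> R \<and> inverse u \<in> R \<and> t \<in> R \<and> N \<in> R" if R: "ring_set R" "A \<subseteq> R" for R
        proof -
          note r = ring_setD[OF R(1)]
          have tR: "t \<in> R" unfolding t_def by (intro r)
          have "- (a * inverse b * t) \<in> R" using inR[OF R(2)] by (intro r tR) auto
          moreover have "- (b * inverse a * inverse (2 ^ Suc i)) \<in> R"
            using inR[OF R(2)] by (intro r pow2[OF R]) auto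
          moreover have "a * (1 - t) \<in> R" using inR[OF R(2)] by (intro r tR) auto
          moreover have u: "u = - (a * inverse b * t)" by (simp add: u_def divide_inverse)
          moreover have "inverse u = - (b * inverse a * inverse (2 ^ Suc i))"
            unfolding u t_def[symmetric] inverse_minus_eq inverse_mult_distrib by simp
          ultimately show ?thesis using tR N' by metis
        qed
        have "infinite {w. infinite {s. g + u *s h + w *s e + s *s n \<in> unit_values A m1 m2}}"
        proof (rule infinite_rangeI)
          show "inj (\<lambda>m::nat. w0 + N * of_nat m)" using N by (auto simp: inj_def)
          fix m
          define w where "w = w0 + N * of_nat m"
          define q where "q = quadric (g + u *s h + w *s e)"
          define z where "z = inverse b *s h + of_nat m *s e"
          have "N * inverse b = a / b + u" using b0 by (simp add: N_def distrib_right divide_inverse)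
          then have Nb: "N *s (inverse b *s h) = (a / b + u) *s h" by simp
          have "N *s z = (a / b + u) *s h + (N * of_nat m) *s e"
            unfolding z_def vector_add_ldistrib Nb by simp
          then have "g + u *s h + w *s e = (p + w0 *s e) + N *s z"
            by (simp add: p_def w_def vec_eq_iff distrib_right)
          then have "q = quadric ((p + w0 *s e) + N *s z)" by (simp only: q_def)
          moreover have "quadric (p + w0 *s e) = K" by (simp only: K_def \<kappa>_def p_def)
          ultimately have q: "q = K + N * quadric_polar (p + w0 *s e) z + N ^ 2 * quadric z"
            by (simp only: quadric_add[of "p + w0 *s e" N])
          have "infinite {s. g + u *s h + w *s e + s *s n \<in> unit_values A m1 m2}"
          proof (rule infinite_rangeI)
            show "inj (\<lambda>j::nat. (K * (2 ^ Suc i) ^ j - q) / N)" by (rule inj) (use N w0(2) in \<open>auto simp: K_def\<close>)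
            fix j
            show "g + u *s h + w *s e + ((K * (2 ^ Suc i) ^ j - q) / N) *s n \<in> unit_values A m1 m2"
              unfolding q_def
            proof (rule mem)
              show "N = a + u * b + w * c" by (simp add: N_def c0)
              show "u \<noteq> 0" "K * (2 ^ Suc i) ^ j \<noteq> 0" using a0 b0 w0(2) by (auto simp: u_def t_def K_def)
              fix R assume R: "ring_set R" "A \<subseteq> R"
              note r = ring_setD[OF R(1)]
              have zR: "z $ l \<in> R" for l
                unfolding z_def using inR[OF R(2)] by (auto intro!: r)
              have "(- a / b) \<in> R" unfolding divide_inverse using inR[OF R(2)] by (intro r) auto
              then have "g $ l + (- a / b) * h $ l + w0 * e $ l \<in> R" for l
                using inR[OF R(2)] KR[OF R] by (intro r) blast+
              moreover have "(p + w0 *s e) $ l = g $ l + (- a / b) * h $ l + w0 * e $ l" for l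
                unfolding p_def vector_add_component vector_smult_component ..
              ultimately have pR: "(p + w0 *s e) $ l \<in> R" for l by simp
              \<comment> \<open>Makes the congruence explicit: \<open>t - 1\<close> divides
                \<open>t ^ j - 1\<close>, and \<open>N\<close> is \<open>1 - t\<close> up to the
                unit \<open>a\<close>.\<close>
              have "K * t ^ j - K = K * ((t - 1) * (\<Sum>l<j. t ^ l))"
                by (simp only: power_diff_1_eq[symmetric] right_diff_distrib mult_1_right)
              also have "\<dots> = (a * inverse a) * (K * ((t - 1) * (\<Sum>l<j. t ^ l)))" using a0 by simp
              also have "\<dots> = N * (- inverse a * K * (\<Sum>l<j. t ^ l))"
              proof -
                have "(a * x) * (K * ((t - 1) * S)) = (a * (1 - t)) * (- x * K * S)" for x S
                  by (simp add: algebra_simps)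
                then show ?thesis unfolding N' .
              qed
              finally have Kt: "K * t ^ j - K = N * (- inverse a * K * (\<Sum>l<j. t ^ l))" .
              have "(K * t ^ j - q) / N =
                  - inverse a * K * (\<Sum>l<j. t ^ l) - quadric_polar (p + w0 *s e) z - N * quadric z"
              proof -
                have *: "x / N = s - d - N * e" if "K * t ^ j - K = N * s" "x = K * t ^ j - (K + N * d + N ^ 2 * e)" for x s d e
                proof -
                  have "x = (K * t ^ j - K) - N * d - N ^ 2 * e" using that(2) by simp
                  then have "x = N * (s - d - N * e)"
                    unfolding that(1) by (simp add: power2_eq_square algebra_simps)
                  then show ?thesis using N by simp
                qed
                show ?thesis by (rule *[OF Kt]) (simp only: q)
              qed
              moreover have "- inverse a * K * (\<Sum>l<j. t ^ l) - quadric_polar (p + w0 *s e) z - N * quadric z \<in> R"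
                using inR[OF R(2)] KR[OF R] uR[OF R] pR zR
                by (intro r quadR[OF R(1)] polR[OF R(1)]) auto
              moreover have "w \<in> R" unfolding w_def using KR[OF R] uR[OF R] by (intro r) auto
              moreover have "inverse (K * (2 ^ Suc i) ^ j) \<in> R"
              proof -
                have "inverse K * (inverse (2 ^ Suc i)) ^ j \<in> R" using KR[OF R] by (intro r pow2[OF R]) auto
                then show ?thesis by (simp only: power_inverse inverse_mult_distrib)
              qed
              ultimately show "u \<in> R \<and> w \<in> R \<and> (K * (2 ^ Suc i) ^ j - quadric (g + u *s h + w *s e)) / N \<in> R \<and>
                  inverse u \<in> R \<and> inverse (K * (2 ^ Suc i) ^ j) \<in> R"
                using uR[OF R] unfolding q_def[symmetric] t_def[symmetric] by simp
            qed (use N in auto)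
          qed
          then show "infinite {s. g + u *s h + (w0 + N * of_nat m) *s e + s *s n \<in> unit_values A m1 m2}"
            unfolding w_def .
        qed
        moreover have "(- a / b * (2 ^ Suc 0) ^ Suc i - 0) / 1 = u" by (simp add: u_def t_def)
        ultimately show "infinite {w. infinite {s. g + ((- a / b * (2 ^ Suc 0) ^ Suc i - 0) / 1) *s h + w *s e + s *s n
             \<in> unit_values A m1 m2}}" by metis
      qed
    qed
  qed
  then show ?thesis using that[OF finA algA ind] by blast
qed

text \<open>The nested infinite sets eliminate \<open>s\<close>, \<open>w\<close> and
  \<open>u\<close> in turn, which settles the chart where the coefficient of \<open>g\<close> is
  \<open>1\<close>. Homogeneity reaches every nonzero coefficient, and moving in the direction of
  \<open>g\<close> reaches the coefficient zero.\<close>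

lemma unit_values_dense:
  fixes m1 m2 :: "complex ^ 4"
  assumes m: "algebraic_vec m1" "algebraic_vec m2" "lin_indep [m1, m2]"
  obtains A where "finite A" "\<And>a. a \<in> A \<Longrightarrow> algebraic a"
    "\<And>G d y. (\<And>y z. polyfun (\<lambda>t. G (y + t *s z))) \<Longrightarrow> (\<And>c y. G (c *s y) = c ^ d * G y) \<Longrightarrow>
       (\<And>y. y \<in> unit_values A m1 m2 \<Longrightarrow> G y = 0) \<Longrightarrow> G y = 0"
proof -
  obtain A g h e n where A: "finite A" "\<And>a. a \<in> A \<Longrightarrow> algebraic a" and ind: "lin_indep [g, h, e, n]"
    and inf: "infinite {u. infinite {w. infinite {s. g + u *s h + w *s e + s *s n \<in> unit_values A m1 m2}}}"
    using unit_values_infinite[OF m] by blast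
  have "G y = 0" if poly: "\<And>y z. polyfun (\<lambda>t. G (y + t *s z))" and homog: "\<And>c y. G (c *s y) = c ^ d * G y"
      and 0: "\<And>y. y \<in> unit_values A m1 m2 \<Longrightarrow> G y = 0" for G y and d :: nat
  proof -
    have P: "polyfun (\<lambda>s. G (g + u *s h + w *s e + s *s n))" "polyfun (\<lambda>w. G (g + u *s h + w *s e + s *s n))"
      "polyfun (\<lambda>u. G (g + u *s h + w *s e + s *s n))" for u w s
      using poly[of "g + u *s h + w *s e" n] poly[of "g + u *s h + s *s n" e] poly[of "g + w *s e + s *s n" h]
      by (simp_all add: algebra_simps)
    have "infinite {u. \<forall>w s. G (g + u *s h + w *s e + s *s n) = 0}"
    proof (rule infinite_super[OF _ inf], safe)
      fix u w s assume "infinite {w. infinite {s. g + u *s h + w *s e + s *s n \<in> unit_values A m1 m2}}"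
      then have "infinite {w. \<forall>s. G (g + u *s h + w *s e + s *s n) = 0}"
      proof (rule infinite_super[rotated], safe)
        fix w s assume "infinite {s. g + u *s h + w *s e + s *s n \<in> unit_values A m1 m2}"
        then have "infinite {s. G (g + u *s h + w *s e + s *s n) = 0}"
          by (rule infinite_super[rotated]) (use 0 in auto)
        then show "G (g + u *s h + w *s e + s *s n) = 0" by (rule polyfun_zero[OF P(1)])
      qed
      then have "infinite {w. G (g + u *s h + w *s e + s *s n) = 0}"
        by (rule infinite_super[rotated]) auto
      then show "G (g + u *s h + w *s e + s *s n) = 0" by (rule polyfun_zero[OF P(2)])
    qed
    then have G1: "G (g + u *s h + w *s e + s *s n) = 0" for u w s
      by (intro polyfun_zero[OF P(3)]) (rule infinite_super[rotated], assumption, auto)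
    obtain c where c: "y = lincomb c [g, h, e, n]" using lin_indep_basis[OF ind, of y] by auto
    have "G (y + t *s g) = 0" if "c 0 + t \<noteq> 0" for t
    proof -
      have "y + t *s g = (c 0 + t) *s (g + (c 1 / (c 0 + t)) *s h + (c 2 / (c 0 + t)) *s e + (c 3 / (c 0 + t)) *s n)"
      proof -
        have "x *s (g + (c 1 / x) *s h + (c 2 / x) *s e + (c 3 / x) *s n) = x *s g + c 1 *s h + c 2 *s e + c 3 *s n"
          if "x \<noteq> 0" for x using that by (simp add: vec_eq_iff distrib_left)
        from this[OF \<open>c 0 + t \<noteq> 0\<close>] show ?thesis
          by (simp add: c vec_eq_iff numeral_2_eq_2 numeral_3_eq_3 distrib_right)
      qed
      then show ?thesis by (simp only: homog G1 mult_zero_right)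
    qed
    then have "UNIV - {- c 0} \<subseteq> {t. G (y + t *s g) = 0}" by (auto simp: add_eq_0_iff)
    moreover have "infinite (UNIV - {- c 0})" using infinite_UNIV_char_0 by (simp add: infinite_remove)
    ultimately have "G (y + 0 *s g) = 0" by (intro polyfun_zero[OF poly]) (auto dest: infinite_super)
    then show ?thesis by simp
  qed
  then show ?thesis using that[OF A] by blast
qed

subsection \<open>Dual functionals\<close>

lemma pairing_add_left: "pairing (h + k) x = pairing h x + pairing k x"
  by (simp add: pairing_def sum.distrib algebra_simps)

lemma pairing_scale_left: "pairing (c *s h) x = c * pairing h x"
  by (simp add: pairing_def sum_distrib_left algebra_simps)

lemma pairing_commute: "pairing h x = pairing x h"
  by (simp add: pairing_def mult.commute)

lemma pairing_lincomb: "pairing h (lincomb c xs) = (\<Sum>i<length xs. c i * pairing h (xs ! i))"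
proof (induction xs arbitrary: c)
  case (Cons x xs)
  have "{..<length (x # xs)} = insert 0 (Suc ` {..<length xs})"
    by (auto simp: image_iff less_Suc_eq_0_disj)
  then show ?case using Cons by (simp add: pairing_simps sum.reindex)
qed (simp add: pairing_simps)

lemma pairing_eq_zero: "(\<And>x. pairing h x = 0) \<Longrightarrow> h = 0"
  using pairing_axis[of h] by (simp add: vec_eq_iff)

lemma sum_axis: "(\<Sum>j\<in>UNIV. axis i 1 $ j * f j) = (f i :: complex)"
  using pairing_axis[of "\<chi> j. f j" i] by (simp add: pairing_def mult.commute)

lemma axis_expansion: "x = (\<Sum>i\<in>UNIV. x $ i *s axis i (1::complex))"
  by (simp add: vec_eq_iff axis_def if_distrib cong: if_cong)

lemma dual_functional:
  fixes vs :: "(complex ^ 'n::finite) list"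
  assumes vs: "lin_indep vs" and k: "k < length vs"
  obtains \<xi> where "\<And>j. j < length vs \<Longrightarrow> pairing \<xi> (vs ! j) = (if j = k then 1 else 0)"
proof -
  have ind: "vec.independent (set vs)" and dist: "distinct vs" using vs by (auto simp: lin_indep_iff)
  define E where "E = vec.extend_basis (set vs)"
  have E: "vec.independent E" "set vs \<subseteq> E" "vec.span E = UNIV"
    unfolding E_def using vec.independent_extend_basis[OF ind] vec.extend_basis_superset[OF ind]
      vec.span_extend_basis[OF ind] by auto
  define f where "f t = vec.representation E t (vs ! k)" for t
  have f_add: "f (s + t) = f s + f t" and f_scale: "f (c *s t) = c * f t" for s t c
    using E by (simp_all add: f_def vec.representation_add vec.representation_scale)
  have f0: "f 0 = 0" using f_scale[of 0 0] by simp
  have f_sum: "f (\<Sum>i\<in>I. g i) = (\<Sum>i\<in>I. f (g i))" for g and I :: "'n set"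
    by (induction I rule: infinite_finite_induct) (simp_all add: f_add f0)
  define \<theta> :: "complex ^ 'n" where "\<theta> = (\<chi> i. f (axis i 1))"
  have \<theta>f: "pairing \<theta> t = f t" for t
    unfolding pairing_def \<theta>_def
    by (subst (2) axis_expansion[of t]) (simp add: f_sum f_scale mult.commute)
  have \<theta>: "pairing \<theta> (vs ! j) = (if j = k then 1 else 0)" if "j < length vs" for j
  proof -
    have "vs ! j \<in> E" using E(2) nth_mem[OF that] by blast
    then show ?thesis
      using vec.representation_basis[OF E(1), of "vs ! j"] that k dist \<theta>f[of "vs ! j"]
      by (auto simp: f_def nth_eq_iff_index_eq)
  qed
  then show ?thesis using that by blast
qed

text \<open>The dual conditions form a linear system with algebraic coefficients that
  \<open>dual_functional\<close> solves over the complex numbers, so an algebraic solution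
  exists.\<close>

lemma algebraic_dual:
  fixes vs :: "(complex ^ 'n::finite) list"
  assumes vs: "lin_indep vs" and k: "k < length vs" and alg: "\<And>v. v \<in> set vs \<Longrightarrow> algebraic_vec v"
  obtains \<xi> where "algebraic_vec \<xi>" "\<And>j. j < length vs \<Longrightarrow> pairing \<xi> (vs ! j) = (if j = k then 1 else 0)"
proof -
  obtain \<theta> where \<theta>: "\<And>j. j < length vs \<Longrightarrow> pairing \<theta> (vs ! j) = (if j = k then 1 else 0)"
    using dual_functional[OF vs k] by metis
  obtain y where y: "\<And>i. algebraic (y $ i)"
    "\<And>j. (\<Sum>i\<in>UNIV. (if j < length vs then vs ! j else 0) $ i * y $ i) = (if j = k then 1 else 0)"
  \<comment> \<open>Indices beyond the list contribute the trivial equation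
    \<open>0 = 0\<close>.\<close>
  proof (rule algebraic_linear_system[where A = "\<lambda>j. if j < length vs then vs ! j else 0" and x = \<theta>
        and b = "\<lambda>j. if j = k then 1 else 0"])
    show "algebraic ((if j < length vs then vs ! j else 0) $ i)" for j i
      using alg[of "vs ! j"] by (auto simp: algebraic_vec_def)
    show "algebraic (if j = k then 1 else 0 :: complex)" for j by (auto intro: algebraic_intros)
    show "(\<Sum>i\<in>UNIV. (if j < length vs then vs ! j else 0) $ i * \<theta> $ i) = (if j = k then 1 else 0)" for j
      using \<theta>[of j] k by (auto simp: pairing_def mult.commute)
  qed blast
  have "pairing y (vs ! j) = (if j = k then 1 else 0)" if "j < length vs" for j
    using y(2)[of j] that by (simp add: pairing_def mult.commute)
  then show ?thesis using that[of y] y(1) by (auto simp: algebraic_vec_def)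
qed

lemma axis_basis:
  obtains es :: "(complex ^ 'n::finite) list" where "lin_indep es" "length es = CARD('n)"
    "\<And>v. v \<in> set es \<Longrightarrow> algebraic_vec v"
proof -
  obtain es :: "(complex ^ 'n) list" where es: "set es = cart_basis" "distinct es"
    using finite_distinct_list[OF finite_cart_basis] by blast
  have "lin_indep es" using es independent_cart_basis by (simp add: lin_indep_iff)
  moreover have "length es = CARD('n)"
    using es vec.dim_eq_card_independent[OF independent_cart_basis] vec_dim_card[where 'n = 'n and 'a = complex]
    by (metis distinct_card vec.dim_UNIV)
  moreover have "algebraic_vec v" if "v \<in> set es" for v
    using that es by (auto simp: cart_basis_def algebraic_vec_intros)
  ultimately show ?thesis using that by blast
qed

lemma mv_lincomb: "M *v lincomb c es = lincomb c (map ((*v) M) es)"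
  for M :: "complex ^ 'n::finite ^ 'm::finite"
proof (induction es arbitrary: c)
  case Nil
  then show ?case by simp
next
  case (Cons x es)
  then show ?case
    by (simp add: matrix_vector_right_distrib vec.scale)
qed

lemma lin_indep_map_mv:
  fixes M :: "complex ^ 'n::finite ^ 'm::finite"
  assumes "inj ((*v) M)" "lin_indep es"
  shows "lin_indep (map ((*v) M) es)"
proof -
  have "lincomb c es = 0" if "M *v lincomb c es = 0" for c
    using assms(1) that by (metis injD matrix_vector_mult_0_right)
  then show ?thesis using assms(2) by (auto simp: lin_indep_def mv_lincomb[symmetric])
qed


subsection \<open>Alternating tensors\<close>

lemma exhaust_5: "x = 1 \<or> x = 2 \<or> x = 3 \<or> x = 4 \<or> x = 5" for x :: 5
proof (induct x)
  case (of_int z)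
  then have "z = 0 \<or> z = 1 \<or> z = 2 \<or> z = 3 \<or> z = 4" by fastforce
  then show ?case by auto
qed

lemma wedge_simps:
  "wedge (v + v') w = wedge v w + wedge v' w" "wedge (c *s v) w = c *s wedge v w"
  "wedge v (w + w') = wedge v w + wedge v w'" "wedge v (c *s w) = c *s wedge v w"
  "wedge v v = 0" "wedge 0 w = 0" "wedge v 0 = 0"
  by (simp_all add: wedge_def vec_eq_iff algebra_simps)

lemma wedge_swap: "wedge v w = - wedge w v"
  by (simp add: wedge_def vec_eq_iff)

lemma wedge_alternating: "wedge v w \<in> alternating_tensors"
  by (simp add: wedge_def alternating_tensors_def algebra_simps)

lemma wedge_eq_0_iff: "wedge v w = 0 \<longleftrightarrow> \<not> lin_indep [v, w]"
proof
  assume 0: "wedge v w = 0"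
  show "\<not> lin_indep [v, w]"
  proof
    assume i: "lin_indep [v, w]"
    then have "v \<noteq> 0" unfolding lin_indep_2 by (metis vector_smult_lzero vector_smult_rzero add_0 zero_neq_one)
    then obtain k where k: "v $ k \<noteq> 0" by (auto simp: vec_eq_iff)
    have "wedge v w $ (k, j) = 0" for j unfolding 0 by simp
    then have "w $ k *s v + (- v $ k) *s w = 0" by (simp add: wedge_def vec_eq_iff algebra_simps)
    then show False using i k unfolding lin_indep_2 by fastforce
  qed
next
  assume "\<not> lin_indep [v, w]"
  then obtain x y where xy: "x *s v + y *s w = 0" "x \<noteq> 0 \<or> y \<noteq> 0" by (auto simp: lin_indep_2)
  have "wedge (x *s v + y *s w) w = 0" "wedge v (x *s v + y *s w) = 0" unfolding xy(1) by (simp_all add: wedge_simps)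
  then show "wedge v w = 0" using xy(2) by (auto simp: wedge_simps vector_mul_eq_0)
qed

lemma alternatingD: "t \<in> alternating_tensors \<Longrightarrow> t $ (i, j) = - t $ (j, i)"
  unfolding alternating_tensors_def by blast

text \<open>Wedges of coordinate vectors over the ten pairs in \<open>P\<close> form a basis. In the
  type \<open>5\<close> the numeral \<open>5\<close> denotes the residue \<open>0\<close>, which
  serves as fifth index.\<close>

lemma dim_alternating: "vec.dim alternating_tensors = 10"
proof -
  define P :: "(5 \<times> 5) set" where
    "P = {(1,2),(1,3),(1,4),(1,5),(2,3),(2,4),(2,5),(3,4),(3,5),(4,5)}"
  define s :: "5 \<times> 5 \<Rightarrow> complex ^ (5 \<times> 5)" where "s p = wedge (axis (fst p) 1) (axis (snd p) 1)" for p
  have s_nth: "s p $ q = (if q = p then 1 else 0)" if "p \<in> P" "q \<in> P" for p q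
    using that by (auto simp: s_def wedge_def axis_def P_def)
  have finP: "finite P" by (simp add: P_def)
  have inj: "inj_on s P"
  proof (rule inj_onI)
    fix p q assume pq: "p \<in> P" "q \<in> P" "s p = s q"
    then have "s p $ p = s q $ p" by simp
    then show "p = q" using s_nth[OF pq(1,1)] s_nth[OF pq(2,1)] by (auto split: if_splits)
  qed
  have "card P = 10" by (simp add: P_def)
  have "vec.independent (s ` P)"
  proof (rule vec.independent_if_scalars_zero)
    show "finite (s ` P)" using finP by simp
    fix f x assume f: "(\<Sum>x\<in>s ` P. f x *s x) = 0" and x: "x \<in> s ` P"
    obtain q where q: "q \<in> P" "x = s q" using x by blast
    have "(\<Sum>p\<in>P. f (s p) *s s p) $ q = 0" using f inj by (simp add: sum.reindex)
    moreover have "(\<Sum>p\<in>P. f (s p) *s s p) $ q = (\<Sum>p\<in>P. if p = q then f (s p) else 0)"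
      unfolding sum_component by (rule sum.cong) (use s_nth q(1) in auto)
    ultimately show "f x = 0" using q finP by simp
  qed
  moreover have "s ` P \<subseteq> alternating_tensors"
    by (auto simp: s_def wedge_alternating)
  moreover have "alternating_tensors \<subseteq> vec.span (s ` P)"
  proof
    fix t assume t: "t \<in> alternating_tensors"
    have a: "t $ (i, j) = - t $ (j, i)" for i j using t by (rule alternatingD)
    have d: "t $ (i, i) = 0" for i
    proof -
      have "x = 0" if "x = - x" for x :: complex using that by simp
      then show ?thesis using a[of i i] .
    qed
    have "t = (\<Sum>p\<in>P. t $ p *s s p)"
    proof -
      have *: "t $ (i, j) = (\<Sum>p\<in>P. t $ p *s s p) $ (i, j)" for i j
        using exhaust_5[of i] exhaust_5[of j]
        by (elim disjE) (simp_all add: P_def s_def wedge_def axis_def d a[of 2 1] a[of 3 1] a[of 4 1] a[of 5 1]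
            a[of 3 2] a[of 4 2] a[of 5 2] a[of 4 3] a[of 5 3] a[of 5 4])
      have "t $ p = (\<Sum>p\<in>P. t $ p *s s p) $ p" for p
        using *[of "fst p" "snd p"] unfolding prod.collapse .
      then show ?thesis unfolding vec_eq_iff by blast
    qed
    also have "\<dots> \<in> vec.span (s ` P)"
      by (intro vec.span_sum vec.span_scale vec.span_base) auto
    finally show "t \<in> vec.span (s ` P)" .
  qed
  ultimately have "card (s ` P) = vec.dim alternating_tensors"
    by (intro vec.basis_card_eq_dim)
  then show ?thesis using card_image[OF inj] \<open>card P = 10\<close> by simp
qed

lemma alternating_basis:
  assumes "lin_indep ws" "length ws = 10" "set ws \<subseteq> alternating_tensors" "t \<in> alternating_tensors"
  obtains c where "t = lincomb c ws"
proof -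
  have ws: "distinct ws" "vec.independent (set ws)" using assms(1) by (auto simp: lin_indep_iff)
  have "alternating_tensors \<subseteq> vec.span (set ws)"
    using vec.card_ge_dim_independent[of "set ws" alternating_tensors] ws assms(2,3)
    by (simp add: dim_alternating distinct_card)
  then have "t \<in> vec.span (set ws)" using assms(4) by blast
  then obtain f where "t = (\<Sum>y\<in>set ws. f y *s y)"
    by (auto simp: vec.span_finite)
  also have "\<dots> = lincomb (\<lambda>i. f (ws ! i)) ws"
    unfolding lincomb_def
    by (rule sum.reindex_bij_betw[symmetric, OF bij_betw_nth]) (use ws in auto)
  finally show ?thesis using that by blast
qed

lemma alternating_extend:
  assumes "lin_indep rs" "set rs \<subseteq> alternating_tensors"
  obtains ts where "lin_indep (rs @ ts)" "length (rs @ ts) = 10" "set (rs @ ts) \<subseteq> alternating_tensors"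
proof -
  have rs: "distinct rs" "vec.independent (set rs)" using assms(1) by (auto simp: lin_indep_iff)
  obtain B where B: "set rs \<subseteq> B" "B \<subseteq> alternating_tensors" "vec.independent B" "alternating_tensors \<subseteq> vec.span B"
    using vec.maximal_independent_subset_extend[OF assms(2) rs(2)] by metis
  have "card B = 10" using vec.basis_card_eq_dim[OF B(2,4,3)] dim_alternating by simp
  have "finite B" using B(3) vec.finiteI_independent by blast
  then obtain ts where ts: "set ts = B - set rs" "distinct ts"
    using finite_distinct_list[of "B - set rs"] by blast
  have "set (rs @ ts) = B" "distinct (rs @ ts)" using ts B(1) rs by auto
  then show ?thesis
    using that[of ts] B \<open>card B = 10\<close> by (metis distinct_card lin_indep_iff)
qed

text \<open>The \<open>\<theta> i\<close> are the last three members of the dual of a basis that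
  starts with the image of \<open>M\<close>. A form \<open>c\<close> killing the tangent space at a
  point of the section defines a functional that kills the section too, hence by transversality all
  alternating tensors.\<close>

lemma transversal_section_net:
  assumes M: "transversal_section M"
  obtains \<theta> :: "3 \<Rightarrow> complex ^ (5 \<times> 5)" where
    "\<And>t. t \<in> alternating_tensors \<Longrightarrow> t \<in> range ((*v) M) \<longleftrightarrow> (\<forall>i. pairing (\<theta> i) t = 0)"
    "net (\<lambda>c v w. \<Sum>i\<in>UNIV. c $ i * pairing (\<theta> i) (wedge v w))"
proof -
  have inj: "inj ((*v) M)" and alt: "range ((*v) M) \<subseteq> alternating_tensors"
    and tr: "\<And>v w. wedge v w \<noteq> 0 \<Longrightarrow> wedge v w \<in> range ((*v) M) \<Longrightarrow>
        {s + t | s t. s \<in> grassmannian25_tangent v w \<and> t \<in> range ((*v) M)} = alternating_tensors"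
    using M by (auto simp: transversal_section_def)
  obtain es :: "(complex ^ 7) list" where es: "lin_indep es" "length es = CARD(7)" by (rule axis_basis)
  define rs where "rs = map ((*v) M) es"
  have rs: "lin_indep rs" "length rs = 7" "set rs \<subseteq> alternating_tensors"
    using lin_indep_map_mv[OF inj es(1)] es(2) alt by (auto simp: rs_def)
  obtain ts where ts: "lin_indep (rs @ ts)" "length (rs @ ts) = 10" "set (rs @ ts) \<subseteq> alternating_tensors"
    using alternating_extend[OF rs(1,3)] by blast
  have "\<exists>f. \<forall>j<10. pairing f ((rs @ ts) ! j) = (if j = k then 1 else 0)" if "k < 10" for k
    using dual_functional[OF ts(1), of k] ts(2) that by metis
  then obtain \<xi> where \<xi>: "\<And>k j. k < 10 \<Longrightarrow> j < 10 \<Longrightarrow> pairing (\<xi> k) ((rs @ ts) ! j) = (if j = k then 1 else 0)"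
    by metis
  \<comment> \<open>The positions 7, 8, 9 come after the seven vectors from the image of
    \<open>M\<close>.\<close>
  define n :: "3 \<Rightarrow> nat" where "n i = (if i = 1 then 7 else if i = 2 then 8 else 9)" for i
  have n: "n i < 10" "7 \<le> n i" for i by (auto simp: n_def)
  have n_surj: "\<exists>i. k = n i" if "7 \<le> k" "k < 10" for k
  proof -
    have "k = 7 \<or> k = 8 \<or> k = 9" using that by auto
    then show ?thesis by (auto simp: n_def intro: exI[of _ 1] exI[of _ 2] exI[of _ 3])
  qed
  have n_inj: "n i = n j \<longleftrightarrow> i = j" for i j
    using exhaust_3[of i] exhaust_3[of j] by (auto simp: n_def)
  have coef: "pairing (\<xi> k) (lincomb c (rs @ ts)) = c k" if "k < 10" for k c
  proof -
    have "(\<Sum>i<10. c i * pairing (\<xi> k) ((rs @ ts) ! i)) = (\<Sum>i<10. if i = k then c i else 0)"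
      by (rule sum.cong) (use \<xi>[OF that] in auto)
    then show ?thesis using that ts(2) unfolding pairing_lincomb by simp
  qed
  have inR: "t \<in> range ((*v) M) \<longleftrightarrow> (\<forall>i. pairing (\<xi> (n i)) t = 0)" if t: "t \<in> alternating_tensors" for t
  proof -
    obtain c where c: "t = lincomb c (rs @ ts)" using alternating_basis[OF ts t] by blast
    show ?thesis
    proof
      assume "t \<in> range ((*v) M)"
      then obtain x where x: "t = M *v x" by blast
      obtain d where d: "x = lincomb d es" using lin_indep_basis[OF es, of x] by blast
      have "t = lincomb d rs" unfolding x d mv_lincomb rs_def ..
      also have "\<dots> = lincomb (\<lambda>i. if i < 7 then d i else 0) (rs @ ts)"
        unfolding lincomb_append using rs(2) by (simp add: lincomb_def)
      finally have "pairing (\<xi> (n i)) t = (if n i < 7 then d (n i) else 0)" for i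
        using coef[OF n(1)] by simp
      moreover have "\<not> n i < 7" for i using n(2)[of i] by simp
      ultimately show "\<forall>i. pairing (\<xi> (n i)) t = 0" by simp
    next
      assume "\<forall>i. pairing (\<xi> (n i)) t = 0"
      then have "c k = 0" if "7 \<le> k" "k < 10" for k using n_surj[OF that] coef[of k c] that(2) c by auto
      then have "lincomb (\<lambda>i. c (i + length rs)) ts = 0"
        using rs(2) ts(2) by (simp add: lincomb_def)
      then have "t = M *v lincomb c es" unfolding c lincomb_append by (simp add: mv_lincomb rs_def)
      then show "t \<in> range ((*v) M)" by blast
    qed
  qed
  define \<omega> where "\<omega> = (\<lambda>(c :: complex ^ 3) v w. \<Sum>i\<in>UNIV. c $ i * pairing (\<xi> (n i)) (wedge v w))"
  have "net \<omega>"
  proof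
    fix c d :: "complex ^ 3" and v v' w :: "complex ^ 5" and x :: complex
    show "\<omega> (c + d) v w = \<omega> c v w + \<omega> d v w" "\<omega> (x *s c) v w = x * \<omega> c v w"
      "\<omega> c (v + v') w = \<omega> c v w + \<omega> c v' w" "\<omega> c (x *s v) w = x * \<omega> c v w"
      by (simp_all add: \<omega>_def wedge_simps pairing_simps sum.distrib sum_distrib_left algebra_simps)
    show "\<omega> c v w = - \<omega> c w v"
      by (simp add: \<omega>_def wedge_swap[of v w] pairing_simps sum_negf)
  next
    fix c :: "complex ^ 3" and v w :: "complex ^ 5"
    assume vw: "lin_indep [v, w]" and 0: "\<And>c. \<omega> c v w = 0" and v0: "\<And>x. \<omega> c v x = 0" and w0: "\<And>x. \<omega> c w x = 0"
    have "pairing (\<xi> (n i)) (wedge v w) = 0" for i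
      using 0[of "axis i 1"] unfolding \<omega>_def sum_axis .
    then have "wedge v w \<in> range ((*v) M)" using inR[OF wedge_alternating] by blast
    then have all: "{s + t | s t. s \<in> grassmannian25_tangent v w \<and> t \<in> range ((*v) M)} = alternating_tensors"
      using tr vw wedge_eq_0_iff by blast
    have zero: "(\<Sum>i\<in>UNIV. c $ i * pairing (\<xi> (n i)) t) = 0" if t: "t \<in> alternating_tensors" for t
    proof -
      obtain s r where sr: "t = s + r" "s \<in> grassmannian25_tangent v w" "r \<in> range ((*v) M)"
        using t all by blast
      obtain a b where s: "s = wedge a w + wedge v b" using sr(2) by (auto simp: grassmannian25_tangent_def)
      have "r \<in> alternating_tensors" using sr(3) alt by blast
      then have "pairing (\<xi> (n i)) r = 0" for i using inR sr(3) by blast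
      then have "(\<Sum>i\<in>UNIV. c $ i * pairing (\<xi> (n i)) t) = \<omega> c a w + \<omega> c v b"
        by (simp add: sr(1) s \<omega>_def pairing_simps distrib_left sum.distrib)
      also have "\<omega> c a w = - \<omega> c w a" by (simp add: \<omega>_def wedge_swap[of a w] pairing_simps sum_negf)
      finally show ?thesis using v0 w0 by simp
    qed
    have "c $ k = 0" for k
    proof -
      have "(rs @ ts) ! n k \<in> alternating_tensors" using ts(2,3) n(1)[of k] nth_mem[of "n k" "rs @ ts"] by auto
      from zero[OF this] have "0 = (\<Sum>i\<in>UNIV. c $ i * pairing (\<xi> (n i)) ((rs @ ts) ! n k))" by simp
      also have "\<dots> = (\<Sum>i\<in>UNIV. if i = k then c $ i else 0)"
        by (rule sum.cong) (use \<xi>[OF n(1) n(1)] n_inj in auto)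
      finally show ?thesis by simp
    qed
    then show "c = 0" by (simp add: vec_eq_iff)
  qed
  then show ?thesis using that[of "\<lambda>i. \<xi> (n i)"] inR by (simp add: \<omega>_def)
qed

subsection \<open>Conics in the linear section\<close>

text \<open>The tensor as a bilinear form on functionals. Arbitrary functionals instead of
  coordinates permit dual bases adapted to the conic.\<close>

definition tens :: "complex ^ (5 \<times> 5) \<Rightarrow> complex ^ 5 \<Rightarrow> complex ^ 5 \<Rightarrow> complex" where
  "tens t \<xi> \<eta> = pairing \<xi> (\<chi> i. pairing \<eta> (\<chi> j. t $ (i, j)))"

lemma tens_add: "tens (s + t) \<xi> \<eta> = tens s \<xi> \<eta> + tens t \<xi> \<eta>"
  by (simp add: tens_def pairing_def sum.distrib algebra_simps)

lemma tens_scale: "tens (c *s t) \<xi> \<eta> = c * tens t \<xi> \<eta>"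
  by (simp add: tens_def pairing_def sum_distrib_left algebra_simps)

lemma tens_wedge: "tens (wedge v w) \<xi> \<eta> = pairing \<xi> v * pairing \<eta> w - pairing \<xi> w * pairing \<eta> v"
proof -
  have "(\<chi> i. pairing \<eta> (\<chi> j. wedge v w $ (i, j))) = pairing \<eta> w *s v - pairing \<eta> v *s w"
    by (simp add: vec_eq_iff wedge_def pairing_def sum_subtractf sum_distrib_left sum_distrib_right algebra_simps)
  then show ?thesis by (simp add: tens_def pairing_simps mult.commute)
qed

lemma tens_axis: "tens t (axis i 1) (axis j 1) = t $ (i, j)"
  by (simp add: tens_def pairing_commute[of "axis _ _"] pairing_axis)

lemma tens_lincomb_right: "tens t \<xi> (lincomb c xs) = (\<Sum>i<length xs. c i * tens t \<xi> (xs ! i))"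
proof -
  have "tens t \<xi> \<eta> = pairing (\<chi> j. pairing \<xi> (\<chi> i. t $ (i, j))) \<eta>" for \<eta>
    unfolding tens_def pairing_def by (simp add: sum_distrib_left sum_distrib_right mult_ac) (rule sum.swap)
  then show ?thesis by (simp add: pairing_lincomb)
qed

lemma tens_lincomb_left: "tens t (lincomb c xs) \<eta> = (\<Sum>i<length xs. c i * tens t (xs ! i) \<eta>)"
  unfolding tens_def pairing_commute[of _ "\<chi> i. pairing \<eta> (\<chi> j. t $ (i, j))"] by (rule pairing_lincomb)

lemma tens_skew:
  assumes "t \<in> alternating_tensors"
  shows "tens t \<eta> \<xi> = - tens t \<xi> \<eta>"
proof -
  have "tens t \<eta> \<xi> = (\<Sum>i\<in>UNIV. \<Sum>j\<in>UNIV. \<eta> $ i * \<xi> $ j * t $ (i, j))"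
    by (simp add: tens_def pairing_def sum_distrib_left mult_ac)
  also have "\<dots> = (\<Sum>i\<in>UNIV. \<Sum>j\<in>UNIV. - (\<xi> $ j * \<eta> $ i * t $ (j, i)))"
    by (intro sum.cong refl) (subst alternatingD[OF assms], simp add: mult_ac)
  also have "\<dots> = - tens t \<xi> \<eta>"
    by (subst sum.swap) (simp add: tens_def pairing_def sum_distrib_left sum_negf mult_ac)
  finally show ?thesis .
qed

lemma tens_eqI:
  assumes xs: "lin_indep xs" "length xs = 5"
    and eq: "\<And>\<xi> \<eta>. \<xi> \<in> set xs \<Longrightarrow> \<eta> \<in> set xs \<Longrightarrow> tens s \<xi> \<eta> = tens t \<xi> \<eta>"
  shows "s = t"
proof -
  have right: "tens s \<xi> \<eta> = tens t \<xi> \<eta>" if "\<xi> \<in> set xs" for \<xi> \<eta>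
  proof -
    obtain c where "\<eta> = lincomb c xs" using lin_indep_basis[of xs \<eta>] xs by auto
    then show ?thesis using eq that by (simp add: tens_lincomb_right)
  qed
  have all: "tens s \<xi> \<eta> = tens t \<xi> \<eta>" for \<xi> \<eta>
  proof -
    obtain c where "\<xi> = lincomb c xs" using lin_indep_basis[of xs \<xi>] xs by auto
    then show ?thesis using right by (simp add: tens_lincomb_left)
  qed
  have "s $ p = t $ p" for p
    using all[of "axis (fst p) 1" "axis (snd p) 1"] unfolding tens_axis by simp
  then show ?thesis unfolding vec_eq_iff by blast
qed

text \<open>For alternating \<open>t\<close> this is the Pfaffian of the 4 by 4 matrix of its values
  on four functionals; a nonzero tensor is decomposable iff all of these vanish.\<close>

definition pluecker :: "complex ^ (5 \<times> 5) \<Rightarrow> complex ^ 5 \<Rightarrow> complex ^ 5 \<Rightarrow> complex ^ 5 \<Rightarrow> complex ^ 5 \<Rightarrow> complex" where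
  "pluecker t x1 x2 x3 x4 =
     tens t x1 x2 * tens t x3 x4 - tens t x1 x3 * tens t x2 x4 + tens t x1 x4 * tens t x2 x3"

definition pluecker_polar ::
  "complex ^ (5 \<times> 5) \<Rightarrow> complex ^ (5 \<times> 5) \<Rightarrow> complex ^ 5 \<Rightarrow> complex ^ 5 \<Rightarrow> complex ^ 5 \<Rightarrow> complex ^ 5 \<Rightarrow> complex" where
  "pluecker_polar s t x1 x2 x3 x4 =
     tens s x1 x2 * tens t x3 x4 + tens t x1 x2 * tens s x3 x4
     - tens s x1 x3 * tens t x2 x4 - tens t x1 x3 * tens s x2 x4
     + tens s x1 x4 * tens t x2 x3 + tens t x1 x4 * tens s x2 x3"

lemma pluecker_wedge: "pluecker (wedge v w) x1 x2 x3 x4 = 0"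
  by (simp add: pluecker_def tens_wedge algebra_simps)

lemma pluecker_add:
  "pluecker (s + t) x1 x2 x3 x4 = pluecker s x1 x2 x3 x4 + pluecker_polar s t x1 x2 x3 x4 + pluecker t x1 x2 x3 x4"
  by (simp add: pluecker_def pluecker_polar_def tens_add algebra_simps)

lemma pluecker_conic:
  "pluecker (s + c *s t + (c * c) *s u) x1 x2 x3 x4 = pluecker s x1 x2 x3 x4
     + c * pluecker_polar s t x1 x2 x3 x4
     + c ^ 2 * (pluecker t x1 x2 x3 x4 + pluecker_polar s u x1 x2 x3 x4)
     + c ^ 3 * pluecker_polar t u x1 x2 x3 x4 + c ^ 4 * pluecker u x1 x2 x3 x4"
  by (simp add: pluecker_def pluecker_polar_def tens_add tens_scale algebra_simps power2_eq_square
      power3_eq_cube power4_eq_xxxx)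

text \<open>If the entry at \<open>(i, j)\<close> is nonzero, the rows \<open>i\<close> and
  \<open>j\<close> of the matrix of \<open>t\<close> span the line. The explicit formula matters
  because it keeps algebraic entries algebraic.\<close>

lemma pluecker_imp_decomposable:
  assumes "t \<noteq> 0" and 0: "\<And>x1 x2 x3 x4. pluecker t x1 x2 x3 x4 = 0"
  obtains i j where "t = wedge (\<chi> k. t $ (i, k)) (\<chi> k. t $ (j, k) / t $ (i, j))"
proof -
  obtain p where "t $ p \<noteq> 0" using assms(1) by (auto simp: vec_eq_iff)
  then obtain i j where ij: "t $ (i, j) \<noteq> 0" by (cases p) auto
  have *: "t $ (k, l) = wedge (\<chi> k. t $ (i, k)) (\<chi> k. t $ (j, k) / t $ (i, j)) $ (k, l)" for k l
  proof -
    have "t $ (i, j) * t $ (k, l) = t $ (i, k) * t $ (j, l) - t $ (i, l) * t $ (j, k)"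
      using 0[of "axis i 1" "axis j 1" "axis k 1" "axis l 1"]
      by (simp add: pluecker_def tens_axis algebra_simps)
    then have "t $ (k, l) = (t $ (i, k) * t $ (j, l) - t $ (i, l) * t $ (j, k)) / t $ (i, j)"
      using ij by (simp add: eq_divide_eq mult.commute)
    then show ?thesis by (simp add: wedge_def diff_divide_distrib)
  qed
  have "t $ p = wedge (\<chi> k. t $ (i, k)) (\<chi> k. t $ (j, k) / t $ (i, j)) $ p" for p
    using *[of "fst p" "snd p"] unfolding prod.collapse .
  then have "t = wedge (\<chi> k. t $ (i, k)) (\<chi> k. t $ (j, k) / t $ (i, j))" unfolding vec_eq_iff by blast
  then show ?thesis by (rule that)
qed

text \<open>Polar Pluecker vectors belong to lines that meet: evaluated on functionals dual to four
  independent vectors, the polar form would be \<open>1\<close>.\<close>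

lemma polar_zero_imp_dependent:
  assumes "\<And>x1 x2 x3 x4. pluecker_polar (wedge u v) (wedge p r) x1 x2 x3 x4 = 0"
  shows "\<not> lin_indep [u, v, p, r]"
proof
  assume i: "lin_indep [u, v, p, r]"
  have "\<exists>f. \<forall>j<4. pairing f ([u, v, p, r] ! j) = (if j = k then 1 else 0)" if "k < 4" for k
  proof -
    have k: "k < length [u, v, p, r]" using that by simp
    obtain f where f: "\<And>j. j < length [u, v, p, r] \<Longrightarrow> pairing f ([u, v, p, r] ! j) = (if j = k then 1 else 0)"
      by (rule dual_functional[OF i k]) blast
    show ?thesis by (rule exI[of _ f]) (use f in simp)
  qed
  then have "\<forall>k. \<exists>f. k < 4 \<longrightarrow> (\<forall>j<4. pairing f ([u, v, p, r] ! j) = (if j = k then 1 else 0))"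
    by blast
  from choice[OF this] obtain f where
    f: "\<And>k j. k < 4 \<Longrightarrow> j < 4 \<Longrightarrow> pairing (f k) ([u, v, p, r] ! j) = (if j = k then 1 else 0)"
    by blast
  have "pairing (f k) u = (if 0 = k then 1 else 0)" "pairing (f k) v = (if 1 = k then 1 else 0)"
    "pairing (f k) p = (if 2 = k then 1 else 0)" "pairing (f k) r = (if 3 = k then 1 else 0)" if "k < 4" for k
    using f[OF that, of 0] f[OF that, of 1] f[OF that, of 2] f[OF that, of 3] by simp_all
  then show False
    using assms[of "f 0" "f 1" "f 2" "f 3"] by (simp add: pluecker_polar_def tens_wedge)
qed

lemma wedge_minus: "wedge (- v) w = - wedge v w" "wedge v (- w) = - wedge v w"
  by (simp_all add: wedge_def vec_eq_iff)

lemma lin_indep_nonzero: "lin_indep xs \<Longrightarrow> x \<in> set xs \<Longrightarrow> x \<noteq> 0"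
  using vec.dependent_zero by (auto simp: lin_indep_iff)

text \<open>A line may be spanned starting with any of its points; the second generator absorbs the
  factor.\<close>

lemma wedge_rebase:
  assumes "u = x *s a + y *s b" "u \<noteq> 0"
  obtains b' where "wedge a b = wedge u b'"
proof (cases "x = 0")
  case True
  then have "y \<noteq> 0" using assms by auto
  then have "wedge u ((- 1 / y) *s a) = wedge a b"
    using True by (simp add: assms(1) wedge_simps wedge_minus wedge_swap[of b a])
  then show ?thesis using that by metis
next
  case False
  then have "wedge u ((1 / x) *s b) = wedge a b" by (simp add: assms(1) wedge_simps vec_eq_iff)
  then show ?thesis using that by metis
qed

text \<open>If two lines of a conic met, then the plane of the conic would consist of lines, either through
  a common point or in a common plane; the net of forms excludes both.\<close>

lemma conic_lines_disjoint:
  fixes \<theta> :: "3 \<Rightarrow> complex ^ (5 \<times> 5)"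
  assumes net: "net (\<lambda>c v w. \<Sum>i\<in>UNIV. c $ i * pairing (\<theta> i) (wedge v w))"
    and killed: "\<And>i. pairing (\<theta> i) (wedge a b) = 0" "\<And>i. pairing (\<theta> i) T = 0" "\<And>i. pairing (\<theta> i) (wedge c d) = 0"
    and ind: "lin_indep [wedge a b, T, wedge c d]"
    and P: "\<And>x1 x2 x3 x4. pluecker_polar (wedge a b) T x1 x2 x3 x4 = 0"
      "\<And>x1 x2 x3 x4. pluecker_polar (wedge c d) T x1 x2 x3 x4 = 0"
      "\<And>x1 x2 x3 x4. pluecker T x1 x2 x3 x4 + pluecker_polar (wedge a b) (wedge c d) x1 x2 x3 x4 = 0"
  shows "lin_indep [a, b, c, d]"
proof (rule ccontr)
  define \<omega> where "\<omega> = (\<lambda>(c :: complex ^ 3) v w. \<Sum>i\<in>UNIV. c $ i * pairing (\<theta> i) (wedge v w))"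
  interpret net \<omega> using net by (simp add: \<omega>_def)
  have om: "\<omega> k v w = 0" if "\<And>i. pairing (\<theta> i) (wedge v w) = 0" for k v w
    using that by (simp add: \<omega>_def)
  assume "\<not> lin_indep [a, b, c, d]"
  then obtain f i where f: "lincomb f [a, b, c, d] = 0" and i: "i < length [a, b, c, d]" "f i \<noteq> 0"
    unfolding lin_indep_def by blast
  have ind': "x = 0 \<and> y = 0 \<and> z = 0" if "x *s wedge a b + y *s T + z *s wedge c d = 0" for x y z
    using ind that unfolding lin_indep_3 by blast
  have ab: "lin_indep [a, b]" and cd: "lin_indep [c, d]"
    using ind'[of 1 0 0] ind'[of 0 0 1] wedge_eq_0_iff[of a b] wedge_eq_0_iff[of c d] by auto
  \<comment> \<open>The assumed dependence yields a common point \<open>u\<close> of the lines of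
    \<open>wedge a b\<close> and \<open>wedge c d\<close>.\<close>
  define u where "u = f 0 *s a + f 1 *s b"
  have u2: "u = (- f 2) *s c + (- f 3) *s d"
    using f by (simp add: u_def numeral_2_eq_2 numeral_3_eq_3 eq_neg_iff_add_eq_0 algebra_simps)
  have u0: "u \<noteq> 0"
  proof
    assume "u = 0"
    then have "f 0 = 0" "f 1 = 0" "f 2 = 0" "f 3 = 0"
      using ab cd u2 unfolding lin_indep_2 u_def by (metis neg_equal_0_iff_equal)+
    moreover have "i = 0 \<or> i = 1 \<or> i = 2 \<or> i = 3" using i(1) by auto
    ultimately show False using i(2) by auto
  qed
  obtain b' where b': "wedge a b = wedge u b'" by (rule wedge_rebase[OF u_def u0])
  obtain d' where d': "wedge c d = wedge u d'" by (rule wedge_rebase[OF u2 u0])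
  have ubd: "lin_indep [u, b', d']"
    unfolding lin_indep_3
  proof (intro allI impI)
    fix x y z assume 0: "x *s u + y *s b' + z *s d' = 0"
    have "wedge u (x *s u + y *s b' + z *s d') = 0" unfolding 0 by (simp add: wedge_simps)
    then have "y *s wedge a b + 0 *s T + z *s wedge c d = 0" by (simp add: wedge_simps b' d')
    then have "y = 0" "z = 0" using ind' by blast+
    then show "x = 0 \<and> y = 0 \<and> z = 0" using 0 u0 by (simp add: vector_mul_eq_0)
  qed
  \<comment> \<open>Both bivectors are divisible by \<open>u\<close>, so their sum is decomposable
    and they are polar to each other. The third relation then makes \<open>T\<close> decomposable as
    well.\<close>
  have "pluecker (wedge a b + wedge c d) x1 x2 x3 x4 = 0" for x1 x2 x3 x4
    unfolding b' d' wedge_simps(3)[symmetric] by (rule pluecker_wedge)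
  then have "pluecker_polar (wedge a b) (wedge c d) x1 x2 x3 x4 = 0" for x1 x2 x3 x4
    unfolding pluecker_add pluecker_wedge by simp
  then have PT: "pluecker T x1 x2 x3 x4 = 0" for x1 x2 x3 x4 using P(3) by simp
  have T0: "T \<noteq> 0" using ind'[of 0 1 0] by auto
  then obtain p r where T: "T = wedge p r"
    using pluecker_imp_decomposable[OF T0 PT] by metis
  have pr: "lin_indep [p, r]" using T0 T wedge_eq_0_iff by blast
  \<comment> \<open>Lines through a common point: if \<open>T\<close> also contains
    \<open>u\<close>, all forms vanish on \<open>u\<close> against a 4-space. Whether a form kills
    \<open>u\<close> is then decided by one further vector \<open>g\<close>, so two independent
    forms do, contrary to \<open>no_common_kernel\<close>.\<close>
  have cone: False if u: "u = x *s p + y *s r" for x y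
  proof -
    obtain p' where p': "wedge p r = wedge u p'" by (rule wedge_rebase[OF u u0])
    have ind4: "lin_indep [u, b', d', p']"
      unfolding lin_indep_def
    proof (intro allI impI)
      fix g j assume 0: "lincomb g [u, b', d', p'] = 0" and j: "j < length [u, b', d', p']"
      have "wedge u (lincomb g [u, b', d', p']) = 0" unfolding 0 by (simp add: wedge_simps)
      then have "g 1 *s wedge a b + g 3 *s T + g 2 *s wedge c d = 0"
        by (simp add: wedge_simps b' d' p' T numeral_2_eq_2 numeral_3_eq_3 algebra_simps)
      then have "g 1 = 0" "g 3 = 0" "g 2 = 0" using ind' by blast+
      moreover from this have "g 0 = 0" using 0 u0 by (simp add: vector_mul_eq_0 numeral_2_eq_2 numeral_3_eq_3)
      moreover have "j = 0 \<or> j = 1 \<or> j = 2 \<or> j = 3" using j by auto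
      ultimately show "g j = 0" by auto
    qed
    obtain ys where ys: "lin_indep ([u, b', d', p'] @ ys)" "length ([u, b', d', p'] @ ys) = CARD(5)"
      using lin_indep_extend[OF ind4] by blast
    then obtain g where g: "ys = [g]" by (auto simp: length_Suc_conv)
    obtain es :: "(complex ^ 3) list" where es: "lin_indep es" "length es = CARD(3)" by (rule axis_basis)
    obtain k l where kl: "lin_indep [lincomb k es, lincomb l es]"
       "(\<Sum>i<length es. k i * \<omega> (es ! i) u g) = 0" "(\<Sum>i<length es. l i * \<omega> (es ! i) u g) = 0"
      using lin_indep_two_kernel[OF es(1), of "\<lambda>i. \<omega> (es ! i) u g"] es(2) by auto
    have z: "\<omega> h u b' = 0" "\<omega> h u d' = 0" "\<omega> h u p' = 0" for h
      by (rule om, use killed b' d' p' T in simp)+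
    have "\<omega> (lincomb k es) u x = 0" if "(\<Sum>i<length es. k i * \<omega> (es ! i) u g) = 0" for k x
    proof (rule zero_on_basis[OF ys(1)])
      fix y assume "y \<in> set ([u, b', d', p'] @ ys)"
      then consider "y = u" | "y = b'" | "y = d'" | "y = p'" | "y = g" using g by auto
      then show "\<omega> (lincomb k es) u y = 0"
        by cases (use z that in \<open>simp_all add: alt lincomb1\<close>)
    qed (use ys(2) in simp)
    then show False using no_common_kernel[OF u0] kl by blast
  qed
  \<comment> \<open>Lines in a common plane: \<open>T\<close> meets the other two lines away from
    \<open>u\<close>, hence lies in their plane, and this plane is isotropic for the whole
    net.\<close>
  have "\<not> lin_indep [u, b', p, r]" by (rule polar_zero_imp_dependent) (use P(1) b' T in simp)
  then obtain g i where g: "lincomb g [u, b', p, r] = 0" "i < length [u, b', p, r]" "g i \<noteq> 0"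
    unfolding lin_indep_def by blast
  have "\<not> lin_indep [u, d', p, r]" by (rule polar_zero_imp_dependent) (use P(2) d' T in simp)
  then obtain h j where h: "lincomb h [u, d', p, r] = 0" "j < length [u, d', p, r]" "h j \<noteq> 0"
    unfolding lin_indep_def by blast
  have prz: "x = 0 \<and> y = 0" if "x *s p + y *s r = 0" for x y using pr that unfolding lin_indep_2 by blast
  have cone': False if 0: "l 0 *s u + (l 2 *s p + l 3 *s r) = 0" and l: "l 0 \<noteq> 0 \<or> l 2 \<noteq> 0 \<or> l 3 \<noteq> 0" for l :: "nat \<Rightarrow> complex"
  proof (cases "l 0 = 0")
    case True
    then show False using 0 l prz by auto
  next
    case False
    have "l 0 *s u = - (l 2 *s p + l 3 *s r)" using 0 unfolding eq_neg_iff_add_eq_0 .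
    then have "(1 / l 0) *s (l 0 *s u) = (1 / l 0) *s (- (l 2 *s p + l 3 *s r))" by simp
    then have "u = (- l 2 / l 0) *s p + (- l 3 / l 0) *s r"
      using False by (simp add: vec_eq_iff algebra_simps add_divide_distrib)
    then show False by (rule cone)
  qed
  have g1: "g 1 \<noteq> 0"
  proof
    assume "g 1 = 0"
    moreover have "i = 0 \<or> i = 1 \<or> i = 2 \<or> i = 3" using g(2) by auto
    ultimately show False
      using cone'[of g] g by (auto simp: numeral_2_eq_2 numeral_3_eq_3)
  qed
  have h1: "h 1 \<noteq> 0"
  proof
    assume "h 1 = 0"
    moreover have "j = 0 \<or> j = 1 \<or> j = 2 \<or> j = 3" using h(2) by auto
    ultimately show False
      using cone'[of h] h by (auto simp: numeral_2_eq_2 numeral_3_eq_3)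
  qed
  have m: "g 0 *s u + g 1 *s b' = - (g 2 *s p + g 3 *s r)" "h 0 *s u + h 1 *s d' = - (h 2 *s p + h 3 *s r)"
    unfolding eq_neg_iff_add_eq_0 using g(1) h(1) by (simp_all add: numeral_2_eq_2 numeral_3_eq_3 add.assoc)
  have z: "\<omega> k u b' = 0" "\<omega> k u d' = 0" "\<omega> k p r = 0" for k
    by (rule om, use killed b' d' T in simp)+
  have "\<omega> k b' d' = 0" for k
  proof -
    have "\<omega> k (g 0 *s u + g 1 *s b') (h 0 *s u + h 1 *s d') = g 1 * h 1 * \<omega> k b' d'"
      using z[of k] skew[of k b' u] by (simp add: om_simps)
    moreover have "\<omega> k (g 0 *s u + g 1 *s b') (h 0 *s u + h 1 *s d') = 0"
      unfolding m using z[of k] skew[of k r p] by (simp add: om_simps)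
    ultimately show ?thesis using g1 h1 by simp
  qed
  then show False using no_isotropic3[OF ubd] z by blast
qed

text \<open>Extending by a coordinate vector keeps the entries of the list algebraic.\<close>

lemma lin_indep_snoc_axis:
  fixes vs :: "(complex ^ 'n::finite) list"
  assumes "lin_indep vs" "length vs < CARD('n)"
  obtains k where "lin_indep (vs @ [axis k 1])"
proof -
  have vs: "distinct vs" "vec.independent (set vs)" using assms(1) by (auto simp: lin_indep_iff)
  have "\<exists>k. axis k 1 \<notin> vec.span (set vs)"
  proof (rule ccontr)
    assume "\<not> ?thesis"
    then have "(\<Sum>i\<in>UNIV. x $ i *s axis i 1) \<in> vec.span (set vs)" for x :: "complex ^ 'n"
      by (intro vec.span_sum vec.span_scale) auto
    then have "UNIV \<subseteq> vec.span (set vs)" using axis_expansion by (metis subsetI)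
    from vec.dim_le_card[OF this] have "CARD('n) \<le> card (set vs)" unfolding vec_dim_card by simp
    then show False using assms(2) vs(1) by (simp add: distinct_card)
  qed
  then obtain k where k: "axis k 1 \<notin> vec.span (set vs)" ..
  then have "axis k 1 \<notin> set vs" using vec.span_base by blast
  then have "lin_indep (vs @ [axis k 1])"
    using vs vec.independent_insertI[OF k vs(2)] by (simp add: lin_indep_iff)
  then show ?thesis by (rule that)
qed

text \<open>The vectors \<open>y0\<close>, \<open>y2\<close> are isotropic and \<open>y1\<close> is
  orthogonal to both, scaled such that \<open>B y1 y1 = - 2 * B y0 y2\<close>; this cancels the
  coefficient of \<open>s ^ 2\<close>. Only square roots are extracted, so the frame stays
  algebraic.\<close>

lemma conic_frame:
  fixes Q :: "complex ^ 3 ^ 3"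
  assumes alg: "\<And>i j. algebraic (Q $ i $ j)" and sym: "transpose Q = Q"
    and smooth: "\<And>y. y \<noteq> 0 \<Longrightarrow> pairing y (Q *v y) = 0 \<Longrightarrow> Q *v y \<noteq> 0"
  obtains y0 y1 y2 where "algebraic_vec y0" "algebraic_vec y1" "algebraic_vec y2" "lin_indep [y0, y1, y2]"
    "pairing y2 (Q *v y2) = 0"
    "\<And>s. pairing (y0 + s *s y1 + (s * s) *s y2) (Q *v (y0 + s *s y1 + (s * s) *s y2)) = 0"
proof -
  define B where "B y z = pairing y (Q *v z)" for y z
  have Qsym: "Q $ i $ j = Q $ j $ i" for i j
  proof -
    have "transpose Q $ j $ i = Q $ i $ j" by (simp add: transpose_def)
    then show ?thesis unfolding sym by simp
  qed
  have B_expand: "B y z = (\<Sum>i\<in>UNIV. \<Sum>j\<in>UNIV. y $ i * Q $ i $ j * z $ j)" for y z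
    by (simp add: B_def pairing_def matrix_vector_mult_def sum_distrib_left mult_ac)
  have B_sym: "B y z = B z y" for y z
  proof -
    have "y $ i * Q $ i $ j * z $ j = z $ j * Q $ j $ i * y $ i" for i j
      unfolding Qsym[of i j] by (simp only: mult_ac)
    then show ?thesis unfolding B_expand by (subst sum.swap) (simp only:)
  qed
  have B_right: "B x (y + z) = B x y + B x z" "B x (c *s y) = c * B x y" "B x (y - z) = B x y - B x z" for x y z c
    by (simp_all add: B_def matrix_vector_right_distrib vec.diff vec.scale pairing_simps)
  have B_left: "B (y + z) x = B y x + B z x" "B (c *s y) x = c * B y x" "B (y - z) x = B y x - B z x" for x y z c
    unfolding B_sym[of _ x] by (rule B_right)+
  have B_alg: "algebraic (B y z)" if "algebraic_vec y" "algebraic_vec z" for y z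
  proof -
    have "algebraic_vec (Q *v z)"
      using that(2) alg by (auto simp: algebraic_vec_def matrix_vector_mult_def intro!: algebraic_intros)
    then show ?thesis unfolding B_def by (rule algebraic_pairing[OF that(1)])
  qed
  have Q_inj: "y = 0" if "Q *v y = 0" for y
    using smooth[of y] that by (auto simp: pairing_simps)
  have "\<exists>y0. y0 \<noteq> 0 \<and> algebraic_vec y0 \<and> B y0 y0 = 0"
  proof (cases "B (axis 1 1) (axis 1 1) = 0")
    case True
    then show ?thesis by (intro exI[of _ "axis 1 1"]) (auto simp: algebraic_vec_intros)
  next
    case False
    define p where "p = B (axis 1 1) (axis 1 1)"
    define q where "q = B (axis 1 1) (axis 2 1)"
    define r where "r = B (axis 2 1) (axis 2 1)"
    define t where "t = (- q + csqrt (q * q - p * r)) / p"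
    have p0: "p \<noteq> 0" using False by (simp add: p_def)
    have "p * t + q = csqrt (q * q - p * r)" using p0 by (simp add: t_def)
    then have "(p * t + q) ^ 2 = q * q - p * r" by simp
    then have "p * (r + 2 * t * q + t * t * p) = 0" by (simp add: power2_eq_square algebra_simps)
    then have 0: "r + 2 * t * q + t * t * p = 0" using p0 by simp
    define y0 :: "complex ^ 3" where "y0 = axis 2 1 + t *s axis 1 1"
    have "B y0 y0 = r + 2 * t * q + t * t * p"
      by (simp add: y0_def B_right B_left B_sym[of "axis 2 1" "axis 1 1"] algebra_simps flip: p_def q_def r_def)
    moreover have "y0 $ 2 = 1" by (simp add: y0_def axis_def)
    then have "y0 \<noteq> 0" by auto
    moreover have "algebraic_vec y0"
      unfolding y0_def t_def p_def q_def r_def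
      by (intro algebraic_vec_intros algebraic_intros B_alg)
    ultimately show ?thesis using 0 by auto
  qed
  then obtain y0 where y0: "y0 \<noteq> 0" "algebraic_vec y0" "B y0 y0 = 0" by blast
  \<comment> \<open>Smoothness gives a nonzero gradient at \<open>y0\<close>, so some coordinate
    vector pairs nontrivially with \<open>y0\<close>.\<close>
  obtain i where i: "(Q *v y0) $ i \<noteq> 0" using Q_inj y0(1) by (auto simp: vec_eq_iff)
  define \<beta> where "\<beta> = B y0 (axis i 1)"
  have "\<beta> = B (axis i 1) y0" unfolding \<beta>_def by (rule B_sym)
  also have "\<dots> = (Q *v y0) $ i"
    unfolding B_def pairing_commute[of "axis i 1" "Q *v y0"] by (rule pairing_axis)
  finally have \<beta>0: "\<beta> \<noteq> 0" using i by simp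
  \<comment> \<open>Subtracting a suitable multiple of the isotropic \<open>y0\<close> makes the
    vector isotropic without changing its pairing with \<open>y0\<close>.\<close>
  define y2 where "y2 = axis i 1 - (B (axis i 1) (axis i 1) / (2 * \<beta>)) *s y0"
  have y2: "B y2 y2 = 0" "B y0 y2 = \<beta>" "B y2 y0 = \<beta>"
    using \<beta>0 y0(3) by (simp_all add: y2_def B_right B_left B_sym[of "axis i 1" y0] flip: \<beta>_def)
  have alg\<beta>: "algebraic \<beta>" unfolding \<beta>_def by (intro B_alg y0 algebraic_vec_intros)
  have alg2: "algebraic_vec y2"
    unfolding y2_def by (intro algebraic_vec_intros algebraic_intros B_alg y0 alg\<beta>)
  have y02: "lin_indep [y0, y2]"
    unfolding lin_indep_2
  proof (intro allI impI)
    fix a b assume 0: "a *s y0 + b *s y2 = 0"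
    have B0: "B 0 z = 0" for z using B_left(2)[of 0 0 z] by simp
    have "B (a *s y0 + b *s y2) y2 = 0" "B (a *s y0 + b *s y2) y0 = 0" unfolding 0 by (simp_all add: B0)
    then show "a = 0 \<and> b = 0" using \<beta>0 y2 y0(3) by (simp add: B_left)
  qed
  obtain k where k: "lin_indep ([y0, y2] @ [axis k 1])" using lin_indep_snoc_axis[OF y02] by auto
  define z where "z = axis k 1 - (B y2 (axis k 1) / \<beta>) *s y0 - (B y0 (axis k 1) / \<beta>) *s y2"
  have z: "B y0 z = 0" "B y2 z = 0" using \<beta>0 y0(3) y2 by (simp_all add: z_def B_right)
  have z': "B z y0 = 0" "B z y2 = 0" using z B_sym by metis+
  have algz: "algebraic_vec z"
    unfolding z_def by (intro algebraic_vec_intros algebraic_intros B_alg y0 alg2 alg\<beta>)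
  have ind: "lin_indep [y0, z, y2]"
    unfolding lin_indep_3
  proof (intro allI impI)
    fix a b c assume 0: "a *s y0 + b *s z + c *s y2 = 0"
    then have "(a - b * (B y2 (axis k 1) / \<beta>)) *s y0 + (c - b * (B y0 (axis k 1) / \<beta>)) *s y2 + b *s axis k 1 = 0"
      by (simp add: z_def vec_eq_iff algebra_simps)
    moreover have "lin_indep [y0, y2, axis k 1]" using k by simp
    ultimately have b: "b = 0" unfolding lin_indep_3 by blast
    then have "a *s y0 + c *s y2 = 0" using 0 by simp
    then show "a = 0 \<and> b = 0 \<and> c = 0" using b y02 unfolding lin_indep_2 by blast
  qed
  \<comment> \<open>Otherwise \<open>z\<close> would be orthogonal to the whole frame and lie in the
    kernel of \<open>Q\<close>.\<close>
  have zz: "B z z \<noteq> 0"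
  proof
    assume 0: "B z z = 0"
    have "pairing (Q *v z) x = 0" for x
    proof -
      obtain d where "x = lincomb d [y0, z, y2]" using lin_indep_basis[OF ind, of x] by auto
      then have "B x z = 0" using z 0 B_left(2)[of 0 0 z] by (simp add: B_left)
      then show ?thesis by (simp add: B_def pairing_commute)
    qed
    then have "z = 0" using Q_inj pairing_eq_zero by blast
    then show False using lin_indep_nonzero[OF ind, of z] by simp
  qed
  define l where "l = csqrt (- 2 * \<beta> / B z z)"
  have l: "l * l = - 2 * \<beta> / B z z" using power2_csqrt[of "- 2 * \<beta> / B z z"] by (simp add: l_def power2_eq_square)
  have l0: "l \<noteq> 0" using l \<beta>0 zz by auto
  define y1 where "y1 = l *s z"
  have y11: "B y1 y1 = - 2 * \<beta>" using zz l by (simp add: y1_def B_left B_right mult.assoc[symmetric])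
  have y1: "B y0 y1 = 0" "B y1 y0 = 0" "B y2 y1 = 0" "B y1 y2 = 0"
    using z z' by (simp_all add: y1_def B_left B_right)
  have "algebraic l" unfolding l_def by (intro algebraic_intros B_alg algz alg\<beta>)
  then have alg1: "algebraic_vec y1" unfolding y1_def by (intro algebraic_vec_intros algz)
  have "lin_indep [y0, y1, y2]"
    unfolding lin_indep_3
  proof (intro allI impI)
    fix a b c assume "a *s y0 + b *s y1 + c *s y2 = 0"
    then have "a *s y0 + (b * l) *s z + c *s y2 = 0" by (simp add: y1_def)
    then have "a = 0 \<and> b * l = 0 \<and> c = 0" using ind unfolding lin_indep_3 by blast
    then show "a = 0 \<and> b = 0 \<and> c = 0" using l0 by simp
  qed
  moreover have "B (y0 + s *s y1 + (s * s) *s y2) (y0 + s *s y1 + (s * s) *s y2) = 0" for s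
    by (simp add: B_left B_right y0(3) y1 y2 y11 algebra_simps)
  ultimately show ?thesis using that y0(2) alg1 alg2 y2(1) unfolding B_def by blast
qed

lemma algebraic_tens:
  assumes "algebraic_vec t" "algebraic_vec \<xi>" "algebraic_vec \<eta>"
  shows "algebraic (tens t \<xi> \<eta>)"
  unfolding tens_def using assms by (auto simp: algebraic_vec_def pairing_def intro!: algebraic_intros)

lemma algebraic_mv:
  "(\<And>i j. algebraic (M $ i $ j)) \<Longrightarrow> algebraic_vec x \<Longrightarrow> algebraic_vec (M *v x)"
  by (auto simp: algebraic_vec_def matrix_vector_mult_def intro!: algebraic_intros)

text \<open>In this frame the conic is \<open>s \<mapsto> wedge (a + s c) (b + s d)\<close>, and
  \<open>x0\<close>, \<open>x1\<close>, \<open>x2\<close> are the coefficients of its expansion in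
  \<open>s\<close>. The last clause holds since a linear form vanishing on the conic is a quadratic
  polynomial in \<open>s\<close> that is identically zero.\<close>

lemma conic_normal_form:
  fixes M :: "complex ^ 7 ^ (5 \<times> 5)"
  assumes M: "transversal_section M" and M_alg: "\<And>i j. algebraic (M $ i $ j)"
    and C: "smooth_conic C" "C \<subseteq> {x. M *v x \<in> grassmannian25}"
  obtains a b c d e x0 x1 x2 where
    "algebraic_vec a" "algebraic_vec b" "algebraic_vec c" "algebraic_vec d" "algebraic_vec e"
    "lin_indep [a, b, c, d, e]"
    "M *v x0 = wedge a b" "M *v x1 = wedge a d - wedge b c" "M *v x2 = wedge c d"
    "\<And>h. (\<And>x. x \<in> C \<Longrightarrow> pairing h x = 0) \<Longrightarrow> pairing h x0 = 0 \<and> pairing h x1 = 0 \<and> pairing h x2 = 0"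
proof -
  obtain N :: "complex ^ 3 ^ 7" and Q :: "complex ^ 3 ^ 3" where
    N: "\<And>i j. algebraic (N $ i $ j)" "inj ((*v) N)" and
    Q: "\<And>i j. algebraic (Q $ i $ j)" "transpose Q = Q"
      "\<And>y. y \<noteq> 0 \<Longrightarrow> pairing y (Q *v y) = 0 \<Longrightarrow> Q *v y \<noteq> 0" and
    C_eq: "C = {N *v y | y. y \<noteq> 0 \<and> pairing y (Q *v y) = 0}"
    using C(1) unfolding smooth_conic_def pairing_def by blast
  obtain y0 y1 y2 where y: "algebraic_vec y0" "algebraic_vec y1" "algebraic_vec y2" "lin_indep [y0, y1, y2]"
    "pairing y2 (Q *v y2) = 0"
    "\<And>s. pairing (y0 + s *s y1 + (s * s) *s y2) (Q *v (y0 + s *s y1 + (s * s) *s y2)) = 0"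
    using conic_frame[OF Q] by blast
  have inj: "inj ((*v) M)" and alt: "range ((*v) M) \<subseteq> alternating_tensors"
    using M by (auto simp: transversal_section_def)
  define x0 where "x0 = N *v y0"
  define x1 where "x1 = N *v y1"
  define x2 where "x2 = N *v y2"
  define S where "S = M *v x0"
  define T where "T = M *v x1"
  define U where "U = M *v x2"
  have alg: "algebraic_vec S" "algebraic_vec T" "algebraic_vec U"
    unfolding S_def T_def U_def x0_def x1_def x2_def by (intro algebraic_mv M_alg N(1) y)+
  have ind: "lin_indep [S, T, U]"
    using lin_indep_map_mv[OF inj lin_indep_map_mv[OF N(2) y(4)]]
    by (simp add: S_def T_def U_def x0_def x1_def x2_def)
  have ind': "x = 0 \<and> z = 0 \<and> w = 0" if "x *s S + z *s T + w *s U = 0" for x z w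
    using ind that unfolding lin_indep_3 by blast
  have yC: "N *v (y0 + s *s y1 + (s * s) *s y2) \<in> C" for s
  proof -
    have "y0 + s *s y1 + (s * s) *s y2 \<noteq> 0"
    proof
      assume "y0 + s *s y1 + (s * s) *s y2 = 0"
      then have "1 *s y0 + s *s y1 + (s * s) *s y2 = 0" by simp
      then have "(1::complex) = 0" using y(4) unfolding lin_indep_3 by blast
      then show False by simp
    qed
    then show ?thesis unfolding C_eq using y(6) by blast
  qed
  have "y2 \<noteq> 0" using lin_indep_nonzero[OF y(4)] by simp
  then have y2C: "N *v y2 \<in> C" unfolding C_eq using y(5) by blast
  have Nx: "N *v (y0 + s *s y1 + (s * s) *s y2) = x0 + s *s x1 + (s * s) *s x2" for s
    by (simp add: x0_def x1_def x2_def matrix_vector_right_distrib vec.scale)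
  have h: "pairing h x0 = 0 \<and> pairing h x1 = 0 \<and> pairing h x2 = 0" if h: "\<And>x. x \<in> C \<Longrightarrow> pairing h x = 0" for h
  proof -
    have e: "pairing h x0 + s * pairing h x1 + s * s * pairing h x2 = 0" for s
      using h[OF yC[of s]] unfolding Nx by (simp add: pairing_simps)
    have "pairing h x2 = 0" using h[OF y2C] by (simp add: x2_def)
    moreover have "pairing h x0 = 0" using e[of 0] by simp
    ultimately show ?thesis using e[of 1] by simp
  qed
  have dec: "pluecker t x1 x2 x3 x4 = 0" if "t \<in> grassmannian25" for t x1 x2 x3 x4
    using that by (auto simp: grassmannian25_def pluecker_wedge)
  have curve: "pluecker (S + s *s T + (s * s) *s U) v1 v2 v3 v4 = 0" for s v1 v2 v3 v4
  proof -
    have "M *v (x0 + s *s x1 + (s * s) *s x2) \<in> grassmannian25" using yC[of s] C(2) unfolding Nx by blast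
    then show ?thesis
      by (intro dec) (simp add: S_def T_def U_def matrix_vector_right_distrib vec.scale)
  qed
  have PU: "pluecker U v1 v2 v3 v4 = 0" for v1 v2 v3 v4
    using y2C C(2) by (intro dec) (auto simp: U_def x2_def)
  have PS: "pluecker S v1 v2 v3 v4 = 0" for v1 v2 v3 v4 using curve[of 0] by simp
  \<comment> \<open>Along the curve a Pluecker relation is a polynomial of degree four in
    \<open>s\<close> whose outer coefficients are the relations for \<open>S\<close> and
    \<open>U\<close>. The values at \<open>1\<close>, \<open>-1\<close> and \<open>2\<close>
    separate the other three.\<close>
  have coeffs: "pluecker_polar S T v1 v2 v3 v4 = 0 \<and> pluecker_polar T U v1 v2 v3 v4 = 0 \<and>
      pluecker T v1 v2 v3 v4 + pluecker_polar S U v1 v2 v3 v4 = 0" for v1 v2 v3 v4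
  proof -
    define p where "p = pluecker_polar S T v1 v2 v3 v4"
    define q where "q = pluecker T v1 v2 v3 v4 + pluecker_polar S U v1 v2 v3 v4"
    define r where "r = pluecker_polar T U v1 v2 v3 v4"
    have e: "s * p + s ^ 2 * q + s ^ 3 * r = 0" for s
      using curve[of s v1 v2 v3 v4] unfolding pluecker_conic PS PU p_def q_def r_def by simp
    have 1: "p + q + r = 0" using e[of 1] by simp
    have 2: "- p + q - r = 0" using e[of "-1"] by simp
    have 3: "2 * p + 4 * q + 8 * r = 0" using e[of 2] by simp
    have "q + q = (p + q + r) + (- p + q - r)" by simp
    then have "q = 0" unfolding 1 2 by simp
    then have "p = - r" using 1 by (simp add: eq_neg_iff_add_eq_0)
    then have "r = 0" using 3 \<open>q = 0\<close> by simp
    then show ?thesis using \<open>p = - r\<close> \<open>q = 0\<close> unfolding p_def q_def r_def by simp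
  qed
  have polar_sym: "pluecker_polar U T v1 v2 v3 v4 = pluecker_polar T U v1 v2 v3 v4" for v1 v2 v3 v4
    by (simp add: pluecker_polar_def)
  have "S \<noteq> 0" "U \<noteq> 0" using ind'[of 1 0 0] ind'[of 0 0 1] by auto
  have alg_dec: "\<exists>v w. t = wedge v w \<and> algebraic_vec v \<and> algebraic_vec w"
    if t: "t \<noteq> 0" "\<And>v1 v2 v3 v4. pluecker t v1 v2 v3 v4 = 0" "algebraic_vec t" for t
  proof -
    obtain i j where ij: "t = wedge (\<chi> k. t $ (i, k)) (\<chi> k. t $ (j, k) / t $ (i, j))"
      using pluecker_imp_decomposable[OF t(1,2)] by blast
    moreover have "algebraic_vec (\<chi> k. t $ (i, k))" "algebraic_vec (\<chi> k. t $ (j, k) / t $ (i, j))"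
      using t(3) by (auto simp: algebraic_vec_def intro!: algebraic_intros)
    ultimately show ?thesis by blast
  qed
  obtain a b where ab: "S = wedge a b" "algebraic_vec a" "algebraic_vec b"
    using alg_dec[OF \<open>S \<noteq> 0\<close> PS alg(1)] by blast
  obtain c d where cd: "U = wedge c d" "algebraic_vec c" "algebraic_vec d"
    using alg_dec[OF \<open>U \<noteq> 0\<close> PU alg(3)] by blast
  obtain \<theta> :: "3 \<Rightarrow> complex ^ (5 \<times> 5)" where
    \<theta>: "\<And>t. t \<in> alternating_tensors \<Longrightarrow> t \<in> range ((*v) M) \<longleftrightarrow> (\<forall>i. pairing (\<theta> i) t = 0)"
    "net (\<lambda>c v w. \<Sum>i\<in>UNIV. c $ i * pairing (\<theta> i) (wedge v w))"
    using transversal_section_net[OF M] by blast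
  have \<theta>0: "pairing (\<theta> i) (M *v x) = 0" for i x using \<theta>(1)[of "M *v x"] alt by blast
  have abcd: "lin_indep [a, b, c, d]"
  proof (rule conic_lines_disjoint[OF \<theta>(2), where T = T])
    show "lin_indep [wedge a b, T, wedge c d]" using ind unfolding ab(1) cd(1) .
    show "pairing (\<theta> i) (wedge a b) = 0" "pairing (\<theta> i) T = 0" "pairing (\<theta> i) (wedge c d) = 0" for i
      using \<theta>0 unfolding ab(1)[symmetric] cd(1)[symmetric] S_def T_def U_def by blast+
    show "pluecker_polar (wedge a b) T v1 v2 v3 v4 = 0" "pluecker_polar (wedge c d) T v1 v2 v3 v4 = 0"
      "pluecker T v1 v2 v3 v4 + pluecker_polar (wedge a b) (wedge c d) v1 v2 v3 v4 = 0" for v1 v2 v3 v4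
      using coeffs polar_sym unfolding ab(1)[symmetric] cd(1)[symmetric] by simp_all
  qed
  obtain k where k: "lin_indep ([a, b, c, d] @ [axis k 1])"
    using lin_indep_snoc_axis[OF abcd] by auto
  define e :: "complex ^ 5" where "e = axis k 1"
  have alge: "algebraic_vec e" by (simp add: e_def algebraic_vec_intros)
  have vs: "lin_indep [a, b, c, d, e]" using k by (simp add: e_def)
  have "\<exists>f. algebraic_vec f \<and> (\<forall>j<5. pairing f ([a, b, c, d, e] ! j) = (if j = m then 1 else 0))" if "m < 5" for m
  proof -
    have m: "m < length [a, b, c, d, e]" using that by simp
    have alg: "algebraic_vec v" if "v \<in> set [a, b, c, d, e]" for v
      using that ab cd alge by auto
    show ?thesis
    proof (rule algebraic_dual[OF vs m alg])
      fix f assume f: "algebraic_vec f"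
        "\<And>j. j < length [a, b, c, d, e] \<Longrightarrow> pairing f ([a, b, c, d, e] ! j) = (if j = m then 1 else 0)"
      show "\<exists>f. algebraic_vec f \<and> (\<forall>j<5. pairing f ([a, b, c, d, e] ! j) = (if j = m then 1 else 0))"
        by (rule exI[of _ f]) (use f in simp)
    qed
  qed
  then have "\<forall>m. \<exists>f. m < 5 \<longrightarrow> algebraic_vec f \<and> (\<forall>j<5. pairing f ([a, b, c, d, e] ! j) = (if j = m then 1 else 0))"
    by blast
  from choice[OF this] obtain f where f_alg: "\<And>m. m < 5 \<Longrightarrow> algebraic_vec (f m)" and
    f': "\<And>m j. m < 5 \<Longrightarrow> j < 5 \<Longrightarrow> pairing (f m) ([a, b, c, d, e] ! j) = (if j = m then 1 else 0)"
    by blast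
  have f: "pairing (f m) a = (if m = 0 then 1 else 0)" "pairing (f m) b = (if m = 1 then 1 else 0)"
    "pairing (f m) c = (if m = 2 then 1 else 0)" "pairing (f m) d = (if m = 3 then 1 else 0)" if "m < 5" for m
    using f'[OF that, of 0] f'[OF that, of 1] f'[OF that, of 2] f'[OF that, of 3] by simp_all
  have f_ind: "lin_indep [f 0, f 1, f 2, f 3, f 4]"
    unfolding lin_indep_def
  proof (intro allI impI)
    fix g i assume g: "lincomb g [f 0, f 1, f 2, f 3, f 4] = 0" and i: "i < length [f 0, f 1, f 2, f 3, f 4]"
    have "pairing (lincomb g [f 0, f 1, f 2, f 3, f 4]) ([a, b, c, d, e] ! i) = 0"
      unfolding g by (simp add: pairing_def)
    moreover have "i = 0 \<or> i = 1 \<or> i = 2 \<or> i = 3 \<or> i = 4" using i by auto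
    ultimately show "g i = 0"
      using f'[of 0 i] f'[of 1 i] f'[of 2 i] f'[of 3 i] f'[of 4 i]
      by (elim disjE) (simp_all add: pairing_add_left pairing_scale_left numeral_2_eq_2 numeral_3_eq_3
          eval_nat_numeral)
  qed
  \<comment> \<open>Coordinates of \<open>T\<close> between the span of \<open>a\<close>,
    \<open>b\<close> and the span of \<open>c\<close>, \<open>d\<close>. Being polar to
    \<open>S\<close> and \<open>U\<close>, the tensor \<open>T\<close> has no others.\<close>
  define p where "p = tens T (f 0) (f 2)"
  define q where "q = tens T (f 0) (f 3)"
  define r where "r = tens T (f 1) (f 2)"
  define s where "s = tens T (f 1) (f 3)"
  have pqrs: "algebraic p" "algebraic q" "algebraic r" "algebraic s"
    unfolding p_def q_def r_def s_def by (intro algebraic_tens alg f_alg; simp)+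
  have PST: "pluecker_polar (wedge a b) T v1 v2 v3 v4 = 0" and PTU: "pluecker_polar T (wedge c d) v1 v2 v3 v4 = 0"
    and det0: "pluecker T v1 v2 v3 v4 + pluecker_polar (wedge a b) (wedge c d) v1 v2 v3 v4 = 0" for v1 v2 v3 v4
    using coeffs unfolding ab(1)[symmetric] cd(1)[symmetric] by blast+
  have T1: "tens T (f 2) (f 3) = 0" "tens T (f 2) (f 4) = 0" "tens T (f 3) (f 4) = 0"
    using PST[of "f 0" "f 1" "f 2" "f 3"] PST[of "f 0" "f 1" "f 2" "f 4"] PST[of "f 0" "f 1" "f 3" "f 4"]
    by (simp_all add: pluecker_polar_def tens_wedge f)
  have T2: "tens T (f 0) (f 1) = 0" "tens T (f 0) (f 4) = 0" "tens T (f 1) (f 4) = 0"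
    using PTU[of "f 0" "f 1" "f 2" "f 3"] PTU[of "f 0" "f 4" "f 2" "f 3"] PTU[of "f 1" "f 4" "f 2" "f 3"]
    by (simp_all add: pluecker_polar_def tens_wedge f)
  \<comment> \<open>The middle coefficient of the Pluecker relations normalizes the determinant of
    these coordinates.\<close>
  have "- (p * s) + q * r + 1 = 0"
    using det0[of "f 0" "f 1" "f 2" "f 3"]
    by (simp add: pluecker_def pluecker_polar_def tens_wedge f T1 T2 p_def q_def r_def s_def)
  then have det: "p * s - q * r = 1" by (simp add: algebra_simps eq_neg_iff_add_eq_0 flip: eq_diff_eq)
  have T_alt: "T \<in> alternating_tensors" using alt by (auto simp: T_def)
  have T_diag: "tens T \<xi> \<xi> = 0" for \<xi>
  proof -
    have "x = 0" if "x = - x" for x :: complex using that by simp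
    then show ?thesis using tens_skew[OF T_alt, of \<xi> \<xi>] .
  qed
  define V where "V = wedge a (p *s c + q *s d) + wedge b (r *s c + s *s d)"
  have V_alt: "tens V \<eta> \<xi> = - tens V \<xi> \<eta>" for \<xi> \<eta>
    by (simp add: V_def tens_add tens_wedge algebra_simps)
  have E: "tens T (f 0) (f 1) = tens V (f 0) (f 1)" "tens T (f 0) (f 2) = tens V (f 0) (f 2)" "tens T (f 0) (f 3) = tens V (f 0) (f 3)" "tens T (f 0) (f 4) = tens V (f 0) (f 4)" "tens T (f 1) (f 2) = tens V (f 1) (f 2)" "tens T (f 1) (f 3) = tens V (f 1) (f 3)" "tens T (f 1) (f 4) = tens V (f 1) (f 4)" "tens T (f 2) (f 3) = tens V (f 2) (f 3)" "tens T (f 2) (f 4) = tens V (f 2) (f 4)" "tens T (f 3) (f 4) = tens V (f 3) (f 4)"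
    by (simp_all add: V_def tens_add tens_wedge pairing_simps f T1 T2 del: One_nat_def flip: p_def q_def r_def s_def)
  have E': "tens T \<eta> \<xi> = tens V \<eta> \<xi>" if "tens T \<xi> \<eta> = tens V \<xi> \<eta>" for \<xi> \<eta>
    using that tens_skew[OF T_alt, of \<eta> \<xi>] V_alt[of \<eta> \<xi>] by simp
  have D: "tens T \<xi> \<xi> = tens V \<xi> \<xi>" for \<xi>
    by (simp add: T_diag) (simp add: V_def tens_add tens_wedge)
  have "T = V"
  proof (rule tens_eqI[OF f_ind])
    fix \<xi> \<eta> assume "\<xi> \<in> set [f 0, f 1, f 2, f 3, f 4]" "\<eta> \<in> set [f 0, f 1, f 2, f 3, f 4]"
    then have "\<xi> = f 0 \<or> \<xi> = f 1 \<or> \<xi> = f 2 \<or> \<xi> = f 3 \<or> \<xi> = f 4"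
      "\<eta> = f 0 \<or> \<eta> = f 1 \<or> \<eta> = f 2 \<or> \<eta> = f 3 \<or> \<eta> = f 4" by simp_all
    then show "tens T \<xi> \<eta> = tens V \<xi> \<eta>"
      by (elim disjE) (simp_all only: D E E[THEN E'])
  qed simp
  then have T_eq: "T = wedge a (p *s c + q *s d) + wedge b (r *s c + s *s d)" unfolding V_def .
  \<comment> \<open>A change of basis of determinant \<open>1\<close> in the span of
    \<open>c\<close>, \<open>d\<close>; it preserves \<open>U\<close> and brings \<open>T\<close> to
    normal form.\<close>
  define c' where "c' = (- r) *s c + (- s) *s d"
  define d' where "d' = p *s c + q *s d"
  have "wedge c' d' = (p * s - q * r) *s wedge c d"
    by (simp add: c'_def d'_def wedge_def vec_eq_iff algebra_simps)
  then have U': "U = wedge c' d'" using det cd(1) by simp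
  have "- wedge b c' = wedge b (r *s c + s *s d)"
    by (simp add: c'_def wedge_def vec_eq_iff algebra_simps)
  then have T': "T = wedge a d' - wedge b c'" unfolding T_eq d'_def by simp
  have ind5: "lin_indep [a, b, c', d', e]"
    unfolding lin_indep_def
  proof (intro allI impI)
    fix g i assume g: "lincomb g [a, b, c', d', e] = 0" and i: "i < length [a, b, c', d', e]"
    define g' where "g' = (!) [g 0, g 1, g 3 * p - g 2 * r, g 3 * q - g 2 * s, g 4]"
    have "lincomb g' [a, b, c, d, e] = lincomb g [a, b, c', d', e]"
      by (simp add: g'_def c'_def d'_def vec_eq_iff eval_nat_numeral algebra_simps)
    then have 0: "g' j = 0" if "j < 5" for j
      using lin_indepD[OF vs, of g' j] g that by simp
    have 1: "g 0 = 0" "g 1 = 0" "g 4 = 0" "g 3 * p = g 2 * r" "g 3 * q = g 2 * s"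
      using 0[of 0] 0[of 1] 0[of 2] 0[of 3] 0[of 4] by (simp_all add: g'_def)
    have "g 2 = g 2 * (p * s - q * r)" using det by simp
    also have "\<dots> = p * (g 2 * s) - q * (g 2 * r)" by (simp add: algebra_simps)
    also have "\<dots> = 0" unfolding 1(4,5)[symmetric] by simp
    finally have g2: "g 2 = 0" .
    have "g 3 = g 3 * (p * s - q * r)" using det by simp
    also have "\<dots> = s * (g 3 * p) - r * (g 3 * q)" by (simp add: algebra_simps)
    also have "\<dots> = 0" unfolding 1(4,5) g2 by simp
    finally have "g 3 = 0" .
    moreover have "i = 0 \<or> i = 1 \<or> i = 2 \<or> i = 3 \<or> i = 4" using i by auto
    ultimately show "g i = 0" using 1 g2 by auto
  qed
  have "algebraic_vec c'" "algebraic_vec d'"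
    unfolding c'_def d'_def by (intro algebraic_vec_intros cd pqrs algebraic_minus)+
  then show ?thesis
    using that[of a b c' d' e x0 x1 x2] ab alge ind5 U' T' h unfolding S_def T_def U_def by blast
qed

subsection \<open>Forms and reduction\<close>

lemma poly_eval_superset:
  assumes "finite S" "Poly_Mapping.keys f \<subseteq> S"
  shows "poly_eval f x = (\<Sum>m\<in>S. Poly_Mapping.lookup f m * (\<Prod>i\<in>UNIV. (x $ i) ^ Poly_Mapping.lookup m i))"
  unfolding poly_eval_def
  by (rule sum.mono_neutral_left) (use assms in \<open>auto simp: in_keys_iff\<close>)

lemma poly_eval_add: "poly_eval (f + g) x = poly_eval f x + poly_eval g x"
proof -
  define S where "S = Poly_Mapping.keys f \<union> Poly_Mapping.keys g"
  have S: "finite S" "Poly_Mapping.keys f \<subseteq> S" "Poly_Mapping.keys g \<subseteq> S" "Poly_Mapping.keys (f + g) \<subseteq> S"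
    unfolding S_def using keys_add[of f g] by auto
  show ?thesis
    unfolding poly_eval_superset[OF S(1,2)] poly_eval_superset[OF S(1,3)] poly_eval_superset[OF S(1,4)]
    by (simp add: lookup_add sum.distrib distrib_right)
qed

lemma poly_eval_zero: "poly_eval 0 x = 0"
  by (simp add: poly_eval_def)

lemma poly_eval_sum: "poly_eval (\<Sum>i\<in>I. f i) x = (\<Sum>i\<in>I. poly_eval (f i) x)"
  by (induction I rule: infinite_finite_induct) (simp_all add: poly_eval_zero poly_eval_add)

lemma poly_eval_single:
  "poly_eval (Poly_Mapping.single m c) x = c * (\<Prod>i\<in>UNIV. (x $ i) ^ Poly_Mapping.lookup m i)"
  by (subst poly_eval_superset[of "{m}"]) auto

lemma prod_power_single: "(\<Prod>i\<in>UNIV. (x $ i) ^ Poly_Mapping.lookup (Poly_Mapping.single a 1) i) = (x $ a :: complex)"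
proof -
  have "(x $ i) ^ Poly_Mapping.lookup (Poly_Mapping.single a 1) i = (if i = a then x $ i else 1)" for i
    by (simp add: lookup_single when_def)
  then show ?thesis by simp
qed

text \<open>The one form to be tested in \<open>reduces_into\<close>: a product of two linear forms
  vanishes on the union of their hyperplane sections.\<close>

definition product_form :: "complex ^ 'n::finite \<Rightarrow> complex ^ 'n \<Rightarrow> ('n \<Rightarrow>\<^sub>0 nat) \<Rightarrow>\<^sub>0 complex" where
  "product_form h k = (\<Sum>i\<in>UNIV. \<Sum>j\<in>UNIV.
     Poly_Mapping.single (Poly_Mapping.single i 1 + Poly_Mapping.single j 1) (h $ i * k $ j))"

lemma poly_eval_product_form: "poly_eval (product_form h k) x = pairing h x * pairing k x"
  by (simp add: product_form_def poly_eval_sum poly_eval_single lookup_add power_add prod.distrib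
      prod_power_single[unfolded One_nat_def] pairing_def sum_product mult_ac)

lemma product_form_in_forms_over:
  assumes R: "ring_set R" and "\<And>i. h $ i \<in> R" "\<And>i. k $ i \<in> R"
  shows "product_form h k \<in> forms_over R"
  unfolding forms_over_def mem_Collect_eq
proof (intro conjI allI exI[of _ 2] ballI)
  fix m
  show "Poly_Mapping.lookup (product_form h k) m \<in> R"
    unfolding product_form_def lookup_sum lookup_single when_def
    using assms ring_setD(1)[OF R] ring_setD(4)[OF R] by (intro ring_setD(10)[OF R]) auto
next
  fix m assume m: "m \<in> Poly_Mapping.keys (product_form h k)"
  have "Poly_Mapping.lookup (product_form h k) m \<noteq> 0" using m by (simp add: in_keys_iff)
  then obtain i where "(\<Sum>j\<in>UNIV. Poly_Mapping.lookup (Poly_Mapping.single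
      (Poly_Mapping.single i 1 + Poly_Mapping.single j 1) (h $ i * k $ j)) m) \<noteq> 0"
    unfolding product_form_def lookup_sum by (meson sum.neutral)
  then obtain j where "Poly_Mapping.lookup (Poly_Mapping.single
      (Poly_Mapping.single i 1 + Poly_Mapping.single j 1) (h $ i * k $ j)) m \<noteq> 0"
    by (meson sum.neutral)
  then have "m = Poly_Mapping.single i 1 + Poly_Mapping.single j 1"
    by (auto simp: lookup_single when_def split: if_splits)
  then show "(\<Sum>i\<in>UNIV. Poly_Mapping.lookup m i) = 2"
    by (simp add: lookup_add lookup_single sum.distrib when_def)
qed

lemma forms_over_homogeneous:
  assumes "f \<in> forms_over R"
  obtains d where "\<And>c x. poly_eval f (c *s x) = c ^ d * poly_eval f x"
proof -
  obtain d where d: "\<And>m. m \<in> Poly_Mapping.keys f \<Longrightarrow> (\<Sum>i\<in>UNIV. Poly_Mapping.lookup m i) = d"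
    using assms by (auto simp: forms_over_def)
  have "poly_eval f (c *s x) = c ^ d * poly_eval f x" for c x
    unfolding poly_eval_def sum_distrib_left
  proof (rule sum.cong)
    fix m assume m: "m \<in> Poly_Mapping.keys f"
    have "(\<Prod>i\<in>UNIV. ((c *s x) $ i) ^ Poly_Mapping.lookup m i) =
        c ^ (\<Sum>i\<in>UNIV. Poly_Mapping.lookup m i) * (\<Prod>i\<in>UNIV. (x $ i) ^ Poly_Mapping.lookup m i)"
      by (simp add: power_mult_distrib prod.distrib power_sum)
    then show "Poly_Mapping.lookup f m * (\<Prod>i\<in>UNIV. ((c *s x) $ i) ^ Poly_Mapping.lookup m i) =
        c ^ d * (Poly_Mapping.lookup f m * (\<Prod>i\<in>UNIV. (x $ i) ^ Poly_Mapping.lookup m i))"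
      unfolding d[OF m] by (simp only: mult_ac)
  qed simp
  then show ?thesis by (rule that)
qed

lemma polyfun_poly_eval: "(\<And>i. polyfun (\<lambda>t. x t $ i)) \<Longrightarrow> polyfun (\<lambda>t. poly_eval f (x t))"
  unfolding poly_eval_def by (intro polyfun_intros)

lemma ring_set_pairing:
  "ring_set R \<Longrightarrow> (\<And>i. h $ i \<in> R) \<Longrightarrow> (\<And>i. x $ i \<in> R) \<Longrightarrow> pairing h x \<in> R"
  unfolding pairing_def by (intro ring_setD(10) ring_setD(4)) auto

text \<open>Where both linear forms take unit values at the integral vector \<open>x\<close>, the
  product form can reduce to zero at the normalized vector \<open>c *s x\<close> only if
  \<open>c\<close> is in the maximal ideal. Then all coordinates of \<open>c *s x\<close> are,
  contrary to normalization.\<close>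

lemma not_reduces_into:
  assumes p: "p \<in> finite_places L"
    and h: "\<And>i. h $ i \<in> place_ring L p" "\<And>i. k $ i \<in> place_ring L p"
    and unit: "pairing h x \<noteq> 0" "inverse (pairing h x) \<in> place_ring L p"
      "pairing k x \<noteq> 0" "inverse (pairing k x) \<in> place_ring L p"
    and x: "\<And>i. x $ i \<in> place_ring L p"
    and D: "\<And>z. z \<in> D \<Longrightarrow> pairing h z = 0 \<or> pairing k z = 0"
  shows "\<not> reduces_into L p D x"
proof
  note R = ring_set_place_ring(1)[OF p]
  assume "reduces_into L p D x"
  then obtain c where c: "\<And>i. (c *s x) $ i \<in> place_ring L p" "\<exists>i. (c *s x) $ i \<notin> place_ideal L p"
    and f: "\<And>f. f \<in> forms_over (place_ring L p) \<Longrightarrow> (\<And>z. z \<in> D \<Longrightarrow> poly_eval f z = 0) \<Longrightarrow>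
        poly_eval f (c *s x) \<in> place_ideal L p"
    unfolding reduces_into_def by blast
  have "poly_eval (product_form h k) (c *s x) \<in> place_ideal L p"
    by (rule f[OF product_form_in_forms_over[OF R h]]) (use D in \<open>auto simp: poly_eval_product_form\<close>)
  moreover have "pairing h (c *s x) \<in> place_ring L p" "pairing k (c *s x) \<in> place_ring L p"
    using c(1) h by (auto intro!: ring_set_pairing[OF R])
  ultimately have "pairing h (c *s x) \<in> place_ideal L p \<or> pairing k (c *s x) \<in> place_ideal L p"
    unfolding poly_eval_product_form by (intro place_idealD(3)[OF p])
  then have "c \<in> place_ideal L p"
  proof
    assume "pairing h (c *s x) \<in> place_ideal L p"
    moreover have "pairing h (c *s x) * inverse (pairing h x) = c"
      unfolding pairing_simps mult.assoc using unit(1) by simp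
    ultimately show ?thesis using place_idealD(2)[OF p _ unit(2)] by metis
  next
    assume "pairing k (c *s x) \<in> place_ideal L p"
    moreover have "pairing k (c *s x) * inverse (pairing k x) = c"
      unfolding pairing_simps mult.assoc using unit(3) by simp
    ultimately show ?thesis using place_idealD(2)[OF p _ unit(4)] by metis
  qed
  then have "(c *s x) $ i \<in> place_ideal L p" for i
    using place_idealD(2)[OF p _ x[of i]] by simp
  then show False using c(2) by blast
qed


subsection \<open>Polynomial curves of isotropic planes\<close>

text \<open>Lets a curve built from one end of a segment be run through from the other end.\<close>

lemma polyfun_reflect: "polyfun f \<Longrightarrow> polyfun (\<lambda>t. f (1 - t))"
proof -
  assume "polyfun f"
  then obtain p where "f = poly p" by (auto simp: polyfun_def)
  then have "(\<lambda>t. f (1 - t)) = poly (pcompose p [:1, -1:])" by (simp add: poly_pcompose fun_eq_iff)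
  then show ?thesis unfolding polyfun_def by (rule exI)
qed

context net
begin

text \<open>The forms at \<open>v\<close> give three independent functionals with a 2-dimensional
  common kernel, so exactly one line of the section passes through a regular point.\<close>

definition regular :: "complex ^ 5 \<Rightarrow> bool" where
  "regular v \<longleftrightarrow> (\<forall>c. (\<forall>z. \<omega> c v z = 0) \<longrightarrow> c = 0)"

lemma sum3: "\<omega> c v (\<Sum>i\<in>I. g i) = (\<Sum>i\<in>I. \<omega> c v (g i))"
  by (induction I rule: infinite_finite_induct) (simp_all add: om_simps)

lemma sum1: "\<omega> (\<Sum>i\<in>I. g i) v w = (\<Sum>i\<in>I. \<omega> (g i) v w)"
  by (induction I rule: infinite_finite_induct) (simp_all add: om_simps)

lemma axis3: "\<omega> c v z = (\<Sum>j\<in>UNIV. z $ j * \<omega> c v (axis j 1))"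
  by (subst axis_expansion[of z]) (simp add: sum3 scale3)

lemma axis1: "\<omega> c v z = (\<Sum>i\<in>UNIV. c $ i * \<omega> (axis i 1) v z)"
  by (subst axis_expansion[of c]) (simp add: sum1 scale1)

text \<open>By regularity the rows of the 3 by 5 matrix of functionals at \<open>v\<close> are
  independent; the columns of a right inverse are the desired vectors.\<close>

lemma regular_dual:
  assumes "regular v"
  obtains f :: "3 \<Rightarrow> complex ^ 5" where "\<And>i j. \<omega> (axis i 1) v (f j) = (if i = j then 1 else 0)"
proof -
  define A :: "complex ^ 5 ^ 3" where "A = (\<chi> i j. \<omega> (axis i 1) v (axis j 1))"
  have "\<forall>c. sum (\<lambda>i. c i *s row i A) UNIV = 0 \<longrightarrow> (\<forall>i. c i = 0)"
  proof (intro allI impI)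
    fix c and i :: 3 assume c: "sum (\<lambda>i. c i *s row i A) UNIV = 0"
    have "\<omega> (\<chi> i. c i) v (axis j 1) = 0" for j
      using arg_cong[OF c, of "\<lambda>x. x $ j"] by (subst axis1) (simp add: row_def A_def)
    then have "\<omega> (\<chi> i. c i) v z = 0" for z by (subst axis3) simp
    then have "(\<chi> i. c i) = (0 :: complex ^ 3)" using assms unfolding regular_def by blast
    then show "c i = 0" by (simp add: vec_eq_iff)
  qed
  then obtain B where B: "A ** B = mat 1"
    using matrix_right_invertible_independent_rows[of A] by blast
  have "\<omega> (axis i 1) v (column j B) = (A ** B) $ i $ j" for i j
    by (subst axis3) (simp add: column_def matrix_matrix_mult_def A_def mult.commute)
  then show ?thesis using that[of "\<lambda>j. column j B"] by (simp add: B mat_def)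
qed

text \<open>As the point moves from the regular \<open>v0\<close> towards \<open>v1\<close>,
  Cramer's rule corrects \<open>w0\<close> within the span of the \<open>f k\<close>. Multiplication
  by the determinant \<open>D\<close> makes the result polynomial; it generates the line of the
  section through the moving point wherever \<open>D\<close> is nonzero.\<close>

lemma rational_section:
  assumes reg: "regular v0" and iso: "\<And>c. \<omega> c v0 w0 = 0"
  obtains D W where "polyfun D" "\<And>i. polyfun (\<lambda>t. W t $ i)" "D 0 \<noteq> 0" "W 0 = D 0 *s w0"
    "\<And>t c. D t \<noteq> 0 \<Longrightarrow> \<omega> c (v0 + t *s (v1 - v0)) (W t) = 0"
    "\<And>t. D t \<noteq> 0 \<Longrightarrow> regular (v0 + t *s (v1 - v0))"
proof -
  obtain f :: "3 \<Rightarrow> complex ^ 5" where f: "\<And>i j. \<omega> (axis i 1) v0 (f j) = (if i = j then 1 else 0)"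
    using regular_dual[OF reg] by blast
  define v where "v t = v0 + t *s (v1 - v0)" for t
  define A where "A t = (\<chi> i j. \<omega> (axis i 1) (v t) (f j))" for t
  define r where "r t = (\<chi> i. \<omega> (axis i 1) (v t) w0)" for t
  define D where "D t = det (A t)" for t
  define x where "x k t = det (\<chi> i j. if j = k then r t $ i else A t $ i $ j)" for k t
  define W where "W t = D t *s w0 - (\<Sum>k\<in>UNIV. x k t *s f k)" for t
  have pv: "polyfun (\<lambda>t. \<omega> c (v t) z)" for c z
    unfolding v_def add2 scale2 by (intro polyfun_intros)
  have pA: "polyfun (\<lambda>t. A t $ i $ j)" "polyfun (\<lambda>t. r t $ i)" for i j
    unfolding A_def r_def by (simp_all add: pv)
  have pD: "polyfun D" unfolding D_def using pA by (intro polyfun_det)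
  have px: "polyfun (x k)" for k
    unfolding x_def
  proof (rule polyfun_det)
    fix i j show "polyfun (\<lambda>t. (\<chi> i j. if j = k then r t $ i else A t $ i $ j) $ i $ j)"
      using pA by (cases "j = k") simp_all
  qed
  have pW: "polyfun (\<lambda>t. W t $ i)" for i
    unfolding W_def by (simp add: sum_component) (intro polyfun_intros pD px)
  have "A 0 = mat 1" by (simp add: A_def v_def f mat_def vec_eq_iff)
  then have D0: "D 0 = 1" by (simp add: D_def)
  have solve: "(\<Sum>k\<in>UNIV. A t $ i $ k * x k t) = D t * r t $ i" if "D t \<noteq> 0" for t i
  proof -
    have "A t *v (\<chi> k. x k t / D t) = r t"
      using cramer[of "A t" "\<chi> k. x k t / D t" "r t"] that by (simp add: D_def x_def)
    from arg_cong[OF this, of "\<lambda>y. D t * y $ i"] show ?thesis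
      using that by (simp add: matrix_vector_mult_def sum_distrib_left)
  qed
  have W_axis: "\<omega> (axis i 1) (v t) (W t) = D t * r t $ i - (\<Sum>k\<in>UNIV. A t $ i $ k * x k t)" for i t
    by (simp add: W_def om_simps sum3 r_def A_def mult.commute)
  have W0: "\<omega> c (v t) (W t) = 0" if "D t \<noteq> 0" for t c
    by (subst axis1) (simp add: W_axis solve[OF that])
  have "r 0 = 0" using iso by (simp add: r_def v_def vec_eq_iff)
  then have "A 0 *v 0 = r 0" by simp
  then have "(0 :: complex ^ 3) = (\<chi> k. x k 0 / D 0)"
    using cramer[of "A 0" 0 "r 0"] D0 by (simp add: D_def x_def)
  then have "x k 0 = 0" for k using D0 by (simp add: vec_eq_iff)
  then have "W 0 = D 0 *s w0" by (simp add: W_def)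
  moreover have "regular (v t)" if "D t \<noteq> 0" for t
    unfolding regular_def
  proof (intro allI impI)
    fix c assume c: "\<forall>z. \<omega> c (v t) z = 0"
    have "(transpose (A t) *v c) $ j = \<omega> c (v t) (f j)" for j
      by (subst axis1) (simp add: matrix_vector_mult_def transpose_def A_def mult.commute)
    then have c0: "transpose (A t) *v c = 0" using c by (simp add: vec_eq_iff)
    have z0: "transpose (A t) *v 0 = 0" by simp
    have d0: "det (transpose (A t)) \<noteq> 0" using that by (simp add: D_def)
    show "c = 0"
      by (rule trans[OF iffD1[OF cramer[OF d0] c0] iffD1[OF cramer[OF d0] z0, symmetric]])
  qed
  ultimately show ?thesis
    using that[OF pD pW _ _ W0[unfolded v_def]] D0 unfolding v_def by simp
qed

text \<open>A third independent vector \<open>w'\<close> would leave only two conditions, from the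
  rest of a basis, on the forms killing \<open>v\<close>; the net has three parameters.\<close>

lemma regular_kernel:
  assumes reg: "regular v" and ind: "lin_indep [v, w]" and w: "\<And>c. \<omega> c v w = 0" "\<And>c. \<omega> c v w' = 0"
  obtains x y where "w' = x *s v + y *s w"
proof (rule ccontr)
  assume no: "\<not> thesis"
  have "lin_indep [v, w, w']"
    unfolding lin_indep_3
  proof (intro allI impI)
    fix a b c assume 0: "a *s v + b *s w + c *s w' = 0"
    have "c = 0"
    proof (rule ccontr)
      assume "c \<noteq> 0"
      have "c *s w' = - (a *s v + b *s w)" using 0 by (metis add.commute eq_neg_iff_add_eq_0)
      then have "(1 / c) *s (c *s w') = (1 / c) *s (- (a *s v + b *s w))" by simp
      then have "w' = (- a / c) *s v + (- b / c) *s w"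
        using \<open>c \<noteq> 0\<close> by (simp add: vec_eq_iff algebra_simps add_divide_distrib)
      then show False using no that by blast
    qed
    moreover from this have "a *s v + b *s w = 0" using 0 by simp
    ultimately show "a = 0 \<and> b = 0 \<and> c = 0" using ind unfolding lin_indep_2 by blast
  qed
  then obtain ys where ys: "lin_indep ([v, w, w'] @ ys)" "length ([v, w, w'] @ ys) = CARD(5)"
    using lin_indep_extend by blast
  then obtain g1 g2 where g: "ys = [g1, g2]" by (auto simp: length_Suc_conv numeral_2_eq_2)
  obtain es :: "(complex ^ 3) list" where es: "lin_indep es" "length es = CARD(3)" by (rule axis_basis)
  obtain x where x: "\<exists>i\<in>{..<3}. x i \<noteq> 0"
    "\<And>j. j \<in> {0::nat, 1} \<Longrightarrow> (\<Sum>i\<in>{..<3}. x i * \<omega> (es ! i) v (ys ! j)) = 0"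
    using homogeneous_system_solution[of "{0::nat, 1}" "{..<3::nat}" "\<lambda>j i. \<omega> (es ! i) v (ys ! j)"] by auto
  define c where "c = lincomb x es"
  have c0: "c \<noteq> 0" using x(1) lin_indep_lincomb_ne_0[OF es(1)] es(2) by (auto simp: c_def)
  have "\<omega> c v z = 0" for z
  proof (rule zero_on_basis[OF ys(1)])
    fix k assume "k \<in> set ([v, w, w'] @ ys)"
    then consider "k = v" | "k = w" | "k = w'" | "k = g1" | "k = g2" using g by auto
    then show "\<omega> c v k = 0"
      by cases (use w x(2)[of 0] x(2)[of 1] es(2) g in \<open>simp_all add: alt c_def lincomb1\<close>)
  qed (use ys(2) in simp)
  then show False using reg c0 unfolding regular_def by blast
qed

end

subsection \<open>The birational parametrization\<close>

text \<open>By \<open>t_vec4\<close> below, the hypotheses are the equations of the section for the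
  bivector of \<open>y\<close> and \<open>u\<close>, so no line of the section inside
  \<open>P\<close> passes through a point off the quadric. The identities eliminate to
  \<open>quadric y *s u = n *s y\<close>.\<close>

lemma pencil_kernel:
  fixes y u :: "complex ^ 4"
  assumes q: "quadric y \<noteq> 0" and 1: "y $ 1 * u $ 3 - y $ 3 * u $ 1 = 0" and 2: "y $ 2 * u $ 4 - y $ 4 * u $ 2 = 0"
    and 3: "y $ 1 * u $ 4 - y $ 4 * u $ 1 + (y $ 2 * u $ 3 - y $ 3 * u $ 2) = 0"
  obtains k where "u = k *s y"
proof -
  define n where "n = u $ 1 * y $ 4 - u $ 3 * y $ 2"
  have "quadric y * u $ 1 - n * y $ 1 = y $ 2 * (y $ 1 * u $ 3 - y $ 3 * u $ 1)"
    "quadric y * u $ 2 - n * y $ 2 = y $ 2 * (y $ 1 * u $ 4 - y $ 4 * u $ 1 + (y $ 2 * u $ 3 - y $ 3 * u $ 2))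
      - y $ 1 * (y $ 2 * u $ 4 - y $ 4 * u $ 2)"
    "quadric y * u $ 3 - n * y $ 3 = y $ 4 * (y $ 1 * u $ 3 - y $ 3 * u $ 1)"
    "quadric y * u $ 4 - n * y $ 4 = y $ 4 * (y $ 1 * u $ 4 - y $ 4 * u $ 1 + (y $ 2 * u $ 3 - y $ 3 * u $ 2))
      - y $ 3 * (y $ 2 * u $ 4 - y $ 4 * u $ 2)"
    unfolding quadric_def n_def by (simp_all add: algebra_simps)
  then have "quadric y * u $ 1 = n * y $ 1" "quadric y * u $ 2 = n * y $ 2"
    "quadric y * u $ 3 = n * y $ 3" "quadric y * u $ 4 = n * y $ 4"
    unfolding 1 2 3 by simp_all
  then have "u $ i = (n / quadric y) * y $ i" for i
    using exhaust_4[of i] q by (elim disjE) (simp_all add: field_simps)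
  then have "u = (n / quadric y) *s y" by (simp add: vec_eq_iff)
  then show ?thesis by (rule that)
qed

lemma polyfun_pairing: "(\<And>i. polyfun (\<lambda>t. x t $ i)) \<Longrightarrow> polyfun (\<lambda>t. pairing h (x t))"
  unfolding pairing_def by (intro polyfun_intros)

lemma polyfun_wedge:
  "(\<And>i. polyfun (\<lambda>t. v t $ i)) \<Longrightarrow> (\<And>i. polyfun (\<lambda>t. w t $ i)) \<Longrightarrow> polyfun (\<lambda>t. wedge (v t) (w t) $ p)"
  unfolding wedge_def by simp (intro polyfun_intros)

lemma polyfun_mv: "(\<And>i. polyfun (\<lambda>t. x t $ i)) \<Longrightarrow> polyfun (\<lambda>t. (M *v x t) $ i)"
  unfolding matrix_vector_mult_def by simp (intro polyfun_intros)

lemma polyfun_quadric: "(\<And>i. polyfun (\<lambda>t. y t $ i)) \<Longrightarrow> polyfun (\<lambda>t. quadric (y t))"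
  unfolding quadric_def by (intro polyfun_intros)

text \<open>The factor \<open>1/2\<close> compensates that each pair of indices occurs in both
  orders.\<close>

lemma alternating_eq_sum_wedge:
  assumes "t \<in> alternating_tensors"
  shows "t = (\<Sum>i\<in>UNIV. \<Sum>j\<in>UNIV. (t $ (i, j) / 2) *s wedge (axis i 1) (axis j 1))"
proof -
  have "(\<Sum>i\<in>UNIV. \<Sum>j\<in>UNIV. (t $ (i, j) / 2) *s wedge (axis i 1) (axis j 1)) $ (k, l) = t $ (k, l)" for k l
  proof -
    have "(\<Sum>i\<in>UNIV. \<Sum>j\<in>UNIV. (t $ (i, j) / 2) *s wedge (axis i 1) (axis j 1)) $ (k, l) =
        (\<Sum>i\<in>UNIV. axis k 1 $ i * (\<Sum>j\<in>UNIV. axis l 1 $ j * (t $ (i, j) / 2))) -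
        (\<Sum>i\<in>UNIV. axis l 1 $ i * (\<Sum>j\<in>UNIV. axis k 1 $ j * (t $ (i, j) / 2)))"
      unfolding sum_subtractf[symmetric] sum_distrib_left sum_component
      by (intro sum.cong refl) (simp add: wedge_def axis_def)
    also have "\<dots> = t $ (k, l) / 2 - t $ (l, k) / 2" unfolding sum_axis ..
    also have "\<dots> = t $ (k, l)" using alternatingD[OF assms, of l k] by (simp only:) simp
    finally show ?thesis .
  qed
  then show ?thesis by (simp add: vec_eq_iff)
qed

text \<open>The tensors \<open>wedge a c\<close>, \<open>wedge b d\<close>, \<open>wedge a d\<close>
  complement the image of \<open>M\<close> among the alternating ones. \<open>L\<close> projects
  along them and inverts \<open>M\<close>; \<open>t1\<close>, \<open>t2\<close>, \<open>t3\<close>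
  are the complementary coordinates, that is, equations of the section.\<close>

locale section_frame = net \<omega> for \<omega> +
  fixes M :: "complex ^ 7 ^ (5 \<times> 5)" and L :: "complex ^ (5 \<times> 5) ^ 7"
    and a b c d e :: "complex ^ 5" and t1 t2 t3 :: "complex ^ (5 \<times> 5)" and x0 x1 x2 :: "complex ^ 7"
  assumes basis: "lin_indep [a, b, c, d, e]"
    and in_section_iff: "wedge v w \<in> range ((*v) M) \<longleftrightarrow> (\<forall>k. \<omega> k v w = 0)"
    and ad_bc: "\<omega> k a d = \<omega> k b c"
    and LM: "L *v (M *v x) = x"
    and tM: "pairing t1 (M *v x) = 0" "pairing t2 (M *v x) = 0" "pairing t3 (M *v x) = 0"
    and section_inv: "pairing t1 (wedge v w) = 0 \<Longrightarrow> pairing t2 (wedge v w) = 0 \<Longrightarrow> pairing t3 (wedge v w) = 0 \<Longrightarrow>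
       M *v (L *v wedge v w) = wedge v w"
    and M_x: "M *v x0 = wedge a b" "M *v x1 = wedge a d - wedge b c" "M *v x2 = wedge c d"
    and t_dual: "pairing t1 (wedge a c) = 1" "pairing t1 (wedge b d) = 0" "pairing t1 (wedge a d) = 0"
      "pairing t2 (wedge a c) = 0" "pairing t2 (wedge b d) = 1" "pairing t2 (wedge a d) = 0"
      "pairing t3 (wedge a c) = 0" "pairing t3 (wedge b d) = 0" "pairing t3 (wedge a d) = 1"
    and L_dual: "L *v wedge a c = 0" "L *v wedge b d = 0" "L *v wedge a d = 0"
begin

definition vec4 :: "complex ^ 4 \<Rightarrow> complex ^ 5" where
  "vec4 y = y $ 1 *s a + y $ 2 *s b + y $ 3 *s c + y $ 4 *s d"

lemma vec4_linear:
  "vec4 (y + z) = vec4 y + vec4 z" "vec4 (k *s y) = k *s vec4 y" "vec4 (y - z) = vec4 y - vec4 z"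
  by (simp_all add: vec4_def vec_eq_iff algebra_simps)

lemma wedge_vec4:
  "wedge (vec4 y) (vec4 z) = (y $ 1 * z $ 2 - y $ 2 * z $ 1) *s wedge a b + (y $ 1 * z $ 3 - y $ 3 * z $ 1) *s wedge a c
    + (y $ 1 * z $ 4 - y $ 4 * z $ 1) *s wedge a d + (y $ 2 * z $ 3 - y $ 3 * z $ 2) *s wedge b c
    + (y $ 2 * z $ 4 - y $ 4 * z $ 2) *s wedge b d + (y $ 3 * z $ 4 - y $ 4 * z $ 3) *s wedge c d"
  by (simp add: vec4_def wedge_def vec_eq_iff algebra_simps)

lemma wedge_vec4_e:
  "wedge (vec4 y) e = y $ 1 *s wedge a e + y $ 2 *s wedge b e + y $ 3 *s wedge c e + y $ 4 *s wedge d e"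
  by (simp add: vec4_def wedge_simps)

lemma t_section:
  "pairing t1 (wedge a b) = 0" "pairing t1 (wedge c d) = 0" "pairing t1 (wedge b c) = 0"
  "pairing t2 (wedge a b) = 0" "pairing t2 (wedge c d) = 0" "pairing t2 (wedge b c) = 0"
  "pairing t3 (wedge a b) = 0" "pairing t3 (wedge c d) = 0" "pairing t3 (wedge b c) = 1"
  using tM[of x0] tM[of x1] tM[of x2] t_dual unfolding M_x by (simp_all add: pairing_simps)

lemma t_vec4:
  "pairing t1 (wedge (vec4 y) (vec4 z)) = y $ 1 * z $ 3 - y $ 3 * z $ 1"
  "pairing t2 (wedge (vec4 y) (vec4 z)) = y $ 2 * z $ 4 - y $ 4 * z $ 2"
  "pairing t3 (wedge (vec4 y) (vec4 z)) = y $ 1 * z $ 4 - y $ 4 * z $ 1 + (y $ 2 * z $ 3 - y $ 3 * z $ 2)"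
  by (simp_all add: wedge_vec4 pairing_simps t_dual t_section)

text \<open>Solves for \<open>u\<close> such that \<open>wedge (vec4 y) (e + vec4 u)\<close> is in
  the section, three equations that determine \<open>u\<close> up to multiples of \<open>y\<close>.
  The entries come from the identities in \<open>pencil_kernel\<close> with right hand sides given
  by \<open>e\<close> and with \<open>n = 0\<close>, after multiplication by
  \<open>quadric y\<close>.\<close>

definition lift :: "complex ^ 4 \<Rightarrow> complex ^ 4" where
  "lift y = (\<chi> i.
     if i = 1 then y $ 2 * - pairing t1 (wedge (vec4 y) e)
     else if i = 2 then y $ 2 * - pairing t3 (wedge (vec4 y) e) - y $ 1 * - pairing t2 (wedge (vec4 y) e)
     else if i = 3 then y $ 4 * - pairing t1 (wedge (vec4 y) e)
     else y $ 4 * - pairing t3 (wedge (vec4 y) e) - y $ 3 * - pairing t2 (wedge (vec4 y) e))"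

text \<open>The line through \<open>vec4 y\<close> in the linear section, with denominators cleared.\<close>

definition point :: "complex ^ 4 \<Rightarrow> complex ^ (5 \<times> 5)" where
  "point y = wedge (vec4 y) (quadric y *s e + vec4 (lift y))"

lemma t_lift:
  "pairing t1 (wedge (vec4 y) (vec4 (lift y))) = - (quadric y * pairing t1 (wedge (vec4 y) e))"
  "pairing t2 (wedge (vec4 y) (vec4 (lift y))) = - (quadric y * pairing t2 (wedge (vec4 y) e))"
  "pairing t3 (wedge (vec4 y) (vec4 (lift y))) = - (quadric y * pairing t3 (wedge (vec4 y) e))"
  unfolding t_vec4 by (simp_all add: lift_def quadric_def algebra_simps)

lemma t_point: "pairing t1 (point y) = 0" "pairing t2 (point y) = 0" "pairing t3 (point y) = 0"
  by (simp_all add: point_def wedge_simps pairing_simps t_lift)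

lemma M_point: "M *v (L *v point y) = point y"
  using t_point section_inv unfolding point_def by blast

lemma lift_scale: "lift (k *s y) = (k * k) *s lift y"
  by (simp add: lift_def vec4_linear wedge_simps pairing_simps vec_eq_iff algebra_simps)

lemma point_scale: "point (k *s y) = k ^ 3 *s point y"
  by (simp add: point_def lift_scale quadric_scale vec4_linear wedge_simps vec_eq_iff power2_eq_square power3_eq_cube algebra_simps)

text \<open>Every bivector of \<open>P\<close> goes under \<open>L\<close> into the span of
  \<open>x0\<close>, \<open>x1\<close>, \<open>x2\<close>: the complementary tensors are killed, and
  \<open>wedge b c\<close> is \<open>wedge a d\<close> minus the image of \<open>x1\<close>.\<close>

lemma pairing_L_vec4:
  assumes "pairing h x0 = 0" "pairing h x1 = 0" "pairing h x2 = 0"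
  shows "pairing h (L *v wedge (vec4 y) (vec4 z)) = 0"
proof -
  have "- (L *v wedge b c) = x1" using LM[of x1] L_dual unfolding M_x by (simp add: vec.diff)
  then have bc: "L *v wedge b c = - x1" by (metis minus_minus)
  have L: "L *v wedge a b = x0" "L *v wedge c d = x2" "L *v wedge b c = - x1"
    using LM[of x0] LM[of x2] bc unfolding M_x by simp_all
  show ?thesis
    unfolding wedge_vec4 vec.add vec.scale L L_dual pairing_simps assms
    by (simp add: pairing_simps assms)
qed

definition param :: "complex ^ 7 \<Rightarrow> complex ^ 4" where
  "param h = (\<chi> i. pairing h (L *v wedge (vec4 (axis i 1)) e))"

lemma pairing_param: "pairing h (L *v wedge (vec4 y) e) = pairing (param h) y"
proof -
  have v: "vec4 (axis 1 1) = a" "vec4 (axis 2 1) = b" "vec4 (axis 3 1) = c" "vec4 (axis 4 1) = d"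
    by (simp_all add: vec4_def axis_def)
  show ?thesis
    unfolding param_def pairing_def[of "vec_lambda _"] sum_4 vec_lambda_beta v
    unfolding wedge_vec4_e vec.add vec.scale pairing_simps
    by (simp only: mult.commute)
qed

text \<open>Bivectors inside \<open>P\<close> contribute nothing, so only the multiple of
  \<open>wedge (vec4 y) e\<close> remains, and its factor is \<open>quadric y\<close>.\<close>

lemma pairing_L_point:
  assumes "pairing h x0 = 0" "pairing h x1 = 0" "pairing h x2 = 0"
  shows "pairing h (L *v point y) = quadric y * pairing (param h) y"
  unfolding point_def wedge_simps vec.add vec.scale pairing_simps pairing_L_vec4[OF assms] pairing_param
  by simp

lemma vec4_exhaust:
  obtains y k where "x = vec4 y + k *s e"
proof -
  obtain g where g: "x = lincomb g [a, b, c, d, e]" using lin_indep_basis[OF basis, of x] by auto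
  define y :: "complex ^ 4" where "y = (\<chi> i. g (if i = 1 then 0 else if i = 2 then 1 else if i = 3 then 2 else 3))"
  have "x = vec4 y + g 4 *s e"
    unfolding g by (simp add: vec4_def y_def eval_nat_numeral add.assoc)
  then show ?thesis by (rule that)
qed

text \<open>Bivectors of \<open>P\<close> are annihilated because of the conic and those with a
  factor \<open>e\<close> because \<open>param h = 0\<close>. Together they span all alternating
  tensors, which \<open>L\<close> maps onto the 7-space.\<close>

lemma param_eq_0:
  assumes h: "pairing h x0 = 0" "pairing h x1 = 0" "pairing h x2 = 0" and 0: "param h = 0"
    and M: "\<And>x. M *v x \<in> alternating_tensors"
  shows "h = 0"
proof (rule pairing_eq_zero)
  fix x
  have "pairing h (L *v wedge v w) = 0" for v w
  proof -
    obtain y k where v: "v = vec4 y + k *s e" by (rule vec4_exhaust)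
    obtain z l where w: "w = vec4 z + l *s e" by (rule vec4_exhaust)
    have "wedge v w = wedge (vec4 y) (vec4 z) + l *s wedge (vec4 y) e - k *s wedge (vec4 z) e"
      unfolding v w by (simp add: wedge_def vec_eq_iff algebra_simps)
    then show ?thesis
      unfolding pairing_param by (simp add: vec.add vec.diff vec.scale pairing_simps pairing_L_vec4[OF h] pairing_param 0) (simp add: pairing_def)
  qed
  note z = this
  have "pairing h (L *v (M *v x)) = 0"
  proof -
    have "pairing h (L *v (\<Sum>i\<in>I. g i)) = (\<Sum>i\<in>I. pairing h (L *v g i))" for I and g :: "5 \<Rightarrow> _"
      by (induction I rule: infinite_finite_induct) (simp_all add: vec.add pairing_simps)
    then show ?thesis
      by (subst alternating_eq_sum_wedge[OF M]) (simp add: vec.scale pairing_simps z)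
  qed
  then show "pairing h x = 0" unfolding LM .
qed

lemma polyfun_point:
  assumes "\<And>i. polyfun (\<lambda>t. y t $ i)"
  shows "polyfun (\<lambda>t. point (y t) $ p)"
proof -
  have v: "polyfun (\<lambda>t. vec4 (z t) $ i)" if "\<And>i. polyfun (\<lambda>t. z t $ i)" for z i
    unfolding vec4_def by simp (intro polyfun_intros that)
  have w: "polyfun (\<lambda>t. pairing h (wedge (vec4 (y t)) e))" for h
    by (intro polyfun_pairing polyfun_wedge v assms polyfun_const)
  have l: "polyfun (\<lambda>t. lift (y t) $ i)" for i
    using exhaust_4[of i] by (elim disjE) (simp_all add: lift_def, (intro polyfun_intros w assms)+)
  show ?thesis
    unfolding point_def
  proof (rule polyfun_wedge)
    show "polyfun (\<lambda>t. vec4 (y t) $ i)" for i by (intro v assms)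
    show "polyfun (\<lambda>t. (quadric (y t) *s e + vec4 (lift (y t))) $ i)" for i
      by simp (intro polyfun_intros polyfun_quadric v l assms)
  qed
qed

text \<open>The line meets \<open>P\<close> in \<open>vec4 y\<close> for
  \<open>y = s' p - s r\<close>. After scaling, \<open>p\<close> and \<open>lift y\<close> solve the
  same equations of the section over \<open>y\<close>, so by \<open>pencil_kernel\<close> their
  difference \<open>u\<close> is a multiple of \<open>y\<close>.\<close>

lemma wedge_eq_point:
  assumes v: "v = vec4 p + s *s e" "s \<noteq> 0" and w: "w = vec4 r + s' *s e"
    and t: "pairing t1 (wedge v w) = 0" "pairing t2 (wedge v w) = 0" "pairing t3 (wedge v w) = 0"
    and q: "quadric (s' *s p - s *s r) \<noteq> 0"
  shows "wedge v w = inverse (quadric (s' *s p - s *s r)) *s point (s' *s p - s *s r)"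
proof -
  define y where "y = s' *s p - s *s r"
  have "vec4 y = s' *s v - s *s w"
    unfolding y_def v w vec4_linear by (simp add: vec_eq_iff algebra_simps)
  then have yv: "wedge (vec4 y) v = s *s wedge v w"
    by (simp only:) (simp add: wedge_def vec_eq_iff algebra_simps)
  have yv': "wedge (vec4 y) v = wedge (vec4 y) (vec4 p) + s *s wedge (vec4 y) e"
    unfolding v wedge_simps ..
  have tp: "pairing h (wedge (vec4 y) (vec4 p)) = - (s * pairing h (wedge (vec4 y) e))"
    if "pairing h (wedge v w) = 0" for h
  proof -
    have "pairing h (wedge (vec4 y) v) = 0" unfolding yv pairing_simps that by simp
    then show ?thesis unfolding yv' pairing_simps by (simp add: add_eq_0_iff)
  qed
  define u where "u = quadric y *s p - s *s lift y"
  have "pairing h (wedge (vec4 y) (vec4 u)) = 0"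
    if "pairing h (wedge v w) = 0"
      "pairing h (wedge (vec4 y) (vec4 (lift y))) = - (quadric y * pairing h (wedge (vec4 y) e))" for h
  proof -
    have "wedge (vec4 y) (vec4 u) = quadric y *s wedge (vec4 y) (vec4 p) - s *s wedge (vec4 y) (vec4 (lift y))"
      unfolding u_def vec4_linear by (simp add: wedge_def vec_eq_iff algebra_simps)
    then show ?thesis using tp[OF that(1)] that(2) by (simp add: pairing_simps)
  qed
  from this[OF t(1) t_lift(1)] this[OF t(2) t_lift(2)] this[OF t(3) t_lift(3)]
  obtain k where "u = k *s y"
    using pencil_kernel[of y u] q unfolding t_vec4 y_def[symmetric] by blast
  then have "wedge (vec4 y) (vec4 u) = 0" by (simp add: vec4_linear wedge_simps)
  moreover have "wedge (vec4 y) (vec4 u) = quadric y *s wedge (vec4 y) (vec4 p) - s *s wedge (vec4 y) (vec4 (lift y))"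
    unfolding u_def vec4_linear by (simp add: wedge_def vec_eq_iff algebra_simps)
  ultimately have qp: "quadric y *s wedge (vec4 y) (vec4 p) = s *s wedge (vec4 y) (vec4 (lift y))" by simp
  have "(quadric y * s) *s wedge v w = quadric y *s wedge (vec4 y) v" unfolding yv by simp
  also have "\<dots> = s *s point y"
    unfolding yv' vector_add_ldistrib qp point_def wedge_simps by (simp add: vec_eq_iff algebra_simps)
  finally have eq: "(quadric y * s) *s wedge v w = s *s point y" .
  have "(inverse (quadric y) * inverse s) *s ((quadric y * s) *s wedge v w) =
      (inverse (quadric y) * inverse s) *s (s *s point y)" unfolding eq ..
  moreover have "inverse (quadric y) * inverse s * (quadric y * s) = 1"
    "inverse (quadric y) * inverse s * s = inverse (quadric y)"
    using q v(2) unfolding y_def[symmetric] by (simp_all add: field_simps)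
  ultimately show ?thesis unfolding y_def[symmetric] vector_smult_assoc by (simp only: vector_smult_lid)
qed

text \<open>This point of \<open>P\<close> has coordinates \<open>(1, 0, 0, 1)\<close> and lies off
  the quadric. A form killing it would, by the relations from \<open>x0\<close>, \<open>x1\<close>,
  \<open>x2\<close>, vanish on all of \<open>P\<close>.\<close>

lemma regular_ad: "regular (a + d)"
  unfolding regular_def
proof (intro allI impI)
  fix k assume 0: "\<forall>z. \<omega> k (a + d) z = 0"
  have "\<omega> k a b = 0" "\<omega> k c d = 0"
    using in_section_iff[of a b] in_section_iff[of c d] M_x(1,3) by (metis rangeI)+
  then have dc: "\<omega> k d c = 0" "\<omega> k a b = 0" using skew[of k d c] by simp_all
  have ac: "\<omega> k a c = 0" using 0[rule_format, of c] dc by (simp add: om_simps)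
  have db: "\<omega> k d b = 0" using 0[rule_format, of b] dc by (simp add: om_simps)
  have ad: "\<omega> k a d = 0" using 0[rule_format, of d] by (simp add: om_simps)
  have bc: "\<omega> k b c = 0" using ad ad_bc by simp
  have sym: "\<omega> k y x = 0" if "\<omega> k x y = 0" for x y using that skew[of k y x] by simp
  have ind: "lin_indep [a, b, c, d]"
  proof (rule lin_indep_mono[OF basis])
    show "distinct [a, b, c, d]" using basis unfolding lin_indep_iff by simp
  qed auto
  show "k = 0"
  proof (rule no_isotropic4[OF ind])
    fix x y assume "x \<in> set [a, b, c, d]" "y \<in> set [a, b, c, d]"
    moreover have "\<forall>x\<in>set [a, b, c, d]. \<forall>y\<in>set [a, b, c, d]. \<omega> k x y = 0"
      by (simp add: alt dc ac db ad bc dc[THEN sym] ac[THEN sym] db[THEN sym] ad[THEN sym] bc[THEN sym])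
    ultimately show "\<omega> k x y = 0" by blast
  qed simp
qed

text \<open>A line of the section meeting \<open>P\<close> in a single point off the quadric is some
  \<open>point y\<close> up to scale. Any other line is the start of a polynomial curve of lines of
  the section that are general in this sense; \<open>F\<close> vanishes at all but finitely many
  parameters, hence at the start.\<close>

lemma vanishes_on_section:
  fixes F :: "complex ^ 7 \<Rightarrow> complex"
  assumes poly: "\<And>x. (\<And>i. polyfun (\<lambda>t. x t $ i)) \<Longrightarrow> polyfun (\<lambda>t. F (x t))"
    and homog: "\<And>k x. F (k *s x) = k ^ n * F x"
    and zero: "\<And>y. F (L *v point y) = 0"
    and iso: "\<And>k. \<omega> k v w = 0" and ne: "wedge v w \<noteq> 0"
  shows "F (L *v wedge v w) = 0"
proof -
  have "\<exists>f. \<forall>j<5. pairing f ([a, b, c, d, e] ! j) = (if j = m then 1 else 0)" if "m < 5" for m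
  proof -
    have m: "m < length [a, b, c, d, e]" using that by simp
    show ?thesis
    proof (rule dual_functional[OF basis m])
      fix f assume f: "\<And>j. j < length [a, b, c, d, e] \<Longrightarrow> pairing f ([a, b, c, d, e] ! j) = (if j = m then 1 else 0)"
      show "\<exists>f. \<forall>j<5. pairing f ([a, b, c, d, e] ! j) = (if j = m then 1 else 0)"
        by (rule exI[of _ f]) (use f in simp)
    qed
  qed
  then have "\<forall>m. \<exists>f. m < 5 \<longrightarrow> (\<forall>j<5. pairing f ([a, b, c, d, e] ! j) = (if j = m then 1 else 0))" by blast
  from choice[OF this] obtain f where
    f': "\<And>m j. m < 5 \<Longrightarrow> j < 5 \<Longrightarrow> pairing (f m) ([a, b, c, d, e] ! j) = (if j = m then 1 else 0)" by blast
  have f: "pairing (f m) a = (if m = 0 then 1 else 0)" "pairing (f m) b = (if m = 1 then 1 else 0)"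
    "pairing (f m) c = (if m = 2 then 1 else 0)" "pairing (f m) d = (if m = 3 then 1 else 0)"
    "pairing (f m) e = (if m = 4 then 1 else 0)" if "m < 5" for m
    using f'[OF that, of 0] f'[OF that, of 1] f'[OF that, of 2] f'[OF that, of 3] f'[OF that, of 4] by simp_all
  define P :: "complex ^ 5 \<Rightarrow> complex ^ 4" where
    "P v = (\<chi> i. pairing (f (if i = 1 then 0 else if i = 2 then 1 else if i = 3 then 2 else 3)) v)" for v
  define s where "s v = pairing (f 4) v" for v
  have P_lin: "P (x + y) = P x + P y" "P (k *s x) = k *s P x" for x y k
    by (simp_all add: P_def vec_eq_iff pairing_simps)
  have s_lin: "s (x + y) = s x + s y" "s (k *s x) = k * s x" for x y k
    by (simp_all add: s_def pairing_simps)
  have s_vec: "s (vec4 y + k *s e) = k" and P_vec: "P (vec4 y + k *s e) = y" for y k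
    by (simp_all add: s_def P_def vec4_def pairing_simps f vec_eq_iff forall_4)
  have dec: "x = vec4 (P x) + s x *s e" for x
  proof -
    obtain y k where "x = vec4 y + k *s e" by (rule vec4_exhaust)
    then show ?thesis using s_vec P_vec by metis
  qed
  have F0: "F (k *s x) = 0" if "F x = 0" for k x using that by (simp add: homog)
  have good1: "F (L *v wedge v w) = 0" if iso: "\<And>k. \<omega> k v w = 0"
      and q: "quadric (s w *s P v - s v *s P w) \<noteq> 0" and s0: "s v \<noteq> 0" for v w
  proof -
    obtain x where "wedge v w = M *v x" using in_section_iff[of v w] iso by blast
    then have "pairing t1 (wedge v w) = 0" "pairing t2 (wedge v w) = 0" "pairing t3 (wedge v w) = 0"
      using tM by simp_all
    from wedge_eq_point[OF dec s0 dec this q] show ?thesis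
      by (simp only: vec.scale F0[OF zero])
  qed
  have good: "F (L *v wedge v w) = 0" if iso: "\<And>k. \<omega> k v w = 0"
      and q: "quadric (s w *s P v - s v *s P w) \<noteq> 0" for v w
  proof (cases "s v = 0")
    case False
    then show ?thesis using good1 iso q by blast
  next
    case True
    have "s w \<noteq> 0"
    proof
      assume "s w = 0"
      then show False using True q by (simp add: quadric_def)
    qed
    moreover have "s v *s P w - s w *s P v = (-1) *s (s w *s P v - s v *s P w)" by (simp add: vec_eq_iff)
    then have "quadric (s v *s P w - s w *s P v) \<noteq> 0" using q by (simp only: quadric_scale) simp
    moreover have "\<omega> k w v = 0" for k using iso skew[of k w v] by simp
    ultimately have "F (L *v wedge w v) = 0" using good1 by blast
    moreover have "L *v wedge v w = (-1) *s (L *v wedge w v)"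
      unfolding wedge_swap[of v w] by (simp add: vec.neg vec_eq_iff)
    ultimately show ?thesis by (simp only: F0)
  qed
  obtain x y where xy: "x \<noteq> 0 \<or> y \<noteq> 0" "regular (x *s v + y *s w)"
    using exists_regular_vector[of v w] iso ne wedge_eq_0_iff unfolding regular_def by metis
  define v0 where "v0 = x *s v + y *s w"
  have "lin_indep [v, w]" using ne wedge_eq_0_iff by blast
  then have "v0 \<noteq> 0" using xy(1) unfolding v0_def lin_indep_2 by blast
  then obtain w0 where w0: "wedge v w = wedge v0 w0" by (rule wedge_rebase[OF v0_def])
  have iso0: "\<omega> k v0 w0 = 0" for k
    using in_section_iff[of v w] in_section_iff[of v0 w0] iso unfolding w0 by blast
  \<comment> \<open>The end of the curve: the regular point \<open>a + d\<close> of
    \<open>P\<close>, where the quadric is \<open>1\<close>.\<close>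
  define y1 :: "complex ^ 4" where "y1 = axis 1 1 + axis 4 1"
  define w1 where "w1 = quadric y1 *s e + vec4 (lift y1)"
  have q1: "quadric y1 = 1" by (simp add: y1_def quadric_def axis_def)
  have y1v: "vec4 y1 = a + d" by (simp add: y1_def vec4_def axis_def)
  have iso1: "\<omega> k (a + d) w1 = 0" for k
    using in_section_iff[of "a + d" w1] M_point[of y1] unfolding point_def y1v w1_def by (metis rangeI)
  \<comment> \<open>Two families of lines over the same segment of points \<open>V t\<close>:
    \<open>W\<close> is controlled at \<open>t = 0\<close>, where the given line must be reached,
    and \<open>U\<close> at \<open>t = 1\<close>, where the quadric is known to be nonzero. The
    determinant of each may vanish at the opposite end, but for general \<open>t\<close> both
    describe the unique line through the regular point \<open>V t\<close>.\<close>
  obtain D W where DW: "polyfun D" "\<And>i. polyfun (\<lambda>t. W t $ i)" "D 0 \<noteq> 0" "W 0 = D 0 *s w0"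
    "\<And>t k. D t \<noteq> 0 \<Longrightarrow> \<omega> k (v0 + t *s ((a + d) - v0)) (W t) = 0"
    "\<And>t. D t \<noteq> 0 \<Longrightarrow> regular (v0 + t *s ((a + d) - v0))"
    by (rule rational_section[OF xy(2)[folded v0_def] iso0, of "a + d"]) blast
  obtain D' W' where DW': "polyfun D'" "\<And>i. polyfun (\<lambda>t. W' t $ i)" "D' 0 \<noteq> 0" "W' 0 = D' 0 *s w1"
    "\<And>t k. D' t \<noteq> 0 \<Longrightarrow> \<omega> k ((a + d) + t *s (v0 - (a + d))) (W' t) = 0"
    by (rule rational_section[OF regular_ad iso1, of v0]) blast
  define V where "V t = v0 + t *s ((a + d) - v0)" for t
  define U where "U t = W' (1 - t)" for t
  have V': "(a + d) + (1 - t) *s (v0 - (a + d)) = V t" for t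
    by (simp add: V_def vec_eq_iff algebra_simps)
  define g where "g t = quadric (s (U t) *s P (V t) - s (V t) *s P (U t))" for t
  have pV: "polyfun (\<lambda>t. V t $ i)" for i unfolding V_def by simp (intro polyfun_intros)
  have pU: "polyfun (\<lambda>t. U t $ i)" for i unfolding U_def by (rule polyfun_reflect[OF DW'(2)])
  have pP: "polyfun (\<lambda>t. P (x t) $ i)" if "\<And>i. polyfun (\<lambda>t. x t $ i)" for x i
    unfolding P_def vec_lambda_beta by (intro polyfun_pairing that)
  have ps: "polyfun (\<lambda>t. s (x t))" if "\<And>i. polyfun (\<lambda>t. x t $ i)" for x
    unfolding s_def by (intro polyfun_pairing that)
  have pg: "polyfun g"
    unfolding g_def by (rule polyfun_quadric) (simp, intro polyfun_intros pP ps pU pV)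
  have "U 1 = D' 0 *s w1" by (simp add: U_def DW'(4))
  moreover have "V 1 = vec4 y1 + 0 *s e" by (simp add: V_def y1v)
  moreover have "w1 = vec4 (lift y1) + 1 *s e" by (simp add: w1_def q1 add.commute)
  ultimately have "s (U 1) = D' 0" "P (V 1) = y1" "s (V 1) = 0"
    by (simp_all only: s_lin(2) s_vec P_vec mult_1_right)
  then have "g 1 = quadric (D' 0 *s y1)" by (simp add: g_def)
  then have g1: "g 1 \<noteq> 0" using DW'(3) by (simp add: quadric_scale q1)
  define N where "N = {t. D t = 0} \<union> {t. D' (1 - t) = 0} \<union> {t. g t = 0}"
  have "finite N"
  proof -
    have "finite {t. D t = 0}" by (rule polyfun_finite_zeros[OF DW(1,3)])
    moreover have "finite {t. D' (1 - t) = 0}"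
      by (rule polyfun_finite_zeros[OF polyfun_reflect[OF DW'(1)], of 1]) (use DW'(3) in simp)
    moreover have "finite {t. g t = 0}" by (rule polyfun_finite_zeros[OF pg g1])
    ultimately show ?thesis by (simp add: N_def)
  qed
  have vanish: "F (L *v wedge (V t) (W t)) = 0" if t: "t \<notin> N" for t
  proof -
    have D: "D t \<noteq> 0" "D' (1 - t) \<noteq> 0" "g t \<noteq> 0" using t by (auto simp: N_def)
    have isoU: "\<omega> k (V t) (U t) = 0" for k
      using DW'(5)[OF D(2)] unfolding V' U_def .
    have isoW: "\<omega> k (V t) (W t) = 0" for k using DW(5)[OF D(1)] unfolding V_def .
    \<comment> \<open>A dependence would annihilate \<open>m\<close>, the coordinates of the point
      where the line meets \<open>P\<close>, against \<open>g t \<noteq> 0\<close>.\<close>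
    have "lin_indep [V t, U t]"
    proof (rule ccontr)
      assume "\<not> ?thesis"
      then obtain x y where xy: "x *s V t + y *s U t = 0" "x \<noteq> 0 \<or> y \<noteq> 0" by (auto simp: lin_indep_2)
      have z: "s 0 = 0" "P 0 = 0" using s_lin(2)[of 0 0] P_lin(2)[of 0 0] by simp_all
      have "s (x *s V t + y *s U t) = 0" "P (x *s V t + y *s U t) = 0" unfolding xy(1) by (simp_all add: z)
      then have sP: "x * s (V t) + y * s (U t) = 0" "x *s P (V t) + y *s P (U t) = 0"
        by (simp_all add: s_lin P_lin)
      define m where "m = s (U t) *s P (V t) - s (V t) *s P (U t)"
      have V: "x * s (V t) = - (y * s (U t))" using sP(1) by (simp add: eq_neg_iff_add_eq_0)
      have PV: "x * P (V t) $ i = - (y * P (U t) $ i)" for i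
        using arg_cong[OF sP(2), of "\<lambda>z. z $ i"] by (simp add: eq_neg_iff_add_eq_0)
      have U: "y * s (U t) = - (x * s (V t))" "y * P (U t) $ i = - (x * P (V t) $ i)" for i
        unfolding V PV by simp_all
      have "x * m $ i = s (U t) * (x * P (V t) $ i) - (x * s (V t)) * P (U t) $ i" for i
        by (simp add: m_def algebra_simps)
      then have "x * m $ i = 0" for i unfolding V PV by simp
      moreover have "y * m $ i = (y * s (U t)) * P (V t) $ i - s (V t) * (y * P (U t) $ i)" for i
        by (simp add: m_def algebra_simps)
      then have "y * m $ i = 0" for i unfolding U by simp
      ultimately have "m $ i = 0" for i using xy(2) by auto
      then have "m = 0" by (simp add: vec_eq_iff)
      then show False using D(3) by (simp add: g_def m_def[symmetric] quadric_def)
    qed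
    then obtain x y where "W t = x *s V t + y *s U t"
      using regular_kernel[OF _ _ isoU isoW] DW(6)[OF D(1)] unfolding V_def by blast
    then have "wedge (V t) (W t) = y *s wedge (V t) (U t)" by (simp add: wedge_simps)
    moreover have "F (L *v wedge (V t) (U t)) = 0"
      by (rule good[OF isoU]) (use D(3) in \<open>simp add: g_def\<close>)
    ultimately show ?thesis by (simp only: vec.scale F0)
  qed
  have pF: "polyfun (\<lambda>t. F (L *v wedge (V t) (W t)))"
    by (intro poly polyfun_mv polyfun_wedge pV DW(2))
  have "infinite {t. F (L *v wedge (V t) (W t)) = 0}"
  proof (rule infinite_super)
    show "- N \<subseteq> {t. F (L *v wedge (V t) (W t)) = 0}" using vanish by blast
    show "infinite (- N)" using \<open>finite N\<close> infinite_UNIV_char_0[where 'a = complex] by (metis finite_compl)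
  qed
  then have "F (L *v wedge (V 0) (W 0)) = 0" by (rule polyfun_zero[OF pF])
  moreover have "L *v wedge (V 0) (W 0) = D 0 *s (L *v wedge v w)"
    unfolding w0 by (simp add: V_def DW(4) wedge_simps vec.scale)
  ultimately show ?thesis using DW(3) by (simp add: homog)
qed

end

subsection \<open>The frame attached to a conic\<close>

lemma algebraic_wedge: "algebraic_vec v \<Longrightarrow> algebraic_vec w \<Longrightarrow> algebraic_vec (wedge v w)"
  by (auto simp: algebraic_vec_def wedge_def intro!: algebraic_intros)

text \<open>Everything is read off from coordinates in the basis \<open>vs\<close>: a basis of the
  section followed by the three complementary wedges. These are independent modulo the section
  because a form vanishing on all three would vanish on all of \<open>P\<close>.\<close>

lemma exists_section_frame:
  fixes M :: "complex ^ 7 ^ (5 \<times> 5)"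
  assumes M: "transversal_section M" and M_alg: "\<And>i j. algebraic (M $ i $ j)"
    and alg: "algebraic_vec a" "algebraic_vec b" "algebraic_vec c" "algebraic_vec d"
    and basis: "lin_indep [a, b, c, d, e]"
    and M_x: "M *v x0 = wedge a b" "M *v x1 = wedge a d - wedge b c" "M *v x2 = wedge c d"
  obtains \<omega> L t1 t2 t3 where "section_frame \<omega> M L a b c d e t1 t2 t3 x0 x1 x2"
    "\<And>i j. algebraic (L $ i $ j)" "algebraic_vec t1" "algebraic_vec t2" "algebraic_vec t3"
proof -
  have inj: "inj ((*v) M)" and M_alt: "M *v x \<in> alternating_tensors" for x
    using M unfolding transversal_section_def by auto
  obtain \<theta> :: "3 \<Rightarrow> complex ^ (5 \<times> 5)" where
    \<theta>: "\<And>t. t \<in> alternating_tensors \<Longrightarrow> t \<in> range ((*v) M) \<longleftrightarrow> (\<forall>i. pairing (\<theta> i) t = 0)"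
    and net: "net (\<lambda>c v w. \<Sum>i\<in>UNIV. c $ i * pairing (\<theta> i) (wedge v w))"
    by (rule transversal_section_net[OF M]) blast
  define \<Theta> where "\<Theta> c t = (\<Sum>i\<in>UNIV. c $ i * pairing (\<theta> i) t)" for c t
  define \<omega> where "\<omega> c v w = \<Theta> c (wedge v w)" for c v w
  have "\<omega> = (\<lambda>c v w. \<Sum>i\<in>UNIV. c $ i * pairing (\<theta> i) (wedge v w))"
    by (intro ext) (simp add: \<omega>_def \<Theta>_def)
  then interpret net \<omega> using net by simp
  have \<Theta>: "\<Theta> k (s + t) = \<Theta> k s + \<Theta> k t" "\<Theta> k (r *s s) = r * \<Theta> k s" "\<Theta> k (s - t) = \<Theta> k s - \<Theta> k t" for k s t r
    by (simp_all add: \<Theta>_def pairing_simps distrib_left right_diff_distrib sum.distrib sum_subtractf sum_distrib_left mult_ac)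
  have \<theta>M: "pairing (\<theta> i) (M *v x) = 0" for i x using \<theta>[OF M_alt] by blast
  have \<Theta>M: "\<Theta> k (M *v x) = 0" for k x by (simp add: \<Theta>_def \<theta>M)
  have iff: "wedge v w \<in> range ((*v) M) \<longleftrightarrow> (\<forall>k. \<omega> k v w = 0)" for v w
  proof
    assume "\<forall>k. \<omega> k v w = 0"
    then have "\<omega> (axis i 1) v w = 0" for i by blast
    then have "pairing (\<theta> i) (wedge v w) = 0" for i by (simp only: \<omega>_def \<Theta>_def sum_axis)
    then show "wedge v w \<in> range ((*v) M)" using \<theta>[OF wedge_alternating] by blast
  next
    assume "wedge v w \<in> range ((*v) M)"
    then show "\<forall>k. \<omega> k v w = 0" using \<Theta>M by (auto simp: \<omega>_def)
  qed
  have ab: "\<omega> k a b = 0" and cd: "\<omega> k c d = 0" for k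
    using \<Theta>M[of k x0] \<Theta>M[of k x2] unfolding M_x \<omega>_def .
  have ad_bc: "\<omega> k a d = \<omega> k b c" for k
    using \<Theta>M[of k x1] unfolding M_x \<omega>_def \<Theta> by simp
  have sym: "\<omega> k y x = 0" if "\<omega> k x y = 0" for k x y using that skew[of k y x] by simp
  have no_kernel: "k = 0" if ac: "\<omega> k a c = 0" and bd: "\<omega> k b d = 0" and ad: "\<omega> k a d = 0" for k
  proof -
    have ind: "lin_indep [a, b, c, d]"
    proof (rule lin_indep_mono[OF basis])
      show "distinct [a, b, c, d]" using basis unfolding lin_indep_iff by simp
    qed auto
    have bc: "\<omega> k b c = 0" using ad ad_bc by simp
    have "\<forall>x\<in>set [a, b, c, d]. \<forall>y\<in>set [a, b, c, d]. \<omega> k x y = 0"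
      by (simp add: alt ab cd ac bd ad bc ab[THEN sym] cd[THEN sym] ac[THEN sym] bd[THEN sym] ad[THEN sym] bc[THEN sym])
    then show "k = 0" by (intro no_isotropic4[OF ind]) auto
  qed
  obtain es :: "(complex ^ 7) list" where es: "lin_indep es" "length es = CARD(7)" "\<And>v. v \<in> set es \<Longrightarrow> algebraic_vec v"
    by (rule axis_basis) blast
  have len: "length es = 7" using es(2) by simp
  define vs where "vs = map ((*v) M) es @ [wedge a c, wedge b d, wedge a d]"
  have lenv: "length vs = 10" by (simp add: vs_def len)
  have vs_nth: "vs ! i = M *v es ! i" if "i < 7" for i using that by (simp add: vs_def nth_append len)
  have vs_last: "vs ! 7 = wedge a c" "vs ! 8 = wedge b d" "vs ! 9 = wedge a d"
    by (simp_all add: vs_def nth_append len)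
  have vs_lin: "lincomb \<kappa> vs = M *v lincomb \<kappa> es + (\<kappa> 7 *s wedge a c + \<kappa> 8 *s wedge b d + \<kappa> 9 *s wedge a d)" for \<kappa>
    by (simp add: vs_def lincomb_append mv_lincomb len add.assoc)
  have vs_alt: "set vs \<subseteq> alternating_tensors" using M_alt wedge_alternating by (auto simp: vs_def)
  have ind: "lin_indep vs"
    unfolding lin_indep_def
  proof (intro allI impI)
    fix \<kappa> i assume 0: "lincomb \<kappa> vs = 0" and i: "i < length vs"
    define \<tau> where "\<tau> = \<kappa> 7 *s wedge a c + \<kappa> 8 *s wedge b d + \<kappa> 9 *s wedge a d"
    have \<tau>0: "\<Theta> k \<tau> = 0" for k
    proof -
      have "\<Theta> k (M *v lincomb \<kappa> es + \<tau>) = 0"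
        using 0 unfolding vs_lin \<tau>_def[symmetric] by (simp add: \<Theta>_def pairing_def)
      then show ?thesis by (simp add: \<Theta> \<Theta>M)
    qed
    \<comment> \<open>A nontrivial combination \<open>\<tau>\<close> of the wedges inside the
      section is a linear relation between three functionals on the net. Such functionals have a
      common nonzero zero, the form excluded by \<open>no_kernel\<close>.\<close>
    have "\<kappa> (7 + k) = 0" if "k < 3" for k
    proof (rule ccontr)
      assume ne: "\<kappa> (7 + k) \<noteq> 0"
      obtain fs :: "(complex ^ 3) list" where fs: "lin_indep fs" "length fs = CARD(3)" by (rule axis_basis)
      define p where "p = (!) [(a, c), (b, d), (a, d)]"
      define g where "g k i = \<omega> (fs ! i) (fst (p k)) (snd (p k))" for k i
      have "(\<Sum>k<3. \<kappa> (7 + k) * g k i) = \<Theta> (fs ! i) \<tau>" for i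
        unfolding \<tau>_def \<Theta> g_def \<omega>_def by (simp add: numeral_3_eq_3 p_def eval_nat_numeral)
      then have s: "(\<Sum>k<3. \<kappa> (7 + k) * g k i) = 0" for i unfolding \<tau>0 .
      obtain x where x: "\<exists>i<3. x i \<noteq> 0" "\<And>k. k < 3 \<Longrightarrow> (\<Sum>i<3. x i * g k i) = 0"
        by (rule dependent_functionals[of k 3 "\<lambda>k. \<kappa> (7 + k)" g, OF \<open>k < 3\<close> ne s]) blast
      have "\<omega> (lincomb x fs) (fst (p k)) (snd (p k)) = 0" if "k < 3" for k
        using x(2)[OF that] fs(2) by (simp add: lincomb1 g_def)
      from this[of 0] this[of 1] this[of 2] have "lincomb x fs = 0"
        by (intro no_kernel) (simp_all add: p_def)
      moreover have "lincomb x fs \<noteq> 0" using x(1) lin_indep_lincomb_ne_0[OF fs(1)] fs(2) by auto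
      ultimately show False by simp
    qed
    note big = this
    from big[of 0] big[of 1] big[of 2] have \<tau>: "\<kappa> 7 = 0" "\<kappa> 8 = 0" "\<kappa> 9 = 0" by simp_all
    then have "M *v lincomb \<kappa> es = M *v 0" using 0 unfolding vs_lin by simp
    then have "lincomb \<kappa> es = 0" by (rule injD[OF inj])
    then have small: "\<kappa> i = 0" if "i < 7" for i using es(1) \<open>lincomb \<kappa> es = 0\<close> len that unfolding lin_indep_def by simp
    have "i < 7 \<or> i = 7 \<or> i = 8 \<or> i = 9" using i lenv by linarith
    then show "\<kappa> i = 0" using small \<tau> by blast
  qed
  have vs_alg: "algebraic_vec v" if "v \<in> set vs" for v
    using that es(3) alg by (auto simp: vs_def intro!: algebraic_mv M_alg algebraic_wedge)
  have "\<forall>k. \<exists>\<xi>. k < 10 \<longrightarrow> algebraic_vec \<xi> \<and> (\<forall>j<10. pairing \<xi> (vs ! j) = (if j = k then 1 else 0))"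
  proof
    fix k
    show "\<exists>\<xi>. k < 10 \<longrightarrow> algebraic_vec \<xi> \<and> (\<forall>j<10. pairing \<xi> (vs ! j) = (if j = k then 1 else 0))"
    proof (cases "k < 10")
      case True
      show ?thesis
      proof (rule algebraic_dual[OF ind _ vs_alg])
        show "k < length vs" using True lenv by simp
        fix \<xi> assume "algebraic_vec \<xi>" "\<And>j. j < length vs \<Longrightarrow> pairing \<xi> (vs ! j) = (if j = k then 1 else 0)"
        then show ?thesis using lenv by auto
      qed
    qed simp
  qed
  from choice[OF this] obtain \<xi> where \<xi>_alg: "\<And>k. k < 10 \<Longrightarrow> algebraic_vec (\<xi> k)"
    and \<xi>: "\<And>k j. k < 10 \<Longrightarrow> j < 10 \<Longrightarrow> pairing (\<xi> k) (vs ! j) = (if j = k then 1 else 0)" by blast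
  \<comment> \<open>Recombines the first seven dual coordinates of a tensor in the basis
    \<open>es\<close>.\<close>
  define L :: "complex ^ (5 \<times> 5) ^ 7" where "L = (\<chi> r. lincomb (\<lambda>i. (es ! i) $ r) (map \<xi> [0..<7]))"
  have L_eq: "L *v t = lincomb (\<lambda>i. pairing (\<xi> i) t) es" for t
  proof -
    have "(L *v t) $ r = pairing (L $ r) t" for r
      by (simp add: matrix_vector_mult_def pairing_def)
    also have "pairing (L $ r) t = lincomb (\<lambda>i. pairing (\<xi> i) t) es $ r" for r
      unfolding L_def vec_lambda_beta pairing_commute[of _ t] pairing_lincomb
      by (simp add: lincomb_def sum_component len mult.commute)
    finally show ?thesis by (simp add: vec_eq_iff)
  qed
  have \<xi>_lin: "pairing (\<xi> k) (lincomb \<kappa> vs) = \<kappa> k" if "k < 10" for k \<kappa>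
  proof -
    have "pairing (\<xi> k) (lincomb \<kappa> vs) = (\<Sum>j<10. \<kappa> j * (if j = k then 1 else 0))"
      unfolding pairing_lincomb lenv by (rule sum.cong) (use \<xi>[OF that] in auto)
    also have "\<dots> = (\<Sum>j<10. if j = k then \<kappa> j else 0)" by (rule sum.cong) auto
    also have "\<dots> = \<kappa> k" using that by simp
    finally show ?thesis .
  qed
  have lincomb_es: "lincomb \<kappa> es = lincomb \<mu> es" if "\<And>i. i < 7 \<Longrightarrow> \<kappa> i = \<mu> i" for \<kappa> \<mu>
    unfolding lincomb_def len using that by (intro sum.cong) auto
  have tM: "pairing (\<xi> k) (M *v x) = 0" if k: "k < 10" "\<not> k < 7" for k x
  proof -
    obtain \<kappa> where "x = lincomb \<kappa> es" using lin_indep_basis[OF es(1,2)] by blast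
    moreover have "lincomb \<kappa> es = lincomb (\<lambda>i. if i < 7 then \<kappa> i else 0) es" by (rule lincomb_es) simp
    ultimately have "M *v x = lincomb (\<lambda>i. if i < 7 then \<kappa> i else 0) vs" by (simp add: vs_lin)
    then show ?thesis using \<xi>_lin[OF k(1)] k(2) by simp
  qed
  have section_inv: "M *v (L *v t) = t"
    if t: "t \<in> alternating_tensors" "pairing (\<xi> 7) t = 0" "pairing (\<xi> 8) t = 0" "pairing (\<xi> 9) t = 0" for t
  proof -
    obtain \<kappa> where \<kappa>: "t = lincomb \<kappa> vs" using alternating_basis[OF ind lenv vs_alt t(1)] by blast
    have "L *v t = lincomb \<kappa> es" unfolding L_eq \<kappa> by (rule lincomb_es) (simp add: \<xi>_lin)
    moreover have "\<kappa> 7 = 0" "\<kappa> 8 = 0" "\<kappa> 9 = 0" using t(2-4) unfolding \<kappa> by (simp_all add: \<xi>_lin)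
    ultimately show ?thesis by (simp add: \<kappa> vs_lin)
  qed
  have L0: "L *v (vs ! j) = 0" if "j < 10" "\<not> j < 7" for j
  proof -
    have "L *v (vs ! j) = lincomb (\<lambda>_. 0) es" unfolding L_eq by (rule lincomb_es) (use \<xi> that in auto)
    then show ?thesis by simp
  qed
  have "section_frame \<omega> M L a b c d e (\<xi> 7) (\<xi> 8) (\<xi> 9) x0 x1 x2"
  proof (unfold_locales)
    fix x
    show tMx: "pairing (\<xi> 7) (M *v x) = 0" "pairing (\<xi> 8) (M *v x) = 0" "pairing (\<xi> 9) (M *v x) = 0"
      by (simp_all add: tM)
    show "L *v (M *v x) = x" by (rule injD[OF inj section_inv[OF M_alt tMx]])
  next
    show "L *v wedge a c = 0" "L *v wedge b d = 0" "L *v wedge a d = 0"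
      using L0[of 7] L0[of 8] L0[of 9] unfolding vs_last by simp_all
    show "pairing (\<xi> 7) (wedge a c) = 1" "pairing (\<xi> 7) (wedge b d) = 0" "pairing (\<xi> 7) (wedge a d) = 0"
      "pairing (\<xi> 8) (wedge a c) = 0" "pairing (\<xi> 8) (wedge b d) = 1" "pairing (\<xi> 8) (wedge a d) = 0"
      "pairing (\<xi> 9) (wedge a c) = 0" "pairing (\<xi> 9) (wedge b d) = 0" "pairing (\<xi> 9) (wedge a d) = 1"
      unfolding vs_last[symmetric] by (simp_all add: \<xi>)
  qed (fact basis iff ad_bc M_x section_inv[OF wedge_alternating])+
  moreover have "algebraic (L $ i $ j)" for i j
  proof -
    have "algebraic ((es ! k) $ i)" "algebraic (\<xi> k $ j)" if "k < 7" for k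
    proof -
      have "algebraic_vec (es ! k)" "algebraic_vec (\<xi> k)" using that es(3)[of "es ! k"] \<xi>_alg[of k] len by simp_all
      then show "algebraic ((es ! k) $ i)" "algebraic (\<xi> k $ j)" unfolding algebraic_vec_def by blast+
    qed
    then show ?thesis
      unfolding L_def lincomb_def by (auto simp: sum_component intro!: algebraic_intros)
  qed
  ultimately show ?thesis using that \<xi>_alg by simp
qed

context section_frame
begin

text \<open>With the denominator \<open>quadric y\<close> cleared, only ring operations on
  \<open>y\<close> and on the entries of the frame occur.\<close>

lemma ring_set_L_point:
  assumes R: "ring_set R" and y: "\<And>i. y $ i \<in> R"
    and abcd: "\<And>v i. v \<in> {a, b, c, d, e} \<Longrightarrow> v $ i \<in> R"
    and t: "\<And>t p. t \<in> {t1, t2, t3} \<Longrightarrow> t $ p \<in> R" and L: "\<And>i p. L $ i $ p \<in> R"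
  shows "(L *v point y) $ i \<in> R"
proof -
  note r = ring_setD[OF R]
  have v: "vec4 z $ i \<in> R" if "\<And>i. z $ i \<in> R" for z i
    unfolding vec4_def vector_add_component vector_smult_component by (intro r that abcd) auto
  have w: "wedge v w $ p \<in> R" if "\<And>i. v $ i \<in> R" "\<And>i. w $ i \<in> R" for v w p
    unfolding wedge_def vec_lambda_beta by (intro r that)
  have "pairing t (wedge (vec4 y) e) \<in> R" if "t \<in> {t1, t2, t3}" for t
    by (intro ring_set_pairing[OF R] w v y t[OF that] abcd) auto
  then have t: "pairing t1 (wedge (vec4 y) e) \<in> R" "pairing t2 (wedge (vec4 y) e) \<in> R" "pairing t3 (wedge (vec4 y) e) \<in> R"
    by blast+
  have l: "lift y $ i \<in> R" for i
    using exhaust_4[of i] by (elim disjE) (simp_all add: lift_def r t y)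
  have q: "quadric y \<in> R" unfolding quadric_def by (intro r y)
  have p: "point y $ p \<in> R" for p
    unfolding point_def
  proof (rule w)
    show "vec4 y $ i \<in> R" for i by (intro v y)
    have "e $ i \<in> R" for i by (rule abcd) simp
    then show "(quadric y *s e + vec4 (lift y)) $ i \<in> R" for i
      unfolding vector_add_component vector_smult_component by (intro r q v l)
  qed
  have "pairing (L $ i) (point y) \<in> R" by (rule ring_set_pairing[OF R L p])
  then show ?thesis by (simp add: matrix_vector_mult_def pairing_def)
qed

lemma algebraic_param:
  assumes "algebraic_vec a" "algebraic_vec b" "algebraic_vec c" "algebraic_vec d" "algebraic_vec e"
    and "\<And>i p. algebraic (L $ i $ p)" and "algebraic_vec h"
  shows "algebraic_vec (param h)"
proof -
  have "algebraic_vec (vec4 (axis i 1))" for i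
    unfolding vec4_def by (intro algebraic_vec_intros assms) (auto simp: axis_def intro!: algebraic_intros)
  then have "algebraic (pairing h (L *v wedge (vec4 (axis i 1)) e))" for i
    by (intro algebraic_pairing algebraic_mv algebraic_wedge assms)
  then show ?thesis by (simp add: algebraic_vec_def param_def)
qed

lemma param_linear: "param (s *s h + t *s k) = s *s param h + t *s param k"
  by (simp add: param_def vec_eq_iff pairing_add_left pairing_scale_left)

lemma decomposable_point:
  assumes "q \<noteq> 0" "L *v point y \<noteq> 0"
  shows "M *v (q *s (L *v point y)) \<in> grassmannian25"
proof -
  have "M *v (q *s (L *v point y)) = q *s point y" unfolding vec.scale M_point ..
  also have "\<dots> = wedge (vec4 y) (q *s (quadric y *s e + vec4 (lift y)))"
    by (simp add: point_def wedge_simps)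
  finally have eq: "M *v (q *s (L *v point y)) = wedge (vec4 y) (q *s (quadric y *s e + vec4 (lift y)))" .
  have "M *v (q *s (L *v point y)) \<noteq> 0"
  proof
    assume "M *v (q *s (L *v point y)) = 0"
    then have "q *s (L *v point y) = 0" using LM[of "q *s (L *v point y)"] by simp
    then show False using assms by simp
  qed
  then show ?thesis unfolding grassmannian25_def eq by blast
qed

end

section \<open>Assembly of the integral points and their density\<close>

theorem mainTheorem6:
  fixes K :: "complex set" and B H1 H2 C :: "(complex ^ 7) set"
  assumes "number_field K"
    and "del_Pezzo_B5 K B"
    and "hyperplane_section K B H1" and "hyperplane_section K B H2" and "H1 \<noteq> H2"
    and "smooth_conic C" and "C \<subseteq> H1 \<inter> H2"
  shows "integral_points_potentially_dense K B (H1 \<union> H2)"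
proof -
  obtain M where M: "transversal_section M" "\<And>i j. algebraic (M $ i $ j)" and B: "B = {x. M *v x \<in> grassmannian25}"
    using assms(2) unfolding del_Pezzo_B5_def by blast
  obtain h1 where h1: "h1 \<noteq> 0" "\<And>i. h1 $ i \<in> K" and H1: "H1 = {x \<in> B. pairing h1 x = 0}"
    using assms(3) unfolding hyperplane_section_def pairing_def by blast
  obtain h2 where h2: "h2 \<noteq> 0" "\<And>i. h2 $ i \<in> K" and H2: "H2 = {x \<in> B. pairing h2 x = 0}"
    using assms(4) unfolding hyperplane_section_def pairing_def by blast
  have CB: "C \<subseteq> {x. M *v x \<in> grassmannian25}" using assms(7) unfolding H1 B by blast
  obtain a b c d e x0 x1 x2 where
    alg: "algebraic_vec a" "algebraic_vec b" "algebraic_vec c" "algebraic_vec d" "algebraic_vec e"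
    and basis: "lin_indep [a, b, c, d, e]"
    and M_x: "M *v x0 = wedge a b" "M *v x1 = wedge a d - wedge b c" "M *v x2 = wedge c d"
    and kill: "\<And>h. (\<And>x. x \<in> C \<Longrightarrow> pairing h x = 0) \<Longrightarrow> pairing h x0 = 0 \<and> pairing h x1 = 0 \<and> pairing h x2 = 0"
    by (rule conic_normal_form[OF M assms(6) CB]) blast
  obtain \<omega> L t1 t2 t3 where frame: "section_frame \<omega> M L a b c d e t1 t2 t3 x0 x1 x2"
    and L_alg: "\<And>i j. algebraic (L $ i $ j)" and t_alg: "algebraic_vec t1" "algebraic_vec t2" "algebraic_vec t3"
    by (rule exists_section_frame[OF M alg(1-4) basis M_x]) blast
  interpret section_frame \<omega> M L a b c d e t1 t2 t3 x0 x1 x2 by (rule frame)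
  have k1: "pairing h1 x0 = 0" "pairing h1 x1 = 0" "pairing h1 x2 = 0"
    using kill[of h1] assms(7) unfolding H1 by blast+
  have k2: "pairing h2 x0 = 0" "pairing h2 x1 = 0" "pairing h2 x2 = 0"
    using kill[of h2] assms(7) unfolding H2 by blast+
  have h_alg: "algebraic_vec h1" "algebraic_vec h2"
    using number_field_imp_algebraic[OF assms(1)] h1(2) h2(2) by (auto simp: algebraic_vec_def)
  have m_alg: "algebraic_vec (param h1)" "algebraic_vec (param h2)"
    using algebraic_param[OF alg L_alg] h_alg by blast+
  \<comment> \<open>A dependence between the two planes would by \<open>param_eq_0\<close> be one
    between the hyperplane equations, hence the sections would agree; this is where
    \<open>H1 \<noteq> H2\<close> enters.\<close>
  have m_ind: "lin_indep [param h1, param h2]"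
    unfolding lin_indep_2
  proof (intro allI impI)
    fix s t assume 0: "s *s param h1 + t *s param h2 = 0"
    have "s *s h1 + t *s h2 = 0"
    proof (rule param_eq_0)
      show "M *v x \<in> alternating_tensors" for x using M(1) unfolding transversal_section_def by auto
    qed (simp_all add: param_linear 0 pairing_add_left pairing_scale_left k1 k2)
    then have st: "s * pairing h1 x + t * pairing h2 x = 0" for x
      using pairing_add_left[of "s *s h1" "t *s h2" x] by (simp add: pairing_scale_left) (simp add: pairing_def)
    have "s = 0 \<or> t = 0"
    proof (rule ccontr)
      assume "\<not> (s = 0 \<or> t = 0)"
      then have "pairing h1 x = 0 \<longleftrightarrow> pairing h2 x = 0" for x using st[of x] by auto
      then show False using assms(5) unfolding H1 H2 by simp
    qed
    then show "s = 0 \<and> t = 0"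
      using \<open>s *s h1 + t *s h2 = 0\<close> h1(1) h2(1) by auto
  qed
  obtain A where A: "finite A" "\<And>a. a \<in> A \<Longrightarrow> algebraic a"
    and dense: "\<And>G d y. (\<And>y z. polyfun (\<lambda>t. G (y + t *s z))) \<Longrightarrow> (\<And>c y. G (c *s y) = c ^ d * G y) \<Longrightarrow>
       (\<And>y. y \<in> unit_values A (param h1) (param h2) \<Longrightarrow> G y = 0) \<Longrightarrow> G y = 0"
    by (rule unit_values_dense[OF m_alg m_ind]) blast
  \<comment> \<open>The entries of the frame, of the equations \<open>t1\<close>, \<open>t2\<close>,
    \<open>t3\<close>, of \<open>L\<close> and of both hyperplanes join \<open>A\<close>. They lie
    in a number field \<open>F\<close> and are integral at almost all of its places.\<close>
  define A1 where "A1 = (\<lambda>(v, i). v $ i) ` ({a, b, c, d, e} \<times> UNIV)"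
  define A2 where "A2 = (\<lambda>(t, p). t $ p) ` ({t1, t2, t3} \<times> UNIV)"
  define A3 where "A3 = (\<lambda>(j, p). L $ j $ p) ` UNIV"
  define A4 where "A4 = (\<lambda>(h, j). h $ j) ` ({h1, h2} \<times> UNIV)"
  define A' where "A' = A \<union> A1 \<union> A2 \<union> A3 \<union> A4"
  have "v $ i \<in> A1" if "v \<in> {a, b, c, d, e}" for v i
    unfolding A1_def by (rule image_eqI[of _ _ "(v, i)"]) (use that in \<open>simp_all only: prod.case mem_Sigma_iff UNIV_I simp_thms\<close>)
  moreover have "t $ p \<in> A2" if "t \<in> {t1, t2, t3}" for t p
    unfolding A2_def by (rule image_eqI[of _ _ "(t, p)"]) (use that in \<open>simp_all only: prod.case mem_Sigma_iff UNIV_I simp_thms\<close>)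
  moreover have "L $ j $ p \<in> A3" for j p
    unfolding A3_def by (rule image_eqI[of _ _ "(j, p)"]) (simp_all only: prod.case UNIV_I)
  moreover have "h $ j \<in> A4" if "h \<in> {h1, h2}" for h j
    unfolding A4_def by (rule image_eqI[of _ _ "(h, j)"]) (use that in \<open>simp_all only: prod.case mem_Sigma_iff UNIV_I simp_thms\<close>)
  ultimately have coord: "v \<in> {a, b, c, d, e} \<Longrightarrow> v $ i \<in> A'" "t \<in> {t1, t2, t3} \<Longrightarrow> t $ p \<in> A'"
    "L $ j $ p \<in> A'" "h \<in> {h1, h2} \<Longrightarrow> h $ j \<in> A'" for v t h i j p
    unfolding A'_def Un_iff by (simp_all only: simp_thms)
  have "finite A'" using A(1) by (simp add: A'_def A1_def A2_def A3_def A4_def)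
  have v_alg: "algebraic_vec v" if "v \<in> {a, b, c, d, e}" for v using that alg by blast
  have t'_alg: "algebraic_vec t" if "t \<in> {t1, t2, t3}" for t using that t_alg by blast
  have h'_alg: "algebraic_vec h" if "h \<in> {h1, h2}" for h using that h_alg by blast
  have "algebraic x" if "x \<in> A1" for x
    using that unfolding A1_def
  proof (elim imageE SigmaE)
    fix z v i assume x: "x = (case z of (v, i) \<Rightarrow> v $ i)" and z: "z = (v, i)" and "v \<in> {a, b, c, d, e}"
    then have "algebraic_vec v" by (intro v_alg)
    then show "algebraic x" unfolding x z prod.case algebraic_vec_def by blast
  qed
  moreover have "algebraic x" if "x \<in> A2" for x
    using that unfolding A2_def
  proof (elim imageE SigmaE)
    fix z t p assume x: "x = (case z of (t, p) \<Rightarrow> t $ p)" and z: "z = (t, p)" and "t \<in> {t1, t2, t3}"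
    then have "algebraic_vec t" by (intro t'_alg)
    then show "algebraic x" unfolding x z prod.case algebraic_vec_def by blast
  qed
  moreover have "algebraic x" if "x \<in> A3" for x
    using that L_alg unfolding A3_def by (elim imageE) (simp only: split_beta)
  moreover have "algebraic x" if "x \<in> A4" for x
    using that unfolding A4_def
  proof (elim imageE SigmaE)
    fix z h j assume x: "x = (case z of (h, j) \<Rightarrow> h $ j)" and z: "z = (h, j)" and "h \<in> {h1, h2}"
    then have "algebraic_vec h" by (intro h'_alg)
    then show "algebraic x" unfolding x z prod.case algebraic_vec_def by blast
  qed
  ultimately have "algebraic x" if "x \<in> A'" for x
    using that A(2) unfolding A'_def by blast
  then obtain F where F: "number_field F" "K \<subseteq> F" "A' \<subseteq> F"
    using number_field_adjoin[OF assms(1) \<open>finite A'\<close>] by blast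
  obtain S where S: "finite S" "S \<subseteq> finite_places F" "\<And>p. p \<in> finite_places F - S \<Longrightarrow> A' \<subseteq> place_ring F p"
    using almost_all_places_integral[OF F(1) \<open>finite A'\<close> F(3)] by blast
  \<comment> \<open>Division by the unit \<open>quadric y\<close> leaves the hyperplane equations
    with the values of the two planes at \<open>y\<close>, namely \<open>1\<close> and a
    unit.\<close>
  define P where "P y = inverse (quadric y) *s (L *v point y)" for y
  have h_P: "pairing h1 (P y) = pairing (param h1) y" "pairing h2 (P y) = pairing (param h2) y" if "quadric y \<noteq> 0" for y
    using that by (simp_all add: P_def pairing_simps pairing_L_point[OF k1] pairing_L_point[OF k2])
  have P_R: "P y $ i \<in> R" if y: "y \<in> unit_values A (param h1) (param h2)" and R: "ring_set R" "A' \<subseteq> R" for y R i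
  proof -
    have "A \<subseteq> R" using R(2) by (auto simp: A'_def)
    then have yR: "\<And>i. y $ i \<in> R" and "inverse (quadric y) \<in> R" using y R(1) unfolding unit_values_def by blast+
    moreover have "(L *v point y) $ i \<in> R"
    proof (rule ring_set_L_point[OF R(1) yR])
      show "v $ i \<in> R" if "v \<in> {a, b, c, d, e}" for v i using coord(1)[OF that] R(2) by blast
      show "t $ p \<in> R" if "t \<in> {t1, t2, t3}" for t p using coord(2)[OF that] R(2) by blast
      show "L $ i $ p \<in> R" for i p using coord(3) R(2) by blast
    qed
    ultimately show ?thesis unfolding P_def vector_smult_component by (intro ring_setD(4)[OF R(1)])
  qed
  have integral: "P y \<in> S_integral_points F S B (H1 \<union> H2)" if y: "y \<in> unit_values A (param h1) (param h2)" for y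
    unfolding S_integral_points_def mem_Collect_eq
  proof (intro conjI allI ballI)
    have q: "quadric y \<noteq> 0" and u: "pairing (param h1) y = 1" "pairing (param h2) y \<noteq> 0"
      using y by (auto simp: unit_values_def)
    have "P y \<noteq> 0" using h_P(1)[OF q] u(1) by (auto simp: pairing_def)
    then have "P y \<in> B" unfolding B P_def using q by (auto intro!: decomposable_point)
    then show "P y \<in> B - (H1 \<union> H2)" unfolding H1 H2 using h_P[OF q] u by simp
    show "P y $ i \<in> F" for i
      using P_R[OF y field_set_imp_ring_set[OF number_field_imp_field_set[OF F(1)]] F(3)] .
    fix p assume p: "p \<in> finite_places F - S"
    have R: "ring_set (place_ring F p)" using ring_set_place_ring(1) p by blast
    have A'R: "A' \<subseteq> place_ring F p" by (rule S(3)[OF p])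
    then have hR: "h1 $ i \<in> place_ring F p" "h2 $ i \<in> place_ring F p" for i using coord(4)[of h1] coord(4)[of h2] by blast+
    have "inverse (pairing (param h2) y) \<in> place_ring F p"
      using y R A'R unfolding unit_values_def A'_def by blast
    then show "\<not> reduces_into F p (H1 \<union> H2) (P y)"
      using p hR h_P[OF q] u P_R[OF y R A'R] ring_setD(2)[OF R]
      by (intro not_reduces_into[of p F h1 h2]) (auto simp: H1 H2)
  qed
  have "B \<subseteq> zariski_closure (S_integral_points F S B (H1 \<union> H2))"
    unfolding zariski_closure_def proj_zeros_def
  proof (intro subsetI CollectI conjI ballI)
    fix x assume x: "x \<in> B"
    then obtain v w where vw: "M *v x = wedge v w" "wedge v w \<noteq> 0" by (auto simp: B grassmannian25_def)
    then show "x \<noteq> 0" by auto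
    fix f assume "f \<in> {f \<in> forms_over UNIV. \<forall>x\<in>S_integral_points F S B (H1 \<union> H2). poly_eval f x = 0}"
    then have f: "f \<in> forms_over UNIV" "\<And>x. x \<in> S_integral_points F S B (H1 \<union> H2) \<Longrightarrow> poly_eval f x = 0" by auto
    obtain n where n: "\<And>c x. poly_eval f (c *s x) = c ^ n * poly_eval f x"
      using forms_over_homogeneous[OF f(1)] by blast
    \<comment> \<open>The form pulled back along the parametrization vanishes on the unit values, so
      it vanishes identically, also on the quadric.\<close>
    have zero: "poly_eval f (L *v point y) = 0" for y
    proof (rule dense)
      show "polyfun (\<lambda>t. poly_eval f (L *v point (y + t *s z)))" for y z
      proof (intro polyfun_poly_eval polyfun_mv polyfun_point)
        show "polyfun (\<lambda>t. (y + t *s z) $ i)" for i by simp (intro polyfun_intros)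
      qed
      \<comment> \<open>The parametrization is cubic, which turns degree \<open>n\<close> into
        \<open>3 * n\<close>.\<close>
      show "poly_eval f (L *v point (c *s y)) = c ^ (3 * n) * poly_eval f (L *v point y)" for c y
        unfolding point_scale vec.scale n power_mult ..
      fix y assume y: "y \<in> unit_values A (param h1) (param h2)"
      then have "quadric y \<noteq> 0" by (simp add: unit_values_def)
      moreover have "inverse (quadric y) ^ n * poly_eval f (L *v point y) = 0"
        using f(2)[OF integral[OF y]] unfolding P_def n .
      ultimately show "poly_eval f (L *v point y) = 0" by simp
    qed
    have "\<omega> k v w = 0" for k using in_section_iff[of v w] vw(1) by (metis rangeI)
    from vanishes_on_section[of "poly_eval f" n, OF polyfun_poly_eval n zero this vw(2)]
    show "poly_eval f x = 0" unfolding vw(1)[symmetric] LM by blast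
  qed
  then show ?thesis unfolding integral_points_potentially_dense_def using F(1,2) S(1,2) by blast
qed

end
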